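(* Let $1\le m<d$, $n=d-m$, and let $A\in\mathbb R^{d\times m}$ have full column rank. With the notation of the context, the map $$\Phi_A:\mathscr B_A\times\mathscr P_n\to\mathscr P_d,\qquad \Phi_A(B,\Sigma)=QL(B)\begin{pmatrix}M(B)&0\\0&\rho(B)\Sigma\end{pmatrix}L(B)^\top Q^\top$$ is a global real-analytic diffeomorphism satisfying $\pi_A(\Phi_A(B,\Sigma))=B$. Consequently $$\mathscr P_d\cong\mathscr B_A\times\mathscr P_{d-m},\qquad \mathscr B_A\cong\mathbb S_{++}^m\times\mathbb R^{n\times m}$$ (real-analytic diffeomorphisms). For every $B\in\mathscr B_A$ the fiber $$\mathscr F_A(B)=\{P\in\mathscr P_d:PA=B\}$$ is nonempty, closed, totally geodesic, and isometric to $\mathscr P_n$ for the affine-invariant metric. Every fiber has a unique nearest controller $$s_A(B)=\operatorname*{arg\,min}_{P\in\mathscr F_A(B)}r(P),\qquad \mathfrak C_A(B)=r(s_A(B)),$$ and the section $s_A$ and the squared cost $\mathfrak C_A^2$ are real analytic on $\mathscr B_A$. Moreover, for every $D\in\operatorname{GL}_m(\mathbb R)$, every $R\in O(d)$ and every $B\in\mathscr B_A$, $$s_{AD}(BD)=s_A(B),\qquad s_{RA}(RB)=R\,s_A(B)\,R^\top .$$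
   Context: $\mathbb S_{++}^d$ is the manifold of real symmetric positive definite $d\times d$ matrices with the affine-invariant Riemannian metric (AIRM) $\langle X,Y\rangle_P=\operatorname{tr}(P^{-1}XP^{-1}Y)$ and distance $d_{\mathrm{AI}}(P,P')=\|\log(P^{-1/2}P'P^{-1/2})\|_F$. $\mathscr P_d=\{P\in\mathbb S_{++}^d:\det P=1\}$ (similarly $\mathscr P_n$), and $r(P)=d_{\mathrm{AI}}(I,P)=\|\log P\|_F$. The action map is $\pi_A:\mathscr P_d\to\mathbb R^{d\times m}$, $\pi_A(P)=PA$, and $\mathscr B_A=\{B\in\mathbb R^{d\times m}:A^\top B\in\mathbb S_{++}^m\}$ (the condition includes symmetry of $A^\top B$; $\mathscr B_A$ is an open subset of the linear space $\{B:A^\top B\text{ symmetric}\}$, hence an analytic manifold). Choose a thin QR factorization $A=UC$ with $U^\top U=I_m$, $C$ invertible, and an orthogonal completion $Q=[U,V]\in O(d)$. For $B\in\mathscr B_A$ put $$M(B)=C^{-\top}A^\top BC^{-1},\quad N(B)=V^\top BC^{-1},\quad T(B)=N(B)M(B)^{-1},\quad L(B)=\begin{pmatrix}I_m&0\\ T(B)&I_n\end{pmatrix},\quad \rho(B)=(\det M(B))^{-1/n}.$$ For other full-column-rank matrices $A'$ (such as $AD$, $RA$), $\mathscr B_{A'}$, $\mathscr F_{A'}$ and $s_{A'}$ are defined in the same way. *)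

theory Defs
  imports "HOL-Analysis.Analysis"
begin

text \<open>
  Matrices of size \<open>p \<times> q\<close> have type \<open>real^'q^'p\<close>. The norm of this type is the Frobenius norm,
  and \<open>**\<close> and \<open>matrix_inv\<close> (not \<open>*\<close> and \<open>inverse\<close>) are the matrix operations.
\<close>

section \<open>Real-analytic maps between subsets of Euclidean spaces\<close>

text \<open>
  Multi-indices are functions on \<open>Basis\<close>; unconditional summation over them is absolute
  convergence of the multivariate power series.
\<close>

definition multi_index :: "('a::euclidean_space \<Rightarrow> nat) set" where
  "multi_index = Basis \<rightarrow>\<^sub>E UNIV"

definition monomial :: "('a::euclidean_space \<Rightarrow> nat) \<Rightarrow> 'a \<Rightarrow> real" where
  "monomial \<alpha> h = (\<Prod>b\<in>Basis. (h \<bullet> b) ^ \<alpha> b)"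

definition has_power_series_at ::
    "('a::euclidean_space \<Rightarrow> 'b::euclidean_space) \<Rightarrow> 'a \<Rightarrow> bool" where
  "has_power_series_at f x \<longleftrightarrow>
     (\<exists>r>0. \<exists>c. \<forall>h. norm h < r \<longrightarrow>
        ((\<lambda>\<alpha>. monomial \<alpha> h *\<^sub>R c \<alpha>) has_sum f (x + h)) multi_index)"

text \<open>
  On an arbitrary subset, a map is real analytic if near each point of the subset it is the
  restriction of a real-analytic map defined on an open subset of the ambient space. For embedded
  analytic submanifolds (all the sets below) this is analyticity in charts.
\<close>

definition real_analytic_on ::
    "('a::euclidean_space \<Rightarrow> 'b::euclidean_space) \<Rightarrow> 'a set \<Rightarrow> bool" where
  "real_analytic_on f S \<longleftrightarrow>
     (\<forall>x\<in>S. \<exists>U g. open U \<and> x \<in> U \<and> (\<forall>y\<in>U. has_power_series_at g y) \<and>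
        (\<forall>y\<in>S \<inter> U. f y = g y))"

definition analytic_diffeo ::
    "'a set \<Rightarrow> 'b set \<Rightarrow> ('a::euclidean_space \<Rightarrow> 'b::euclidean_space) \<Rightarrow> bool" where
  "analytic_diffeo S T f \<longleftrightarrow>
     bij_betw f S T \<and> real_analytic_on f S \<and> real_analytic_on (inv_into S f) T"

definition analytically_diffeomorphic ::
    "'a::euclidean_space set \<Rightarrow> 'b::euclidean_space set \<Rightarrow> bool" where
  "analytically_diffeomorphic S T \<longleftrightarrow> (\<exists>f. analytic_diffeo S T f)"

section \<open>Symmetric positive definite matrices and the affine-invariant metric\<close>

definition spd :: "(real^'k^'k) set" where
  "spd = {P. transpose P = P \<and> (\<forall>x. x \<noteq> 0 \<longrightarrow> x \<bullet> (P *v x) > 0)}"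

definition spd1 :: "(real^'k^'k) set" where
  "spd1 = {P \<in> spd. det P = 1}"

definition diag_mat :: "('k \<Rightarrow> real) \<Rightarrow> real^'k^'k" where
  "diag_mat l = (\<chi> i j. if i = j then l i else 0)"

text \<open>
  Functional calculus of a symmetric matrix \<open>P\<close>: the result does not depend on the
  orthogonal diagonalization.
\<close>

definition spectral_fun :: "(real \<Rightarrow> real) \<Rightarrow> real^'k^'k \<Rightarrow> real^'k^'k" where
  "spectral_fun f P =
     (THE X. \<exists>W l. orthogonal_matrix W \<and> P = W ** diag_mat l ** transpose W \<and>
        X = W ** diag_mat (\<lambda>i. f (l i)) ** transpose W)"

definition mat_log :: "real^'k^'k \<Rightarrow> real^'k^'k" where
  "mat_log = spectral_fun ln"

definition mat_inv_sqrt :: "real^'k^'k \<Rightarrow> real^'k^'k" where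
  "mat_inv_sqrt = spectral_fun (\<lambda>x. 1 / sqrt x)"

definition airm :: "real^'k^'k \<Rightarrow> real^'k^'k \<Rightarrow> real^'k^'k \<Rightarrow> real" where
  "airm P X Y = trace (matrix_inv P ** X ** matrix_inv P ** Y)"

definition d_AI :: "real^'k^'k \<Rightarrow> real^'k^'k \<Rightarrow> real" where
  "d_AI P P' = norm (mat_log (mat_inv_sqrt P ** P' ** mat_inv_sqrt P))"

definition radius :: "real^'k^'k \<Rightarrow> real" where
  "radius P = d_AI (mat 1) P"

section \<open>Tangent vectors, isometries and geodesics\<close>

definition tangent_space :: "'a::real_normed_vector set \<Rightarrow> 'a \<Rightarrow> 'a set" where
  "tangent_space S p =
     {X. \<exists>c e. 0 < e \<and> c 0 = p \<and> (\<forall>t. \<bar>t\<bar> < e \<longrightarrow> c t \<in> S) \<and>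
        (c has_vector_derivative X) (at (0::real))}"

text \<open>
  The derivative \<open>D\<close> of a map within \<open>S\<close> is determined on the tangent vectors of \<open>S\<close>.
\<close>

definition airm_isometry ::
    "(real^'k^'k) set \<Rightarrow> (real^'l^'l) set \<Rightarrow> (real^'k^'k \<Rightarrow> real^'l^'l) \<Rightarrow> bool" where
  "airm_isometry S T f \<longleftrightarrow>
     analytic_diffeo S T f \<and>
     (\<forall>P\<in>S. \<exists>D. (f has_derivative D) (at P within S) \<and>
        (\<forall>X\<in>tangent_space S P. \<forall>Y\<in>tangent_space S P.
           airm (f P) (D X) (D Y) = airm P X Y))"

text \<open>
  Geodesics of a submanifold \<open>S\<close> of the positive definite matrices with the induced metric
  \<open>g = airm\<close>, as solutions of the Euler-Lagrange equation
  \<open>d/dt g\<^bsub>\<gamma>(t)\<^esub>(\<gamma>'(t), Z) = 1/2 (D\<^bsub>Z\<^esub> g)\<^bsub>\<gamma>(t)\<^esub>(\<gamma>'(t), \<gamma>'(t))\<close> of the energy. For a constant matrix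
  \<open>Z\<close>, left side minus right side is \<open>g(\<nabla>\<^bsub>\<gamma>'\<^esub>\<gamma>', Z)\<close> for the Levi-Civita connection
  \<open>\<nabla>\<close> of \<open>g\<close> on all positive definite matrices; testing only against \<open>Z\<close> tangent
  to \<open>S\<close> says that the tangential part of this acceleration, which is the covariant
  acceleration in \<open>S\<close>, vanishes.
\<close>

definition airm_geodesic :: "(real^'k^'k) set \<Rightarrow> real set \<Rightarrow> (real \<Rightarrow> real^'k^'k) \<Rightarrow> bool" where
  "airm_geodesic S I \<gamma> \<longleftrightarrow>
     (let v = (\<lambda>t. vector_derivative \<gamma> (at t)) in
      \<forall>t\<in>I. \<gamma> t \<in> S \<and> \<gamma> differentiable (at t) \<and> v differentiable (at t) \<and>
        (\<forall>Z\<in>tangent_space S (\<gamma> t).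
           deriv (\<lambda>s. airm (\<gamma> s) (v s) Z) t =
           1 / 2 * deriv (\<lambda>e. airm (\<gamma> t + e *\<^sub>R Z) (v t) (v t)) 0))"

text \<open>
  A submanifold \<open>N\<close> of \<open>S\<close> is totally geodesic if every geodesic of \<open>S\<close> that is tangent to \<open>N\<close>
  at some time stays in \<open>N\<close> for nearby times.
\<close>

definition totally_geodesic :: "(real^'k^'k) set \<Rightarrow> (real^'k^'k) set \<Rightarrow> bool" where
  "totally_geodesic S N \<longleftrightarrow>
     N \<subseteq> S \<and>
     (\<forall>I \<gamma> t0. open I \<and> is_interval I \<and> airm_geodesic S I \<gamma> \<and> t0 \<in> I \<and> \<gamma> t0 \<in> N \<and>
        vector_derivative \<gamma> (at t0) \<in> tangent_space N (\<gamma> t0) \<longrightarrow>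
        (\<exists>e>0. \<forall>t\<in>I. \<bar>t - t0\<bar> < e \<longrightarrow> \<gamma> t \<in> N))"

section \<open>The action map, its fibers and the nearest-point section\<close>

definition act :: "real^'m^'d \<Rightarrow> real^'d^'d \<Rightarrow> real^'m^'d" where
  "act A P = P ** A"

definition base :: "real^'m^'d \<Rightarrow> (real^'m^'d) set" where
  "base A = {B. transpose A ** B \<in> spd}"

definition fiber :: "real^'m^'d \<Rightarrow> real^'m^'d \<Rightarrow> (real^'d^'d) set" where
  "fiber A B = {P \<in> spd1. act A P = B}"

definition nearest :: "real^'m^'d \<Rightarrow> real^'m^'d \<Rightarrow> real^'d^'d" where
  "nearest A B = arg_min_on radius (fiber A B)"

definition cost :: "real^'m^'d \<Rightarrow> real^'m^'d \<Rightarrow> real" where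
  "cost A B = radius (nearest A B)"

section \<open>The trivialization\<close>

definition hcat :: "real^'m^'d \<Rightarrow> real^'n^'d \<Rightarrow> real^('m + 'n)^'d" where
  "hcat U V = (\<chi> i j. case j of Inl a \<Rightarrow> U $ i $ a | Inr b \<Rightarrow> V $ i $ b)"

definition vcat :: "real^'q^'m \<Rightarrow> real^'q^'n \<Rightarrow> real^'q^('m + 'n)" where
  "vcat X Y = (\<chi> i. case i of Inl a \<Rightarrow> X $ a | Inr b \<Rightarrow> Y $ b)"

definition block_mat ::
    "real^'m^'m \<Rightarrow> real^'n^'m \<Rightarrow> real^'m^'n \<Rightarrow> real^'n^'n \<Rightarrow> real^('m + 'n)^('m + 'n)" where
  "block_mat X Y Z W = vcat (hcat X Y) (hcat Z W)"

text \<open>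
  The columns of \<open>Q = [U, V]\<close> are indexed by \<open>'m + 'n\<close> and its rows by \<open>'d\<close>, so its
  orthogonality is spelled out on both sides.
\<close>

definition thin_qr_completion ::
    "real^'m^'d \<Rightarrow> real^'m^'d \<Rightarrow> real^'m^'m \<Rightarrow> real^'n^'d \<Rightarrow> bool" where
  "thin_qr_completion A U C V \<longleftrightarrow>
     A = U ** C \<and> transpose U ** U = mat 1 \<and> invertible C \<and>
     transpose (hcat U V) ** hcat U V = mat 1 \<and> hcat U V ** transpose (hcat U V) = mat 1"

definition M_part :: "real^'m^'d \<Rightarrow> real^'m^'m \<Rightarrow> real^'m^'d \<Rightarrow> real^'m^'m" where
  "M_part A C B = transpose (matrix_inv C) ** transpose A ** B ** matrix_inv C"

definition N_part :: "real^'m^'m \<Rightarrow> real^'n^'d \<Rightarrow> real^'m^'d \<Rightarrow> real^'m^'n" where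
  "N_part C V B = transpose V ** B ** matrix_inv C"

definition T_part ::
    "real^'m^'d \<Rightarrow> real^'m^'m \<Rightarrow> real^'n^'d \<Rightarrow> real^'m^'d \<Rightarrow> real^'m^'n" where
  "T_part A C V B = N_part C V B ** matrix_inv (M_part A C B)"

definition L_part ::
    "real^'m^'d \<Rightarrow> real^'m^'m \<Rightarrow> real^'n^'d \<Rightarrow> real^'m^'d \<Rightarrow> real^('m + 'n)^('m + 'n)" where
  "L_part A C V B = block_mat (mat 1) 0 (T_part A C V B) (mat 1)"

definition rho :: "'n::finite itself \<Rightarrow> real^'m^'d \<Rightarrow> real^'m^'m \<Rightarrow> real^'m^'d \<Rightarrow> real" where
  "rho _ A C B = det (M_part A C B) powr (- 1 / real CARD('n))"

definition Phi ::
    "real^'m^'d \<Rightarrow> real^'m^'d \<Rightarrow> real^'m^'m \<Rightarrow> real^'n^'d \<Rightarrow>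
     (real^'m^'d) \<times> (real^'n^'n) \<Rightarrow> real^'d^'d" where
  "Phi A U C V = (\<lambda>(B, \<Sigma>).
     hcat U V ** L_part A C V B **
     block_mat (M_part A C B) 0 0 (rho TYPE('n) A C B *\<^sub>R \<Sigma>) **
     transpose (L_part A C V B) ** transpose (hcat U V))"

end

theory Submission
  imports Defs "HOL-Complex_Analysis.Complex_Analysis"
begin

text \<open>
  In the frame \<open>Q = [U, V]\<close> a positive definite matrix \<open>X\<close> is determined by its first block column,
  which is \<open>X A\<close> in other coordinates, and by its Schur complement, which can be any
  positive definite matrix; \<open>\<Phi>\<close> is this block \<open>L D L\<^sup>T\<close> factorization, with the determinant of the
  Schur complement adjusted by \<open>\<rho>\<close>. Its inverse \<open>Psi\<close> is an equally explicit formula, so analyticity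
  of both is a matter of closure properties (\<open>Phi_diffeo\<close>). On a fiber \<open>\<Phi>\<close> reads
  \<open>\<Sigma> \<mapsto> G (M \<oplus> \<rho> \<Sigma>) G\<^sup>T\<close> with \<open>G\<close> fixed, and the metric and the distance are invariant
  under congruence, which gives the isometry (\<open>fiber_isometry\<close>).

  A geodesic of the determinant-one matrices satisfies \<open>(\<gamma>\<^sup>-\<^sup>1 \<gamma>')' = 0\<close>. If its velocity is tangent to
  a fiber at one time, then \<open>\<gamma>\<^sup>-\<^sup>1 \<gamma>' A = 0\<close> at that time, hence always, and \<open>\<gamma> A\<close> is constant
  (\<open>totally_geodesic_fiber\<close>).

  The nearest point rests on nonpositive curvature in the form of the semi-parallelogram law
  (\<open>semi_parallelogram_law\<close>). It follows from the fact that the logarithm does not increase distances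
  (\<open>log_distance_le_d_AI\<close>), which compares entries in two eigenbases and needs only that the logarithmic
  mean of two positive numbers is at least their geometric mean. Because midpoints of two points of a
  fiber stay in the fiber (\<open>fiber_midpoint\<close>), the squared radius exceeds its minimum over a fiber
  by at least half the squared distance to the minimizer. This one inequality yields uniqueness of the
  minimizer, its continuity in \<open>B\<close> (together with compactness of balls) and positivity of the Hessian. The
  minimizer is therefore given by the analytic implicit function theorem, applied to the gradient of the
  squared radius after a retraction onto the fiber (\<open>real_analytic_at_nearest\<close>).

  Analyticity is handled throughout by holomorphic extension to the complexification: closure under
  composition is the chain rule, and the implicit function theorem is that of real calculus with
  complex linear derivatives. Power series appear once, in \<open>real_analytic_at_imp_power_series\<close>. The
  squared radius is analytic because the logarithm is an integral of rational functions (\<open>log_integral\<close>).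
\<close>

section \<open>Power series of separately holomorphic functions on polydiscs\<close>

text \<open>
  Coordinates outside \<open>I\<close> are zero, so that for empty \<open>I\<close> the polydisc is a single point: the base case of
  an induction on \<open>I\<close>.
\<close>

definition polydisc :: "'i set \<Rightarrow> real \<Rightarrow> ('i \<Rightarrow> complex) set" where
  "polydisc I R = {z. (\<forall>i\<in>I. norm (z i) < R) \<and> (\<forall>i. i \<notin> I \<longrightarrow> z i = 0)}"

definition bounded_sep_hol :: "'i set \<Rightarrow> real \<Rightarrow> real \<Rightarrow> (('i \<Rightarrow> complex) \<Rightarrow> complex) \<Rightarrow> bool" where
  "bounded_sep_hol I R M g \<longleftrightarrow>
     (\<forall>z\<in>polydisc I R. norm (g z) \<le> M \<and> (\<forall>i\<in>I. (\<lambda>w. g (z(i := w))) holomorphic_on ball 0 R))"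

text \<open>
  The value at \<open>z\<^sub>i = 0\<close> removes the singularity. The values at \<open>z\<^sub>i = 0\<close> of the iterated quotients are
  the Taylor coefficients of \<open>g\<close> in the variable \<open>z\<^sub>i\<close>.
\<close>

definition quot :: "'i \<Rightarrow> (('i \<Rightarrow> complex) \<Rightarrow> complex) \<Rightarrow> ('i \<Rightarrow> complex) \<Rightarrow> complex" where
  "quot i g z = (if z i = 0 then deriv (\<lambda>w. g (z(i := w))) 0 else (g z - g (z(i := 0))) / z i)"

lemma polydisc_upd: "z \<in> polydisc I R \<Longrightarrow> i \<in> I \<Longrightarrow> norm w < R \<Longrightarrow> z(i := w) \<in> polydisc I R"
  by (auto simp: polydisc_def)

text \<open>
  The maximum principle on circles of radius \<open>r < R\<close>, with \<open>r\<close> tending to \<open>R\<close>.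
\<close>

lemma quotient_bound:
  assumes h: "h holomorphic_on ball 0 R" and "R > 0"
    and K: "\<And>w. w \<in> ball 0 R \<Longrightarrow> norm (h w) * norm w \<le> K" and w: "w \<in> ball 0 R"
  shows "norm (h w) \<le> K / R"
proof -
  have *: "norm (h w) \<le> K / r" if r: "norm w < r" "r < R" for r
  proof (rule maximum_modulus_frontier[of h "cball 0 r"])
    show "h holomorphic_on interior (cball 0 r)"
      using h r by (auto intro: holomorphic_on_subset)
    show "continuous_on (closure (cball 0 r)) h"
      using r holomorphic_on_imp_continuous_on[OF h] by (auto intro: continuous_on_subset)
    have "r > 0" using r norm_ge_zero[of w] by linarith
    then show "norm (h z) \<le> K / r" if "z \<in> frontier (cball 0 r)" for z
      using K[of z] that r by (auto simp: field_simps)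
  qed (use r in auto)
  have "((\<lambda>r. K / r) \<longlongrightarrow> K / R) (at_left R)"
    using \<open>R > 0\<close> by (auto intro!: tendsto_intros)
  moreover have "\<forall>\<^sub>F r in at_left R. norm (h w) \<le> K / r"
    using * w by (auto simp: eventually_at_left[of "norm w" R])
  ultimately show ?thesis
    by (intro tendsto_lowerbound) auto
qed

lemma quot_same_var:
  "quot i g (z(i := w)) = (if w = 0 then deriv (\<lambda>w. g (z(i := w))) 0
     else (g (z(i := w)) - g (z(i := 0))) / w)"
  by (simp add: quot_def)

lemma quot_same_var_facts:
  assumes g: "(\<lambda>w. g (z(i := w))) holomorphic_on ball 0 R" and "R > 0"
    and M: "\<And>w. norm w < R \<Longrightarrow> norm (g (z(i := w))) \<le> M"
  shows "(\<lambda>w. quot i g (z(i := w))) holomorphic_on ball 0 R"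
    and "norm w < R \<Longrightarrow> norm (quot i g (z(i := w))) \<le> 2 * M / R"
proof -
  show hol: "(\<lambda>w. quot i g (z(i := w))) holomorphic_on ball 0 R"
    using pole_lemma[OF g, of 0] \<open>R > 0\<close> by (simp add: quot_same_var cong: if_cong)
  have "norm (quot i g (z(i := w))) * norm w \<le> 2 * M" if "w \<in> ball 0 R" for w
  proof -
    have "norm (g (z(i := w)) - g (z(i := 0))) \<le> M + M"
      using M[of w] M[of 0] that \<open>R > 0\<close> norm_triangle_ineq4 by (smt (verit) dist_0_norm mem_ball norm_zero)
    moreover have "M \<ge> 0" using M[of 0] \<open>R > 0\<close> norm_ge_zero by (smt (verit) norm_zero)
    ultimately show ?thesis by (auto simp: quot_same_var norm_divide)
  qed
  from quotient_bound[OF hol \<open>R > 0\<close> this]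
  show "norm w < R \<Longrightarrow> norm (quot i g (z(i := w))) \<le> 2 * M / R" by simp
qed

text \<open>
  In a variable other than \<open>z\<^sub>i\<close> holomorphy is in question only where \<open>z\<^sub>i = 0\<close>. There the quotient is the
  uniform limit of its values at small nonzero \<open>z\<^sub>i\<close>: its increments in \<open>z\<^sub>i\<close> are \<open>z\<^sub>i\<close> times the second
  quotient, which is bounded as well.
\<close>

lemma bounded_sep_hol_quot:
  assumes g: "bounded_sep_hol I R M g" and "R > 0" and i: "i \<in> I"
  shows "bounded_sep_hol I R (2 * M / R) (quot i g)"
  unfolding bounded_sep_hol_def
proof (intro ballI conjI)
  fix z :: "'a \<Rightarrow> complex" assume z: "z \<in> polydisc I R"
  have hol: "(\<lambda>w. g (z(j := w))) holomorphic_on ball 0 R" if "z \<in> polydisc I R" "j \<in> I" for z j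
    using g that by (auto simp: bounded_sep_hol_def)
  have M: "norm (g (z(j := w))) \<le> M" if "z \<in> polydisc I R" "j \<in> I" "norm w < R" for z j w
    using g polydisc_upd[OF that] by (auto simp: bounded_sep_hol_def)
  note 1 = quot_same_var_facts[where g = g, OF hol \<open>R > 0\<close> M]
  have bd: "norm (quot i g (z(i := w))) \<le> 2 * M / R" if "z \<in> polydisc I R" "norm w < R" for z w
    using 1(2)[OF that(1) i that(1) i] that(2) by blast
  have zi: "norm (z i) < R" if "z \<in> polydisc I R" for z using that i by (auto simp: polydisc_def)
  show "norm (quot i g z) \<le> 2 * M / R" using bd[OF z zi[OF z]] by simp
  fix j assume j: "j \<in> I"
  show "(\<lambda>w. quot i g (z(j := w))) holomorphic_on ball 0 R"
  proof (cases "j = i")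
    case True then show ?thesis using 1(1)[OF z i z i] by simp
  next
    case False
    have nz: "(\<lambda>w. quot i g (z(j := w, i := u))) holomorphic_on ball 0 R" if u: "u \<noteq> 0" "norm u < R" for u
    proof -
      have "(\<lambda>w. (g (z(i := u, j := w)) - g (z(i := 0, j := w))) / u) holomorphic_on ball 0 R"
        using polydisc_upd[OF z i] u j \<open>R > 0\<close> by (intro holomorphic_intros hol) auto
      then show ?thesis
        using False u by (simp add: quot_def fun_upd_twist[of i j])
    qed
    show ?thesis
    proof (cases "z i = 0")
      case False
      then show ?thesis using nz[of "z i"] zi[OF z] \<open>j \<noteq> i\<close> by (simp add: fun_upd_twist[of j i])
    next
      case True
      have z0: "z(j := w, i := 0) = z(j := w)" for w using True \<open>j \<noteq> i\<close> by auto
      \<comment> \<open>A null sequence inside the disc; the shift by two keeps \<open>e n < R\<close>.\<close>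
      define e where "e n = R * inverse (real (Suc (Suc n)))" for n
      have e: "e n > 0" "e n < R" for n using \<open>R > 0\<close> by (auto simp: e_def field_simps add_pos_nonneg)
      have lip: "norm (quot i g (z(j := w, i := of_real (e n))) - quot i g (z(j := w))) \<le> e n * (2 * (2 * M / R) / R)"
        if w: "norm w < R" for n w
      proof -
        let ?y = "z(j := w)"
        have y: "?y \<in> polydisc I R" using polydisc_upd[OF z j w] .
        have "norm (quot i (quot i g) (?y(i := of_real (e n)))) \<le> 2 * (2 * M / R) / R"
          by (rule quot_same_var_facts(2)[where R = R]) (use 1(1)[OF y i y i] \<open>R > 0\<close> bd[OF y] e[of n] in auto)
        then show ?thesis
          using e[of n] z0[of w] by (simp add: quot_same_var norm_divide norm_mult field_simps)
      qed
      show ?thesis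
      proof (rule holomorphic_uniform_sequence)
        show "(\<lambda>w. quot i g (z(j := w, i := of_real (e n)))) holomorphic_on ball 0 R" for n
          using nz[of "of_real (e n)"] e[of n] by simp
        fix x :: complex assume "x \<in> ball 0 R"
        then obtain d where d: "0 < d" "cball x d \<subseteq> ball 0 R"
          by (metis open_contains_cball open_ball)
        have "uniform_limit (cball x d) (\<lambda>n w. quot i g (z(j := w, i := of_real (e n)))) (\<lambda>w. quot i g (z(j := w))) sequentially"
        proof (rule uniform_limitI)
          fix \<epsilon> :: real assume "\<epsilon> > 0"
          have "(\<lambda>n. R * inverse (real (Suc (Suc n))) * (2 * (2 * M / R) / R)) \<longlonglongrightarrow> R * 0 * (2 * (2 * M / R) / R)"
            by (intro tendsto_intros LIMSEQ_Suc[OF LIMSEQ_inverse_real_of_nat])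
          then have "\<forall>\<^sub>F n in sequentially. e n * (2 * (2 * M / R) / R) < \<epsilon>"
            using \<open>\<epsilon> > 0\<close> by (auto dest: order_tendstoD(2) simp: e_def)
          then show "\<forall>\<^sub>F n in sequentially. \<forall>w\<in>cball x d. dist (quot i g (z(j := w, i := of_real (e n)))) (quot i g (z(j := w))) < \<epsilon>"
          proof eventually_elim
            case (elim n)
            show ?case
            proof
              fix w assume "w \<in> cball x d"
              then have "norm w < R" using d by auto
              from le_less_trans[OF lip[OF this] elim]
              show "dist (quot i g (z(j := w, i := of_real (e n)))) (quot i g (z(j := w))) < \<epsilon>"
                by (simp add: dist_norm)
            qed
          qed
        qed
        then show "\<exists>d>0. cball x d \<subseteq> ball 0 R \<and> uniform_limit (cball x d) (\<lambda>n w. quot i g (z(j := w, i := of_real (e n)))) (\<lambda>w. quot i g (z(j := w))) sequentially"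
          using d by blast
      qed simp
    qed
  qed
qed

lemma quot_expansion:
  "g z = (\<Sum>l<k. (quot i ^^ l) g (z(i := 0)) * z i ^ l) + z i ^ k * (quot i ^^ k) g z"
proof (induction k)
  case (Suc k)
  have "(quot i ^^ k) g z = (quot i ^^ k) g (z(i := 0)) + z i * quot i ((quot i ^^ k) g) z"
    by (cases "z i = 0") (auto simp: quot_def fun_upd_idem)
  then have "z i ^ k * (quot i ^^ k) g z = (quot i ^^ k) g (z(i := 0)) * z i ^ k + z i ^ Suc k * (quot i ^^ Suc k) g z"
    by (simp add: algebra_simps del: fun_upd_apply)
  with Suc show ?case by (simp only: sum.lessThan_Suc add.assoc)
qed simp

lemma bij_betw_insert_multi_index:
  assumes "i \<notin> J"
  shows "bij_betw (\<lambda>(k, \<beta>). \<beta>(i := k)) (UNIV \<times> (J \<rightarrow>\<^sub>E UNIV)) (insert i J \<rightarrow>\<^sub>E (UNIV :: 'b set))"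
proof (rule bij_betw_byWitness[where f' = "\<lambda>\<alpha>. (\<alpha> i, restrict \<alpha> J)"])
  show "\<forall>a\<in>UNIV \<times> (J \<rightarrow>\<^sub>E (UNIV :: 'b set)). (\<lambda>\<alpha>. (\<alpha> i, restrict \<alpha> J)) ((\<lambda>(k, \<beta>). \<beta>(i := k)) a) = a"
    using assms by (auto simp: PiE_restrict)
  show "\<forall>\<alpha>\<in>insert i J \<rightarrow>\<^sub>E (UNIV :: 'b set). (\<lambda>(k, \<beta>). \<beta>(i := k)) (\<alpha> i, restrict \<alpha> J) = \<alpha>"
  proof
    fix \<alpha> :: "'a \<Rightarrow> 'b" assume a: "\<alpha> \<in> insert i J \<rightarrow>\<^sub>E UNIV"
    show "(\<lambda>(k, \<beta>). \<beta>(i := k)) (\<alpha> i, restrict \<alpha> J) = \<alpha>" unfolding prod.case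
    proof (rule ext)
      fix j show "((restrict \<alpha> J)(i := \<alpha> i)) j = \<alpha> j"
        using PiE_arb[OF a, of j] by (cases "j = i"; cases "j \<in> J") auto
    qed
  qed
  show "(\<lambda>(k, \<beta>). \<beta>(i := k)) ` (UNIV \<times> (J \<rightarrow>\<^sub>E UNIV)) \<subseteq> insert i J \<rightarrow>\<^sub>E (UNIV :: 'b set)"
    by (auto simp: PiE_def extensional_def)
  show "(\<lambda>\<alpha>. (\<alpha> i, restrict \<alpha> J)) ` (insert i J \<rightarrow>\<^sub>E (UNIV :: 'b set)) \<subseteq> UNIV \<times> (J \<rightarrow>\<^sub>E UNIV)"
    by auto
qed

lemma geometric_summable_multi_index:
  fixes q :: "'i \<Rightarrow> real"
  assumes "finite I" "\<And>i. i \<in> I \<Longrightarrow> 0 \<le> q i \<and> q i < 1"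
  shows "(\<lambda>\<alpha>. \<Prod>i\<in>I. q i ^ \<alpha> i) summable_on (I \<rightarrow>\<^sub>E (UNIV :: nat set))"
  using assms
proof (induction I)
  case (insert i J)
  have geo: "(\<lambda>k. q i ^ k) summable_on (UNIV :: nat set)"
    using insert.prems by (subst summable_on_UNIV_nonneg_real_iff) auto
  have IH: "(\<lambda>\<beta>. \<Prod>j\<in>J. q j ^ \<beta> j) summable_on (J \<rightarrow>\<^sub>E (UNIV :: nat set))"
    using insert by auto
  have nn: "0 \<le> (\<Prod>j\<in>J. q j ^ \<beta> j)" for \<beta> :: "'i \<Rightarrow> nat" using insert.prems by (auto intro!: prod_nonneg)
  have q: "0 \<le> q i" using insert.prems by auto
  have nnn: "norm (\<Prod>j\<in>J. q j ^ \<beta> j) = (\<Prod>j\<in>J. q j ^ \<beta> j)" for \<beta> :: "'i \<Rightarrow> nat" using nn by simp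
  let ?h = "\<lambda>x. case x of (k, \<beta>) \<Rightarrow> q i ^ k * (\<Prod>j\<in>J. q j ^ \<beta> j)"
  have "(\<lambda>x. norm (?h x)) summable_on (UNIV \<times> (J \<rightarrow>\<^sub>E (UNIV :: nat set)))"
  proof (subst Infinite_Sum.abs_summable_on_Sigma_iff, intro conjI ballI)
    show "(\<lambda>\<beta>. norm (?h (k, \<beta>))) summable_on (J \<rightarrow>\<^sub>E (UNIV :: nat set))" for k
      using IH q by (simp add: norm_mult nnn norm_power summable_on_cmult_right del: real_norm_def)
    have *: "norm (?h (k, \<beta>)) = q i ^ k * (\<Prod>j\<in>J. q j ^ \<beta> j)" for k \<beta>
      using nn q by (simp add: abs_mult)
    show "(\<lambda>k. norm (\<Sum>\<^sub>\<infinity>\<beta>\<in>J \<rightarrow>\<^sub>E UNIV. norm (?h (k, \<beta>)))) summable_on (UNIV :: nat set)"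
      unfolding * using geo q by (simp add: infsum_cmult_right' abs_mult infsum_nonneg nn summable_on_cmult_left)
  qed
  then have "?h summable_on (UNIV \<times> (J \<rightarrow>\<^sub>E (UNIV :: nat set)))"
    by (rule Infinite_Sum.abs_summable_summable)
  also have "(\<lambda>(k, \<beta>). q i ^ k * (\<Prod>j\<in>J. q j ^ \<beta> j)) = (\<lambda>x. (\<lambda>\<alpha>. \<Prod>i\<in>insert i J. q i ^ \<alpha> i) ((\<lambda>(k, \<beta>). \<beta>(i := k)) x))"
  proof (rule ext, clarify)
    fix k \<beta>
    have "(\<Prod>j\<in>J. q j ^ (\<beta>(i := k)) j) = (\<Prod>j\<in>J. q j ^ \<beta> j)"
      using insert.hyps by (intro prod.cong) auto
    then show "q i ^ k * (\<Prod>j\<in>J. q j ^ \<beta> j) = (\<Prod>j\<in>insert i J. q j ^ ((\<beta>(i := k)) j))"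
      using insert.hyps by simp
  qed
  finally show ?case
    by (subst (asm) summable_on_reindex_bij_betw[OF bij_betw_insert_multi_index[OF insert.hyps(2)]])
qed simp

text \<open>
  Osgood's lemma, by induction on the number of variables. The Taylor coefficients in the new variable are again
  bounded and separately holomorphic in the others, so they have expansions, and the double series converges
  absolutely. Each quotient costs a factor \<open>2 / R\<close> in the bounds; this is why the expansion is claimed for half
  the radius.
\<close>

lemma polydisc_power_series:
  assumes "finite I" "R > 0" "bounded_sep_hol I R M g"
  shows "\<exists>c. (\<forall>\<alpha>\<in>I \<rightarrow>\<^sub>E UNIV. norm (c \<alpha>) \<le> M * (\<Prod>i\<in>I. (2 / R) ^ \<alpha> i)) \<and>
     (\<forall>z\<in>polydisc I (R / 2). ((\<lambda>\<alpha>. c \<alpha> * (\<Prod>i\<in>I. z i ^ \<alpha> i)) has_sum g z) (I \<rightarrow>\<^sub>E UNIV))"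
  using assms
proof (induction I arbitrary: M g)
  case empty
  have "norm (g (\<lambda>_. 0)) \<le> M" using empty by (auto simp: bounded_sep_hol_def polydisc_def)
  moreover have "z = (\<lambda>_. 0)" if "z \<in> polydisc {} (R / 2)" for z :: "'a \<Rightarrow> complex"
    using that by (auto simp: polydisc_def)
  ultimately show ?case
    by (intro exI[of _ "\<lambda>_. g (\<lambda>_. 0)"]) (auto intro!: has_sum_finiteI)
next
  case (insert i J)
  define M' where "M' k = M * (2 / R) ^ k" for k :: nat
  have gk: "bounded_sep_hol (insert i J) R (M' k) ((quot i ^^ k) g)" for k
  proof (induction k)
    case (Suc k)
    from bounded_sep_hol_quot[OF this \<open>R > 0\<close>, of i] show ?case by (simp add: M'_def mult.commute mult.left_commute)
  qed (use insert.prems in \<open>simp add: M'_def\<close>)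
  define a where "a k z = (quot i ^^ k) g (z(i := 0))" for k z
  have a: "bounded_sep_hol J R (M' k) (a k)" for k
    unfolding bounded_sep_hol_def
  proof (intro ballI conjI)
    fix z :: "'a \<Rightarrow> complex" assume z: "z \<in> polydisc J R"
    then have z': "z \<in> polydisc (insert i J) R" "z(i := 0) = z" using insert.hyps \<open>R > 0\<close> by (auto simp: polydisc_def)
    then show "norm (a k z) \<le> M' k" using gk[of k] by (auto simp: a_def bounded_sep_hol_def)
    fix j assume j: "j \<in> J"
    then have "z(j := w, i := 0) = z(j := w)" for w using z' insert.hyps by (metis fun_upd_twist)
    then show "(\<lambda>w. a k (z(j := w))) holomorphic_on ball 0 R"
      using gk[of k] z' j by (auto simp: a_def bounded_sep_hol_def)
  qed
  define Q where "Q k c \<longleftrightarrow> (\<forall>\<alpha>\<in>J \<rightarrow>\<^sub>E UNIV. norm (c \<alpha>) \<le> M' k * (\<Prod>i\<in>J. (2 / R) ^ \<alpha> i)) \<and>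
     (\<forall>z\<in>polydisc J (R / 2). ((\<lambda>\<alpha>. c \<alpha> * (\<Prod>i\<in>J. z i ^ \<alpha> i)) has_sum a k z) (J \<rightarrow>\<^sub>E UNIV))" for k c
  have "\<forall>k. \<exists>c. Q k c"
    unfolding Q_def using insert.IH[OF \<open>R > 0\<close> a] by (intro allI)
  from choice[OF this] obtain c where c: "\<forall>k. Q k (c k)" ..
  have c1: "norm (c k \<alpha>) \<le> M' k * (\<Prod>i\<in>J. (2 / R) ^ \<alpha> i)" if "\<alpha> \<in> J \<rightarrow>\<^sub>E UNIV" for k \<alpha>
    using c that unfolding Q_def by blast
  have c2: "((\<lambda>\<alpha>. c k \<alpha> * (\<Prod>i\<in>J. z i ^ \<alpha> i)) has_sum a k z) (J \<rightarrow>\<^sub>E UNIV)" if "z \<in> polydisc J (R / 2)" for k z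
    using c that unfolding Q_def by blast
  define C where "C \<alpha> = c (\<alpha> i) (restrict \<alpha> J)" for \<alpha>
  have Cupd: "C (\<beta>(i := k)) = c k \<beta>" if "\<beta> \<in> J \<rightarrow>\<^sub>E UNIV" for \<beta> k
  proof -
    have "restrict (\<beta>(i := k)) J = \<beta>" using that insert.hyps by (auto simp: fun_eq_iff PiE_def extensional_def)
    then show ?thesis by (simp add: C_def)
  qed
  have C1: "norm (C \<alpha>) \<le> M * (\<Prod>i\<in>insert i J. (2 / R) ^ \<alpha> i)" for \<alpha>
  proof -
    have "norm (C \<alpha>) \<le> M' (\<alpha> i) * (\<Prod>j\<in>J. (2 / R) ^ restrict \<alpha> J j)" unfolding C_def by (rule c1) auto
    also have "(\<Prod>j\<in>J. (2 / R) ^ restrict \<alpha> J j) = (\<Prod>j\<in>J. (2 / R) ^ \<alpha> j)" by (intro prod.cong) auto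
    finally show ?thesis using insert.hyps by (simp add: M'_def mult_ac)
  qed
  have "((\<lambda>\<alpha>. C \<alpha> * (\<Prod>i\<in>insert i J. z i ^ \<alpha> i)) has_sum g z) (insert i J \<rightarrow>\<^sub>E UNIV)"
    if z: "z \<in> polydisc (insert i J) (R / 2)" for z
  proof -
    have zR: "z \<in> polydisc (insert i J) R" using z \<open>R > 0\<close> by (force simp: polydisc_def)
    have "norm (g z) \<le> M" using insert.prems zR by (simp add: bounded_sep_hol_def)
    then have M0: "M \<ge> 0" using norm_ge_zero[of "g z"] by linarith
    have zJ: "z(i := 0) \<in> polydisc J (R / 2)" using z insert.hyps by (auto simp: polydisc_def)
    define q where "q j = 2 / R * norm (z j)" for j
    have q: "0 \<le> q j \<and> q j < 1" if "j \<in> insert i J" for j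
      using z that \<open>R > 0\<close> by (auto simp: q_def polydisc_def field_simps)
    let ?f = "\<lambda>\<alpha>. C \<alpha> * (\<Prod>i\<in>insert i J. z i ^ \<alpha> i)"
    have "(\<lambda>\<alpha>. M * (\<Prod>i\<in>insert i J. q i ^ \<alpha> i)) summable_on (insert i J \<rightarrow>\<^sub>E UNIV)"
      using geometric_summable_multi_index[of "insert i J" q] insert.hyps q by (intro summable_on_cmult_right) auto
    then have "(\<lambda>\<alpha>. norm (?f \<alpha>)) summable_on (insert i J \<rightarrow>\<^sub>E UNIV)"
    proof (rule Infinite_Sum.abs_summable_on_comparison_test')
      fix \<alpha> :: "'a \<Rightarrow> nat"
      have "norm (?f \<alpha>) \<le> M * (\<Prod>i\<in>insert i J. (2 / R) ^ \<alpha> i) * (\<Prod>i\<in>insert i J. norm (z i) ^ \<alpha> i)"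
        unfolding norm_mult prod_norm[symmetric] norm_power by (intro mult_right_mono C1 prod_nonneg) auto
      also have "\<dots> = M * (\<Prod>i\<in>insert i J. q i ^ \<alpha> i)"
        unfolding q_def power_mult_distrib prod.distrib by (simp only: mult.assoc)
      finally show "norm (?f \<alpha>) \<le> M * (\<Prod>i\<in>insert i J. q i ^ \<alpha> i)" .
    qed
    then have sm: "?f summable_on (insert i J \<rightarrow>\<^sub>E UNIV)" by (rule Infinite_Sum.abs_summable_summable)
    have eq: "?f (\<beta>(i := k)) = (c k \<beta> * (\<Prod>j\<in>J. (z(i := 0)) j ^ \<beta> j)) * z i ^ k" if "\<beta> \<in> J \<rightarrow>\<^sub>E UNIV" for \<beta> k
    proof -
      have "(\<Prod>j\<in>J. z j ^ (\<beta>(i := k)) j) = (\<Prod>j\<in>J. (z(i := 0)) j ^ \<beta> j)"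
        by (intro prod.cong) (use insert.hyps in auto)
      then show ?thesis using insert.hyps Cupd[OF that] by (simp add: mult_ac)
    qed
    define F where "F = (\<lambda>x. ?f ((\<lambda>(k, \<beta>). \<beta>(i := k)) x))"
    have Fs: "F summable_on (UNIV \<times> (J \<rightarrow>\<^sub>E UNIV))"
      using sm unfolding F_def
      by (subst summable_on_reindex_bij_betw[OF bij_betw_insert_multi_index[OF insert.hyps(2)]])
    then obtain S where S: "(F has_sum S) (UNIV \<times> (J \<rightarrow>\<^sub>E UNIV))" by (auto simp: summable_on_def)
    have inner: "((\<lambda>\<beta>. F (k, \<beta>)) has_sum (a k (z(i := 0)) * z i ^ k)) (J \<rightarrow>\<^sub>E UNIV)" for k
    proof -
      have "((\<lambda>\<beta>. (c k \<beta> * (\<Prod>j\<in>J. (z(i := 0)) j ^ \<beta> j)) * z i ^ k) has_sum (a k (z(i := 0)) * z i ^ k)) (J \<rightarrow>\<^sub>E UNIV)"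
        by (intro has_sum_cmult_left c2 zJ)
      then show ?thesis
        by (rule has_sum_cong[THEN iffD1, rotated]) (simp only: F_def prod.case eq)
    qed
    have "((\<lambda>k. a k (z(i := 0)) * z i ^ k) has_sum S) UNIV"
      using has_sum_SigmaD[OF S inner] by simp
    then have "(\<lambda>k. a k (z(i := 0)) * z i ^ k) sums S" by (rule has_sum_imp_sums)
    moreover have "(\<lambda>k. a k (z(i := 0)) * z i ^ k) sums g z"
    proof -
      have "(\<lambda>k. z i ^ k * (quot i ^^ k) g z) \<longlonglongrightarrow> 0"
      proof (rule Lim_null_comparison[where g = "\<lambda>k. M * q i ^ k"])
        show "\<forall>\<^sub>F k in sequentially. norm (z i ^ k * (quot i ^^ k) g z) \<le> M * q i ^ k"
        proof (rule always_eventually, rule allI)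
          fix k
          have "norm ((quot i ^^ k) g z) \<le> M' k" using gk[of k] zR by (auto simp: bounded_sep_hol_def)
          then have "norm (z i) ^ k * norm ((quot i ^^ k) g z) \<le> norm (z i) ^ k * M' k" by (intro mult_left_mono) auto
          then show "norm (z i ^ k * (quot i ^^ k) g z) \<le> M * q i ^ k"
            by (simp add: M'_def q_def norm_mult norm_power power_mult_distrib mult_ac power_divide)
        qed
        show "(\<lambda>k. M * q i ^ k) \<longlonglongrightarrow> 0"
          using q[of i] by (intro tendsto_mult_right_zero LIMSEQ_realpow_zero) auto
      qed
      then have "(\<lambda>k. g z - z i ^ k * (quot i ^^ k) g z) \<longlonglongrightarrow> g z - 0" by (intro tendsto_intros)
      moreover have "g z - z i ^ k * (quot i ^^ k) g z = (\<Sum>l<k. a l (z(i := 0)) * z i ^ l)" for k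
        using quot_expansion[where g = g and z = z and k = k and i = i] by (simp add: a_def algebra_simps)
      ultimately show ?thesis by (simp add: sums_def)
    qed
    ultimately have "S = g z" by (rule sums_unique2)
    then have "(F has_sum g z) (UNIV \<times> (J \<rightarrow>\<^sub>E UNIV))" using S by simp
    then show ?thesis unfolding F_def
      by (rule has_sum_reindex_bij_betw[OF bij_betw_insert_multi_index[OF insert.hyps(2)], THEN iffD1])
  qed
  then show ?case using C1 by blast
qed

section \<open>Real-analytic maps as restrictions of holomorphic maps\<close>

text \<open>
  The complexification of \<open>'a\<close> is \<open>'a \<times> 'a\<close>, where \<open>(u, v)\<close> stands for \<open>u + \<i> v\<close>.
\<close>

definition cscale :: "complex \<Rightarrow> 'a::real_vector \<times> 'a \<Rightarrow> 'a \<times> 'a" where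
  "cscale z p = (Re z *\<^sub>R fst p - Im z *\<^sub>R snd p, Re z *\<^sub>R snd p + Im z *\<^sub>R fst p)"

text \<open>
  Commuting with multiplication by \<open>\<i>\<close> is the Cauchy-Riemann condition.
\<close>

definition cdiff :: "('a::real_normed_vector \<times> 'a \<Rightarrow> 'b::real_normed_vector \<times> 'b) \<Rightarrow> 'a \<times> 'a \<Rightarrow> bool" where
  "cdiff F p \<longleftrightarrow> (\<exists>D. (F has_derivative D) (at p) \<and> (\<forall>q. D (cscale \<i> q) = cscale \<i> (D q)))"

definition holo :: "('a::real_normed_vector \<times> 'a \<Rightarrow> 'b::real_normed_vector \<times> 'b) \<Rightarrow> ('a \<times> 'a) set \<Rightarrow> bool" where
  "holo F U \<longleftrightarrow> open U \<and> (\<forall>p\<in>U. cdiff F p)"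

text \<open>
  The extension has to be real at real points: this makes the notion stable under composition.
\<close>

definition real_analytic_at :: "('a::real_normed_vector \<Rightarrow> 'b::real_normed_vector) \<Rightarrow> 'a \<Rightarrow> bool" where
  "real_analytic_at f x \<longleftrightarrow>
     (\<exists>F U. holo F U \<and> (x, 0) \<in> U \<and> (\<forall>y. (y, 0) \<in> U \<longrightarrow> F (y, 0) = (f y, 0)))"

lemma cscale_i: "cscale \<i> (u, v) = (- v, u)"
  by (simp add: cscale_def)

lemma cscale_mult: "cscale z (cscale w p) = cscale (z * w) p"
  by (simp add: cscale_def prod_eq_iff algebra_simps)

lemma cscale_of_real: "cscale (of_real r) p = r *\<^sub>R p"
  by (simp add: cscale_def prod_eq_iff)

lemma cscale_decomp: "cscale z p = Re z *\<^sub>R p + Im z *\<^sub>R cscale \<i> p"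
  by (simp add: cscale_def prod_eq_iff)

lemma norm_cscale: "norm (cscale z p) \<le> 2 * norm z * norm p" for p :: "'a::real_normed_vector \<times> 'a"
proof -
  have "norm (cscale \<i> p) = norm p"
    by (cases p) (simp add: cscale_i norm_Pair add.commute)
  moreover have "norm (cscale z p) \<le> \<bar>Re z\<bar> * norm p + \<bar>Im z\<bar> * norm (cscale \<i> p)"
    by (subst cscale_decomp) (metis norm_scaleR norm_triangle_ineq)
  ultimately have "norm (cscale z p) \<le> (\<bar>Re z\<bar> + \<bar>Im z\<bar>) * norm p" by (simp add: algebra_simps)
  also have "\<dots> \<le> (2 * norm z) * norm p"
    using abs_Re_le_cmod[of z] abs_Im_le_cmod[of z] by (intro mult_right_mono) auto
  finally show ?thesis .
qed

lemma bounded_bilinear_cscale: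
  "bounded_bilinear (cscale :: complex \<Rightarrow> ('a::real_normed_vector \<times> 'a) \<Rightarrow> _)"
proof (rule bounded_bilinear.intro)
  show "cscale (z + w) p = cscale z p + cscale w p" for z w and p :: "'a \<times> 'a"
    by (simp add: cscale_def prod_eq_iff algebra_simps)
  show "cscale z (p + q) = cscale z p + cscale z q" for z and p q :: "'a \<times> 'a"
    by (simp add: cscale_def prod_eq_iff algebra_simps)
  show "cscale (r *\<^sub>R z) p = r *\<^sub>R cscale z p" for r z and p :: "'a \<times> 'a"
    by (simp add: cscale_def prod_eq_iff algebra_simps)
  show "cscale z (r *\<^sub>R p) = r *\<^sub>R cscale z p" for r z and p :: "'a \<times> 'a"
    by (simp add: cscale_def prod_eq_iff algebra_simps)
  show "\<exists>K. \<forall>z (p :: 'a \<times> 'a). norm (cscale z p) \<le> norm z * norm p * K"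
    using norm_cscale by (intro exI[of _ 2] allI) (simp add: mult_ac)
qed

lemmas bounded_linear_cscale_left = bounded_bilinear.bounded_linear_left[OF bounded_bilinear_cscale]
lemmas bounded_linear_cscale_right = bounded_bilinear.bounded_linear_right[OF bounded_bilinear_cscale]

lemma linear_commutes_cscale:
  assumes "linear D" "\<And>q. D (cscale \<i> q) = cscale \<i> (D q)"
  shows "D (cscale z q) = cscale z (D q)"
  unfolding cscale_decomp[of z] linear_add[OF assms(1)] linear_scale[OF assms(1)] assms(2) ..

lemma cdiffI:
  "(F has_derivative D) (at p) \<Longrightarrow> (\<And>q. D (cscale \<i> q) = cscale \<i> (D q)) \<Longrightarrow> cdiff F p"
  by (auto simp: cdiff_def)

lemma holo_cdiff: "holo F U \<Longrightarrow> p \<in> U \<Longrightarrow> cdiff F p"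
  by (simp add: holo_def)

lemma holo_subset: "holo F U \<Longrightarrow> V \<subseteq> U \<Longrightarrow> open V \<Longrightarrow> holo F V"
  by (auto simp: holo_def)

lemma cdiff_imp_continuous: "cdiff F p \<Longrightarrow> isCont F p"
  by (auto simp: cdiff_def dest: has_derivative_continuous)

lemma holo_imp_continuous_on: "holo F U \<Longrightarrow> continuous_on U F"
  by (meson cdiff_imp_continuous continuous_at_imp_continuous_on holo_cdiff)

lemma cdiff_compose: "cdiff F p \<Longrightarrow> cdiff G (F p) \<Longrightarrow> cdiff (\<lambda>p. G (F p)) p"
  unfolding cdiff_def
proof (elim exE conjE)
  fix D E assume *: "(F has_derivative D) (at p)" "(G has_derivative E) (at (F p))"
    and "\<forall>q. D (cscale \<i> q) = cscale \<i> (D q)" "\<forall>q. E (cscale \<i> q) = cscale \<i> (E q)"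
  moreover have "((\<lambda>p. G (F p)) has_derivative (\<lambda>q. E (D q))) (at p)"
    using has_derivative_compose[OF *] .
  ultimately show "\<exists>D. ((\<lambda>p. G (F p)) has_derivative D) (at p) \<and> (\<forall>q. D (cscale \<i> q) = cscale \<i> (D q))"
    by (intro exI[of _ "\<lambda>q. E (D q)"]) (simp del: split_paired_All)
qed

lemma real_analytic_at_compose:
  assumes "real_analytic_at f x" "real_analytic_at g (f x)"
  shows "real_analytic_at (\<lambda>x. g (f x)) x"
proof -
  obtain F U where F: "holo F U" "(x, 0) \<in> U" "\<And>y. (y, 0) \<in> U \<Longrightarrow> F (y, 0) = (f y, 0)"
    using assms by (auto simp: real_analytic_at_def)
  obtain G V where G: "holo G V" "(f x, 0) \<in> V" "\<And>y. (y, 0) \<in> V \<Longrightarrow> G (y, 0) = (g y, 0)"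
    using assms by (auto simp: real_analytic_at_def)
  have "open (U \<inter> F -` V)"
    using F(1) G(1) by (intro continuous_open_preimage holo_imp_continuous_on) (auto simp: holo_def)
  moreover have "cdiff (\<lambda>p. G (F p)) p" if "p \<in> U \<inter> F -` V" for p
    using that by (intro cdiff_compose[of F p G] holo_cdiff[OF F(1)] holo_cdiff[OF G(1)]) auto
  ultimately have "holo (\<lambda>p. G (F p)) (U \<inter> F -` V)"
    by (simp add: holo_def)
  then show ?thesis
    unfolding real_analytic_at_def using F(2,3) G(2,3)
    by (intro exI[of _ "\<lambda>p. G (F p)"] exI[of _ "U \<inter> F -` V"]) auto
qed

lemma real_analytic_at_linear:
  assumes "bounded_linear L"
  shows "real_analytic_at L x"
proof -
  interpret bounded_linear L by fact
  have "cdiff (\<lambda>p. (L (fst p), L (snd p))) p" for p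
    unfolding cdiff_def
    by (rule exI[of _ "\<lambda>p. (L (fst p), L (snd p))"])
      (auto simp: cscale_def neg intro!: has_derivative_Pair has_derivative has_derivative_fst has_derivative_snd)
  then show ?thesis
    unfolding real_analytic_at_def holo_def
    by (intro exI[of _ "\<lambda>p. (L (fst p), L (snd p))"] exI[of _ UNIV]) (auto simp: zero)
qed

lemma real_analytic_at_const: "real_analytic_at (\<lambda>x. c) x"
proof -
  have "cdiff (\<lambda>p. (c, 0)) p" for p :: "'a \<times> 'a"
    unfolding cdiff_def by (rule exI[of _ "\<lambda>p. 0"]) (auto simp: cscale_def zero_prod_def[symmetric])
  then show ?thesis
    unfolding real_analytic_at_def holo_def
    by (intro exI[of _ "\<lambda>p. (c, 0)"] exI[of _ UNIV]) auto
qed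

lemma real_analytic_at_ident: "real_analytic_at (\<lambda>x. x) x"
  by (rule real_analytic_at_linear) simp

lemma real_analytic_at_Pair:
  assumes "real_analytic_at f x" "real_analytic_at g x"
  shows "real_analytic_at (\<lambda>x. (f x, g x)) x"
proof -
  obtain F U where F: "holo F U" "(x, 0) \<in> U" "\<And>y. (y, 0) \<in> U \<Longrightarrow> F (y, 0) = (f y, 0)"
    using assms by (auto simp: real_analytic_at_def)
  obtain G V where G: "holo G V" "(x, 0) \<in> V" "\<And>y. (y, 0) \<in> V \<Longrightarrow> G (y, 0) = (g y, 0)"
    using assms by (auto simp: real_analytic_at_def)
  let ?H = "\<lambda>p. ((fst (F p), fst (G p)), (snd (F p), snd (G p)))"
  have "cdiff ?H p" if FG: "cdiff F p" "cdiff G p" for p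
  proof -
    obtain D E where D: "(F has_derivative D) (at p)" "\<And>q. D (cscale \<i> q) = cscale \<i> (D q)"
      and E: "(G has_derivative E) (at p)" "\<And>q. E (cscale \<i> q) = cscale \<i> (E q)"
      using FG by (auto simp: cdiff_def)
    have "(?H has_derivative (\<lambda>q. ((fst (D q), fst (E q)), (snd (D q), snd (E q))))) (at p)"
      by (intro has_derivative_Pair has_derivative_fst has_derivative_snd D E)
    then show ?thesis
      by (rule cdiffI) (simp add: D E, simp add: cscale_def)
  qed
  then have "holo ?H (U \<inter> V)"
    using F(1) G(1) by (auto simp: holo_def)
  then show ?thesis
    unfolding real_analytic_at_def using F G
    by (intro exI[of _ ?H] exI[of _ "U \<inter> V"]) (auto simp: zero_prod_def)
qed

text \<open>
  The extension is the complex bilinear one, the expansion of \<open>B (x + \<i> x') (y + \<i> y')\<close>.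
\<close>

lemma real_analytic_at_bilinear_aux:
  assumes "bounded_bilinear B"
  shows "real_analytic_at (\<lambda>p. B (fst p) (snd p)) x"
proof -
  interpret bounded_bilinear B by fact
  let ?H = "\<lambda>p. (B (fst (fst p)) (snd (fst p)) - B (fst (snd p)) (snd (snd p)),
                 B (fst (fst p)) (snd (snd p)) + B (fst (snd p)) (snd (fst p)))"
  have "cdiff ?H p" for p
  proof -
    have "(?H has_derivative (\<lambda>q.
       ((B (fst (fst p)) (snd (fst q)) + B (fst (fst q)) (snd (fst p))) -
        (B (fst (snd p)) (snd (snd q)) + B (fst (snd q)) (snd (snd p))),
        (B (fst (fst p)) (snd (snd q)) + B (fst (fst q)) (snd (snd p))) +
        (B (fst (snd p)) (snd (fst q)) + B (fst (snd q)) (snd (fst p)))))) (at p)"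
      by (intro has_derivative_Pair has_derivative_diff has_derivative_add FDERIV
           has_derivative_fst has_derivative_snd has_derivative_ident)
    then show ?thesis
      by (rule cdiffI) (simp add: cscale_def minus_left minus_right algebra_simps)
  qed
  then show ?thesis
    unfolding real_analytic_at_def holo_def
    by (intro exI[of _ ?H] exI[of _ UNIV]) (auto simp: zero_left zero_right)
qed

lemma real_analytic_at_bilinear:
  assumes "bounded_bilinear B" "real_analytic_at f x" "real_analytic_at g x"
  shows "real_analytic_at (\<lambda>x. B (f x) (g x)) x"
  using real_analytic_at_compose[OF real_analytic_at_Pair[OF assms(2,3)] real_analytic_at_bilinear_aux[OF assms(1)]]
  by simp

lemma real_analytic_at_linear_compose:
  "bounded_linear L \<Longrightarrow> real_analytic_at f x \<Longrightarrow> real_analytic_at (\<lambda>x. L (f x)) x"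
  by (rule real_analytic_at_compose[OF _ real_analytic_at_linear])

lemma real_analytic_at_add:
  assumes "real_analytic_at f x" "real_analytic_at g x"
  shows "real_analytic_at (\<lambda>x. f x + g x) x"
  using real_analytic_at_linear_compose[OF _ real_analytic_at_Pair[OF assms], of "\<lambda>p. fst p + snd p"]
  by (simp add: bounded_linear_add bounded_linear_fst bounded_linear_snd)

lemma real_analytic_at_minus: "real_analytic_at f x \<Longrightarrow> real_analytic_at (\<lambda>x. - f x) x"
  by (rule real_analytic_at_linear_compose) (simp add: bounded_linear_minus)

lemma real_analytic_at_diff:
  assumes "real_analytic_at f x" "real_analytic_at g x"
  shows "real_analytic_at (\<lambda>x. f x - g x) x"
  using real_analytic_at_add[OF assms(1) real_analytic_at_minus[OF assms(2)]] by simp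

lemmas real_analytic_at_mult = real_analytic_at_bilinear[OF bounded_bilinear_mult]
lemmas real_analytic_at_scaleR = real_analytic_at_bilinear[OF bounded_bilinear_scaleR]
lemmas real_analytic_at_inner = real_analytic_at_bilinear[OF bounded_bilinear_inner]

lemma real_analytic_at_sum:
  "(\<And>i. i \<in> I \<Longrightarrow> real_analytic_at (f i) x) \<Longrightarrow> real_analytic_at (\<lambda>x. \<Sum>i\<in>I. f i x) x"
  by (induction I rule: infinite_finite_induct) (auto intro: real_analytic_at_add real_analytic_at_const)

lemma real_analytic_at_prod:
  fixes f :: "'i \<Rightarrow> 'a::real_normed_vector \<Rightarrow> real"
  shows "(\<And>i. i \<in> I \<Longrightarrow> real_analytic_at (f i) x) \<Longrightarrow> real_analytic_at (\<lambda>x. \<Prod>i\<in>I. f i x) x"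
  by (induction I rule: infinite_finite_induct) (auto intro: real_analytic_at_mult real_analytic_at_const)

lemma real_analytic_at_open:
  assumes "real_analytic_at f x"
  shows "\<exists>V. open V \<and> x \<in> V \<and> (\<forall>y\<in>V. real_analytic_at f y)"
proof -
  obtain F U where F: "holo F U" "(x, 0) \<in> U" "\<And>y. (y, 0) \<in> U \<Longrightarrow> F (y, 0) = (f y, 0)"
    using assms by (auto simp: real_analytic_at_def)
  have "open ((\<lambda>y. (y, 0)) -` U)"
    using F(1) by (intro open_vimage continuous_intros) (auto simp: holo_def)
  then show ?thesis
    using F by (intro exI[of _ "(\<lambda>y. (y, 0)) -` U"]) (auto simp: real_analytic_at_def)
qed

lemma real_analytic_at_cong:
  assumes "real_analytic_at f x" "open V" "x \<in> V" "\<And>y. y \<in> V \<Longrightarrow> f y = g y"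
  shows "real_analytic_at g x"
proof -
  obtain F U where F: "holo F U" "(x, 0) \<in> U" "\<And>y. (y, 0) \<in> U \<Longrightarrow> F (y, 0) = (f y, 0)"
    using assms by (auto simp: real_analytic_at_def)
  have "open (U \<inter> fst -` V)"
    using F(1) assms by (intro open_Int open_vimage continuous_intros) (auto simp: holo_def)
  then have "holo F (U \<inter> fst -` V)" using F(1) by (auto intro: holo_subset)
  then show ?thesis
    unfolding real_analytic_at_def using F assms
    by (intro exI[of _ F] exI[of _ "U \<inter> fst -` V"]) auto
qed

lemma real_analytic_at_imp_derivative:
  assumes "real_analytic_at f x"
  shows "\<exists>D. (f has_derivative D) (at x)"
proof -
  obtain F U where F: "holo F U" "(x, 0) \<in> U" "\<And>y. (y, 0) \<in> U \<Longrightarrow> F (y, 0) = (f y, 0)"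
    using assms by (auto simp: real_analytic_at_def)
  obtain D where D: "(F has_derivative D) (at (x, 0))"
    using holo_cdiff[OF F(1,2)] by (auto simp: cdiff_def)
  have "((\<lambda>y. (y, 0)) has_derivative (\<lambda>h. (h, 0))) (at x)"
    by (intro derivative_intros)
  from has_derivative_fst[OF has_derivative_compose[OF this, of F D]] D
  have *: "((\<lambda>y. fst (F (y, 0))) has_derivative (\<lambda>h. fst (D (h, 0)))) (at x)" by simp
  have "open ((\<lambda>y. (y, 0)) -` U)"
    using F(1) by (intro open_vimage continuous_intros) (auto simp: holo_def)
  from has_derivative_transform_within_open[OF * this]
  show ?thesis using F by auto
qed

lemma real_analytic_at_imp_isCont: "real_analytic_at f x \<Longrightarrow> isCont f x"
  using real_analytic_at_imp_derivative has_derivative_continuous by blast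

lemma real_analytic_at_holomorphic:
  fixes f :: "real \<Rightarrow> real"
  assumes g: "g holomorphic_on S" "open S" "of_real x \<in> S"
    and fg: "\<And>y. of_real y \<in> S \<Longrightarrow> g (of_real y) = of_real (f y)"
  shows "real_analytic_at f x"
proof -
  let ?c = "\<lambda>p. Complex (fst p) (snd p)"
  let ?F = "\<lambda>p. (Re (g (?c p)), Im (g (?c p)))"
  have c: "?c = (\<lambda>p. of_real (fst p) + \<i> * of_real (snd p))"
    by (simp add: fun_eq_iff complex_eq_iff)
  have bl: "bounded_linear ?c"
    unfolding c by (intro bounded_linear_add bounded_linear_mult_right[THEN bounded_linear_compose]
        bounded_linear_of_real[THEN bounded_linear_compose] bounded_linear_fst bounded_linear_snd)
  have "open (?c -` S)"
    using g bl by (intro open_vimage linear_continuous_on) auto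
  moreover have "cdiff ?F p" if cp: "?c p \<in> S" for p
  proof -
    obtain d where "(g has_field_derivative d) (at (?c p))"
      using g(1)[unfolded holomorphic_on_open[OF g(2)], THEN bspec, OF cp] by (elim exE)
    then have "(g has_derivative (\<lambda>h. d * h)) (at (?c p))" by (rule has_field_derivative_imp_has_derivative)
    from has_derivative_compose[OF bounded_linear.has_derivative[OF bl has_derivative_ident] this]
    have *: "((\<lambda>p. g (?c p)) has_derivative (\<lambda>q. d * ?c q)) (at p)" .
    have "(?F has_derivative (\<lambda>q. (Re (d * ?c q), Im (d * ?c q)))) (at p)"
      by (intro has_derivative_Pair bounded_linear.has_derivative[OF bounded_linear_Re]
           bounded_linear.has_derivative[OF bounded_linear_Im] *)
    then show ?thesis
      by (rule cdiffI) (simp add: cscale_def algebra_simps)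
  qed
  ultimately have "holo ?F (?c -` S)" by (auto simp: holo_def)
  moreover have "Complex y 0 = of_real y" for y by (simp add: complex_eq_iff)
  ultimately show ?thesis
    unfolding real_analytic_at_def using g fg
    by (intro exI[of _ ?F] exI[of _ "?c -` S"]) auto
qed

section \<open>Holomorphic maps on complex lines\<close>

text \<open>
  The complex coordinate of \<open>w\<close> belonging to the basis vector \<open>b\<close>.
\<close>

definition ccoord :: "'b::real_inner \<Rightarrow> 'b \<times> 'b \<Rightarrow> complex" where
  "ccoord b w = Complex (fst w \<bullet> b) (snd w \<bullet> b)"

lemma ccoord_cscale: "ccoord b (cscale z w) = z * ccoord b w"
  by (simp add: ccoord_def cscale_def complex_eq_iff inner_diff_left inner_add_left)

lemma bounded_linear_ccoord: "bounded_linear (ccoord b)"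
proof -
  have "ccoord b = (\<lambda>w. of_real (fst w \<bullet> b) + \<i> * of_real (snd w \<bullet> b))"
    by (simp add: fun_eq_iff complex_eq_iff ccoord_def)
  then show ?thesis
    by (simp, intro bounded_linear_add bounded_linear_mult_right[THEN bounded_linear_compose]
        bounded_linear_of_real[THEN bounded_linear_compose] bounded_linear_fst bounded_linear_snd
        bounded_linear_inner_left[THEN bounded_linear_compose])
qed

lemma ccoord_eqI:
  fixes v w :: "'b::euclidean_space \<times> 'b"
  assumes "\<And>b. b \<in> Basis \<Longrightarrow> ccoord b v = ccoord b w"
  shows "v = w"
proof -
  have "fst v \<bullet> b = fst w \<bullet> b \<and> snd v \<bullet> b = snd w \<bullet> b" if "b \<in> Basis" for b
    using assms[OF that] by (simp add: ccoord_def)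
  then show ?thesis by (intro prod_eqI euclidean_eqI[of "fst v"] euclidean_eqI[of "snd v"]) auto
qed

lemma ccoord_line_derivative:
  assumes D: "(F has_derivative D) (at (p + cscale w q))" "\<And>q. D (cscale \<i> q) = cscale \<i> (D q)"
  shows "((\<lambda>w. ccoord b (F (p + cscale w q))) has_field_derivative ccoord b (D q)) (at w)"
proof -
  have "((\<lambda>w. p + cscale w q) has_derivative (\<lambda>h. 0 + cscale h q)) (at w)"
    by (intro has_derivative_add has_derivative_const bounded_linear.has_derivative[OF bounded_linear_cscale_left] has_derivative_ident)
  from bounded_linear.has_derivative[OF bounded_linear_ccoord[of b] has_derivative_compose[OF this D(1)]]
  have "((\<lambda>w. ccoord b (F (p + cscale w q))) has_derivative (\<lambda>h. ccoord b (D (cscale h q)))) (at w)"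
    by simp
  moreover have "D (cscale h q) = cscale h (D q)" for h
    using linear_commutes_cscale[OF has_derivative_linear[OF D(1)] D(2)] .
  ultimately show ?thesis
    unfolding has_field_derivative_def by (simp add: ccoord_cscale mult.commute[of _ "ccoord b (D q)"])
qed

lemma ccoord_line_holomorphic:
  assumes "\<And>w. w \<in> S \<Longrightarrow> cdiff F (p + cscale w q)" "open S"
  shows "(\<lambda>w. ccoord b (F (p + cscale w q))) holomorphic_on S"
  unfolding holomorphic_on_open[OF assms(2)]
proof
  fix w assume "w \<in> S"
  then obtain D where "(F has_derivative D) (at (p + cscale w q))" "\<And>q. D (cscale \<i> q) = cscale \<i> (D q)"
    using assms(1)[of w] unfolding cdiff_def by blast
  from ccoord_line_derivative[OF this]
  show "\<exists>f'. ((\<lambda>w. ccoord b (F (p + cscale w q))) has_field_derivative f') (at w)" by blast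
qed

lemma has_sum_finite_sum:
  fixes f :: "'i \<Rightarrow> 'x \<Rightarrow> 'c::real_normed_vector"
  shows "(\<And>b. b \<in> B \<Longrightarrow> (f b has_sum s b) A) \<Longrightarrow> ((\<lambda>x. \<Sum>b\<in>B. f b x) has_sum (\<Sum>b\<in>B. s b)) A"
  by (induction B rule: infinite_finite_induct) (auto intro: has_sum_add)

text \<open>
  In complex coordinates with respect to \<open>Basis\<close> the extension is bounded and holomorphic in each variable on a
  small polydisc. Its power series restricts to the real points, where the real parts of the coefficients suffice.
\<close>

theorem real_analytic_at_imp_power_series:
  fixes f :: "'a::euclidean_space \<Rightarrow> 'b::euclidean_space"
  assumes "real_analytic_at f x"
  shows "has_power_series_at f x"
proof -
  obtain F U where F: "holo F U" "(x, 0) \<in> U" "\<And>y. (y, 0) \<in> U \<Longrightarrow> F (y, 0) = (f y, 0)"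
    using assms by (auto simp: real_analytic_at_def)
  obtain e where e: "e > 0" "cball (x, 0) e \<subseteq> U"
    using F by (meson holo_def open_contains_cball)
  have "compact (F ` cball (x, 0) e)"
    using holo_imp_continuous_on[OF F(1)] e by (intro compact_continuous_image) (auto intro: continuous_on_subset)
  then obtain K where K: "\<And>p. p \<in> cball (x, 0) e \<Longrightarrow> norm (F p) \<le> K"
    by (meson bounded_iff compact_imp_bounded imageI)
  define N where "N = real DIM('a)"
  \<comment> \<open>Coordinates below \<open>R\<close> keep the real and the imaginary displacement below \<open>e / 2\<close> each.\<close>
  define R where "R = e / (2 * N)"
  have N: "N > 0" by (simp add: N_def)
  have R: "R > 0" using e N by (simp add: R_def)
  define P where "P z = (x + (\<Sum>b\<in>Basis. Re (z b) *\<^sub>R b), \<Sum>b\<in>Basis. Im (z b) *\<^sub>R b)" for z :: "'a \<Rightarrow> complex"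
  have P: "P z \<in> cball (x, 0) e" if z: "z \<in> polydisc Basis R" for z
  proof -
    have 1: "norm (\<Sum>b\<in>Basis. t b *\<^sub>R b) \<le> N * R" if t: "\<And>b. \<bar>t b\<bar> \<le> norm (z b)" for t :: "'a \<Rightarrow> real"
    proof -
      have "norm (t b *\<^sub>R b) \<le> R" if "b \<in> Basis" for b
        using t[of b] z that by (auto simp: polydisc_def intro: order_trans less_imp_le)
      from sum_norm_le[of Basis "\<lambda>b. t b *\<^sub>R b" "\<lambda>_. R", OF this] show ?thesis by (simp add: N_def)
    qed
    have "dist (x, 0) (P z) = norm (\<Sum>b\<in>Basis. Re (z b) *\<^sub>R b, \<Sum>b\<in>Basis. Im (z b) *\<^sub>R b)"
      unfolding dist_norm norm_minus_commute[of "(x, 0)"] P_def by simp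
    also have "\<dots> \<le> norm (\<Sum>b\<in>Basis. Re (z b) *\<^sub>R b) + norm (\<Sum>b\<in>Basis. Im (z b) *\<^sub>R b)"
      by (rule norm_Pair_le)
    also have "\<dots> \<le> N * R + N * R"
      by (intro add_mono 1 abs_Re_le_cmod abs_Im_le_cmod)
    also have "\<dots> = e" using N by (simp add: R_def)
    finally show ?thesis by simp
  qed
  define g where "g b z = ccoord b (F (P z))" for b :: 'b and z
  have g: "bounded_sep_hol Basis R (2 * K) (g b)" if b: "b \<in> Basis" for b
    unfolding bounded_sep_hol_def
  proof (intro ballI conjI)
    fix z :: "'a \<Rightarrow> complex" assume z: "z \<in> polydisc Basis R"
    have "norm (g b z) \<le> \<bar>fst (F (P z)) \<bullet> b\<bar> + \<bar>snd (F (P z)) \<bullet> b\<bar>"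
      unfolding g_def ccoord_def by (rule order_trans[OF cmod_le]) simp
    also have "\<dots> \<le> norm (F (P z)) + norm (F (P z))"
      using b norm_fst_le[of "fst (F (P z))" "snd (F (P z))"] norm_snd_le[of "snd (F (P z))" "fst (F (P z))"]
      by (intro add_mono order_trans[OF Basis_le_norm]) auto
    also have "\<dots> \<le> 2 * K" using K[OF P[OF z]] by simp
    finally show "norm (g b z) \<le> 2 * K" .
    fix i :: 'a assume i: "i \<in> Basis"
    have PP: "P (z(i := w)) = P (z(i := 0)) + cscale w (i, 0)" for w
    proof -
      have *: "(\<Sum>b\<in>Basis. c ((z(i := w)) b) *\<^sub>R b) = (\<Sum>b\<in>Basis. c ((z(i := 0)) b) *\<^sub>R b) + c w *\<^sub>R i"
        if c0: "c 0 = 0" for c :: "complex \<Rightarrow> real"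
      proof -
        have "(\<Sum>b\<in>Basis. c ((z(i := w)) b) *\<^sub>R b) = (\<Sum>b\<in>Basis. c ((z(i := 0)) b) *\<^sub>R b + (if b = i then c w *\<^sub>R i else 0))"
          by (intro sum.cong) (auto simp: c0)
        also have "\<dots> = (\<Sum>b\<in>Basis. c ((z(i := 0)) b) *\<^sub>R b) + c w *\<^sub>R i"
          using i by (simp add: sum.distrib del: fun_upd_apply)
        finally show ?thesis .
      qed
      show ?thesis
        unfolding P_def cscale_def using *[of Re] *[of Im] by (simp add: add.assoc del: fun_upd_apply)
    qed
    show "(\<lambda>w. g b (z(i := w))) holomorphic_on ball 0 R"
      unfolding g_def
    proof (subst PP, rule ccoord_line_holomorphic)
      fix w :: complex assume "w \<in> ball 0 R"
      then have "P (z(i := w)) \<in> U" using e P[OF polydisc_upd[OF z i]] by auto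
      then have "cdiff F (P (z(i := w)))" by (rule holo_cdiff[OF F(1)])
      then show "cdiff F (P (z(i := 0)) + cscale w (i, 0))" by (subst (asm) PP)
    qed simp
  qed
  have "\<forall>b. \<exists>c. b \<in> Basis \<longrightarrow> (\<forall>z\<in>polydisc Basis (R / 2). ((\<lambda>\<alpha>. c \<alpha> * (\<Prod>i\<in>Basis. z i ^ \<alpha> i)) has_sum g b z) (Basis \<rightarrow>\<^sub>E UNIV))"
    using polydisc_power_series[OF finite_Basis R g] by blast
  from choice[OF this] obtain c where c: "\<And>b z. b \<in> Basis \<Longrightarrow> z \<in> polydisc Basis (R / 2) \<Longrightarrow>
      ((\<lambda>\<alpha>. c b \<alpha> * (\<Prod>i\<in>Basis. z i ^ \<alpha> i)) has_sum g b z) (Basis \<rightarrow>\<^sub>E UNIV)" by blast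
  have "((\<lambda>\<alpha>. monomial \<alpha> h *\<^sub>R (\<Sum>b\<in>Basis. Re (c b \<alpha>) *\<^sub>R b)) has_sum f (x + h)) multi_index"
    if h: "norm h < R / 2" for h
  proof -
    define z where "z b = (if b \<in> Basis then complex_of_real (h \<bullet> b) else 0)" for b
    have "\<bar>h \<bullet> b\<bar> < R / 2" if "b \<in> Basis" for b
      using Basis_le_norm[OF that, of h] h by linarith
    then have z: "z \<in> polydisc Basis (R / 2)"
      by (simp add: polydisc_def z_def)
    then have "z \<in> polydisc Basis R" using R by (force simp: polydisc_def)
    from P[OF this] have PU: "P z \<in> U" using e by blast
    have "(\<Sum>b\<in>Basis. Re (z b) *\<^sub>R b) = (\<Sum>b\<in>Basis. (h \<bullet> b) *\<^sub>R b)" "(\<Sum>b\<in>Basis. Im (z b) *\<^sub>R b) = (\<Sum>b\<in>Basis. 0)"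
      by (auto simp: z_def intro!: sum.cong)
    then have "P z = (x + h, 0)" by (simp add: P_def euclidean_representation)
    with PU F have Pz: "F (P z) = (f (x + h), 0)" by simp
    have "((\<lambda>\<alpha>. (monomial \<alpha> h * Re (c b \<alpha>)) *\<^sub>R b) has_sum ((f (x + h) \<bullet> b) *\<^sub>R b)) multi_index"
      if b: "b \<in> Basis" for b
    proof -
      have m: "(\<Prod>i\<in>Basis. z i ^ \<alpha> i) = of_real (monomial \<alpha> h)" for \<alpha>
        by (simp add: monomial_def z_def)
      have "((\<lambda>\<alpha>. Re (c b \<alpha> * (\<Prod>i\<in>Basis. z i ^ \<alpha> i))) has_sum Re (g b z)) (Basis \<rightarrow>\<^sub>E UNIV)"
        by (rule has_sum_Re[OF c[OF b z]])
      then have "((\<lambda>\<alpha>. monomial \<alpha> h * Re (c b \<alpha>)) has_sum (f (x + h) \<bullet> b)) multi_index"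
        by (simp add: m g_def Pz ccoord_def multi_index_def mult.commute)
      then show ?thesis
        using has_sum_bounded_linear[OF bounded_linear_scaleR_left] by blast
    qed
    then have "((\<lambda>\<alpha>. \<Sum>b\<in>Basis. (monomial \<alpha> h * Re (c b \<alpha>)) *\<^sub>R b) has_sum (\<Sum>b\<in>Basis. (f (x + h) \<bullet> b) *\<^sub>R b)) multi_index"
      by (rule has_sum_finite_sum)
    then show ?thesis
      by (simp add: euclidean_representation scaleR_sum_right)
  qed
  then show ?thesis
    unfolding has_power_series_at_def using R
    by (intro exI[of _ "R / 2"] conjI exI[of _ "\<lambda>\<alpha>. \<Sum>b\<in>Basis. Re (c b \<alpha>) *\<^sub>R b"]) auto
qed

lemma real_analytic_onI:
  assumes "\<And>x. x \<in> S \<Longrightarrow> \<exists>g V. real_analytic_at g x \<and> open V \<and> x \<in> V \<and> (\<forall>y\<in>S \<inter> V. f y = g y)"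
  shows "real_analytic_on f S"
  unfolding real_analytic_on_def
proof
  fix x assume "x \<in> S"
  then obtain g V where g: "real_analytic_at g x" "open V" "x \<in> V" "\<And>y. y \<in> S \<inter> V \<Longrightarrow> f y = g y"
    using assms by blast
  obtain W where "open W" "x \<in> W" "\<And>y. y \<in> W \<Longrightarrow> real_analytic_at g y"
    using real_analytic_at_open[OF g(1)] by blast
  then show "\<exists>U g. open U \<and> x \<in> U \<and> (\<forall>y\<in>U. has_power_series_at g y) \<and> (\<forall>y\<in>S \<inter> U. f y = g y)"
    using g by (intro exI[of _ "V \<inter> W"] exI[of _ g]) (auto intro: real_analytic_at_imp_power_series)
qed

section \<open>Derivatives, parameter integrals and implicit functions\<close>

text \<open>
  Cauchy's formula for the first derivative on the complex line through \<open>p\<close> in the direction \<open>q\<close>.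
\<close>

lemma has_integral_directional_derivative:
  fixes F :: "'a::euclidean_space \<times> 'a \<Rightarrow> 'b::euclidean_space \<times> 'b"
  assumes F: "holo F U" and r: "r > 0" and U: "\<And>w. norm w \<le> r \<Longrightarrow> p + cscale w q \<in> U"
    and D: "(F has_derivative D) (at p)" "\<And>q. D (cscale \<i> q) = cscale \<i> (D q)"
  shows "D q = integral {0..1} (\<lambda>t. cscale (exp (- (2 * of_real pi * \<i> * of_real t)) / r)
           (F (p + cscale (r * exp (2 * of_real pi * \<i> * of_real t)) q)))"
    (is "_ = integral _ ?H")
proof (rule ccoord_eqI)
  fix b :: 'b assume "b \<in> Basis"
  let ?e = "\<lambda>t. exp (2 * of_real pi * \<i> * of_real t) :: complex"
  have ne: "norm (?e t) = 1" for t by (simp add: norm_exp_eq_Re)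
  define f where "f w = ccoord b (F (p + cscale w q))" for w
  have holf: "f holomorphic_on ball 0 r"
    unfolding f_def using U by (intro ccoord_line_holomorphic holo_cdiff[OF F]) auto
  have contf: "continuous_on (cball 0 r) f"
    unfolding f_def
    by (intro continuous_on_compose2[OF linear_continuous_on[OF bounded_linear_ccoord]]
        continuous_on_compose2[OF holo_imp_continuous_on[OF F]] continuous_intros
        linear_continuous_on[OF bounded_linear_cscale_left]) (use U in auto)
  have df: "deriv f 0 = ccoord b (D q)"
    unfolding f_def by (rule DERIV_imp_deriv, rule ccoord_line_derivative)
      (use D in \<open>simp_all add: cscale_of_real[of 0, simplified]\<close>)
  have "((\<lambda>u. f u / (u - 0) ^ Suc 1) has_contour_integral (2 * pi * \<i>) / fact 1 * (deriv ^^ 1) f 0) (circlepath 0 r)"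
    using r by (intro Cauchy_has_contour_integral_higher_derivative_circlepath contf holf) auto
  then have c: "((\<lambda>u. f u / u ^ 2) has_contour_integral 2 * of_real pi * \<i> * deriv f 0) (circlepath 0 r)"
    by (simp add: power2_eq_square)
  have "((\<lambda>t. ccoord b (?H t) * (2 * of_real pi * \<i>)) has_integral 2 * of_real pi * \<i> * deriv f 0) {0..1}"
  proof (rule has_integral_eq[OF _ c[unfolded has_contour_integral_def]])
    fix t :: real assume "t \<in> {0..1}"
    then have vd: "vector_derivative (circlepath 0 r) (at t within {0..1}) = 2 * of_real pi * \<i> * of_real r * ?e t"
      by (simp add: vector_derivative_circlepath01)
    have cp: "circlepath 0 r t = of_real r * ?e t" by (simp add: circlepath)
    show "f (circlepath 0 r t) / circlepath 0 r t ^ 2 * vector_derivative (circlepath 0 r) (at t within {0..1}) =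
        ccoord b (?H t) * (2 * of_real pi * \<i>)"
      unfolding vd cp using r by (simp add: ccoord_cscale f_def exp_minus power2_eq_square field_simps)
  qed
  from has_integral_mult_left[OF this, of "inverse (2 * of_real pi * \<i>)"]
  have "((\<lambda>t. ccoord b (?H t)) has_integral ccoord b (D q)) {0..1}"
    by (simp add: df field_simps)
  moreover have "continuous_on {0..1} ?H"
    by (intro bounded_bilinear.continuous_on[OF bounded_bilinear_cscale]
        continuous_on_compose2[OF holo_imp_continuous_on[OF F]] continuous_intros)
      (use r U ne in \<open>auto simp: norm_mult\<close>)
  then have "?H integrable_on {0..1}" by (rule integrable_continuous_real)
  then have "((\<lambda>t. ccoord b (?H t)) has_integral ccoord b (integral {0..1} ?H)) {0..1}"
    using has_integral_linear[OF integrable_integral bounded_linear_ccoord] by (simp add: o_def)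
  ultimately show "ccoord b (D q) = ccoord b (integral {0..1} ?H)"
    by (rule has_integral_unique)
qed

text \<open>
  One radius of the circles in Cauchy's formula serves all centers near \<open>p0\<close>; only then can the formula be
  differentiated with respect to the center.
\<close>

lemma cscale_room:
  fixes p0 q :: "'a::real_normed_vector \<times> 'a"
  assumes "open U" "p0 \<in> U"
  shows "\<exists>\<delta> r. \<delta> > 0 \<and> r > 0 \<and> ball p0 \<delta> \<subseteq> U \<and> (\<forall>p w. p \<in> ball p0 \<delta> \<longrightarrow> norm w \<le> r \<longrightarrow> p + cscale w q \<in> U)"
proof -
  obtain e where e: "e > 0" "ball p0 e \<subseteq> U" using assms by (meson openE)
  define r where "r = e / (4 * (norm q + 1))"
  have q: "norm q + 1 > 0" using norm_ge_zero[of q] by linarith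
  have r: "r > 0" using e q by (simp add: r_def)
  have "p + cscale w q \<in> U" if "p \<in> ball p0 (e / 2)" "norm w \<le> r" for p w
  proof -
    have "norm (cscale w q) \<le> 2 * norm w * norm q" by (rule norm_cscale)
    also have "\<dots> \<le> 2 * r * (norm q + 1)" using that r by (intro mult_mono) auto
    also have "\<dots> = e / 2" using q by (simp add: r_def field_simps)
    finally have "norm (cscale w q) \<le> e / 2" .
    moreover have "dist p0 (p + cscale w q) \<le> dist p0 p + norm (cscale w q)"
      using norm_triangle_ineq4[of "p0 - p" "cscale w q"] by (simp add: dist_norm diff_diff_eq)
    ultimately have "p + cscale w q \<in> ball p0 e" using that by simp
    then show ?thesis using e by blast
  qed
  moreover have "ball p0 (e / 2) \<subseteq> U" using e by (auto simp: subset_iff)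
  ultimately show ?thesis
    using e r by (intro exI[of _ "e / 2"] exI[of _ r]) auto
qed

definition cderiv :: "('a::euclidean_space \<times> 'a \<Rightarrow> 'b::euclidean_space \<times> 'b) \<Rightarrow> 'a \<times> 'a \<Rightarrow> ('a \<times> 'a) \<Rightarrow>\<^sub>L ('b \<times> 'b)" where
  "cderiv F p = Blinfun (frechet_derivative F (at p))"

lemma cderiv:
  assumes "cdiff F p"
  shows "(F has_derivative blinfun_apply (cderiv F p)) (at p)" "cderiv F p (cscale \<i> q) = cscale \<i> (cderiv F p q)"
proof -
  obtain D where D: "(F has_derivative D) (at p)" "\<And>q. D (cscale \<i> q) = cscale \<i> (D q)"
    using assms unfolding cdiff_def by blast
  have "blinfun_apply (cderiv F p) = D"
    using D(1) unfolding cderiv_def frechet_derivative_at[OF D(1), symmetric]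
    by (simp add: bounded_linear_Blinfun_apply has_derivative_bounded_linear)
  then show "(F has_derivative blinfun_apply (cderiv F p)) (at p)" "cderiv F p (cscale \<i> q) = cscale \<i> (cderiv F p q)"
    using D by simp_all
qed

text \<open>
  By Cauchy's formula a directional derivative is an integral depending continuously on the center.
\<close>

lemma holo_imp_continuous_cderiv:
  assumes F: "holo F U"
  shows "continuous_on U (cderiv F)"
proof (rule continuous_on_blinfun_componentwise)
  fix q :: "'a \<times> 'a"
  show "continuous_on U (\<lambda>p. cderiv F p q)"
  proof (rule continuous_at_imp_continuous_on, rule ballI)
    fix p0 assume "p0 \<in> U"
    then obtain \<delta> r where d: "\<delta> > 0" "r > 0" "ball p0 \<delta> \<subseteq> U"
      and U: "\<And>p w. p \<in> ball p0 \<delta> \<Longrightarrow> norm w \<le> r \<Longrightarrow> p + cscale w q \<in> U"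
      using cscale_room[of U p0 q] F unfolding holo_def by blast
    let ?H = "\<lambda>p t. cscale (exp (- (2 * of_real pi * \<i> * of_real t)) / r)
           (F (p + cscale (r * exp (2 * of_real pi * \<i> * of_real t)) q))"
    have "continuous_on (ball p0 \<delta> \<times> cbox 0 1) (\<lambda>(p, t). ?H p t)"
      unfolding split_beta
      by (intro bounded_bilinear.continuous_on[OF bounded_bilinear_cscale]
        continuous_on_compose2[OF holo_imp_continuous_on[OF F]] continuous_intros)
       (use d U in \<open>auto simp: norm_mult norm_exp_eq_Re\<close>)
    then have "continuous_on (ball p0 \<delta>) (\<lambda>p. integral (cbox 0 1) (?H p))"
      by (rule integral_continuous_on_param)
    moreover have "integral (cbox 0 1) (?H p) = cderiv F p q" if p: "p \<in> ball p0 \<delta>" for p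
      using has_integral_directional_derivative[OF F d(2) U[OF p] cderiv[OF holo_cdiff[OF F]]] p d by auto
    ultimately have "continuous_on (ball p0 \<delta>) (\<lambda>p. cderiv F p q)"
      by (rule continuous_on_eq)
    then show "isCont (\<lambda>p. cderiv F p q) p0"
      using d by (simp add: continuous_on_eq_continuous_at)
  qed
qed

lemma holo_integral:
  fixes H :: "'a::euclidean_space \<times> 'a \<Rightarrow> real \<Rightarrow> 'b::euclidean_space \<times> 'b"
  assumes V: "open V"
    and H': "\<And>p t. p \<in> V \<Longrightarrow> t \<in> {a..b} \<Longrightarrow> ((\<lambda>p. H p t) has_derivative blinfun_apply (H' p t)) (at p)"
    and comm: "\<And>p t q. p \<in> V \<Longrightarrow> t \<in> {a..b} \<Longrightarrow> H' p t (cscale \<i> q) = cscale \<i> (H' p t q)"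
    and cont: "continuous_on (V \<times> {a..b}) (\<lambda>(p, t). H' p t)"
    and int: "\<And>p. p \<in> V \<Longrightarrow> H p integrable_on {a..b}"
  shows "holo (\<lambda>p. integral {a..b} (H p)) V"
  unfolding holo_def
proof (intro conjI V ballI)
  fix p assume p: "p \<in> V"
  then obtain e where e: "e > 0" "ball p e \<subseteq> V" using V by (meson openE)
  have "((\<lambda>x. integral (cbox a b) (H x)) has_derivative blinfun_apply (integral (cbox a b) (H' p))) (at p within ball p e)"
  proof (rule leibniz_rule)
    show "((\<lambda>x. H x t) has_derivative blinfun_apply (H' x t)) (at x within ball p e)" if "x \<in> ball p e" "t \<in> cbox a b" for x t
      using has_derivative_at_withinI[OF H'[of x t]] that e by auto
    show "continuous_on (ball p e \<times> cbox a b) (\<lambda>(x, t). H' x t)"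
      using cont e by (auto intro: continuous_on_subset)
  qed (use int e in auto)
  then have 1: "((\<lambda>x. integral {a..b} (H x)) has_derivative blinfun_apply (integral {a..b} (H' p))) (at p)"
    using e by (simp add: at_within_open[of p "ball p e"])
  have "continuous_on {a..b} (\<lambda>t. (\<lambda>(p, t). H' p t) (p, t))"
    by (rule continuous_on_compose2[OF cont]) (use p in \<open>auto intro!: continuous_intros\<close>)
  then have ig: "H' p integrable_on {a..b}" by (auto intro: integrable_continuous_real)
  have ap: "integral {a..b} (H' p) q = integral {a..b} (\<lambda>t. H' p t q)" for q
    using integral_linear[OF ig blinfun.bounded_linear_left] by (simp add: o_def)
  have igq: "(\<lambda>t. H' p t q) integrable_on {a..b}" for q
    using integrable_linear[OF ig blinfun.bounded_linear_left] by (simp add: o_def)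
  have "integral {a..b} (\<lambda>t. H' p t (cscale \<i> q)) = integral {a..b} (\<lambda>t. cscale \<i> (H' p t q))" for q
    using comm[OF p] by (intro integral_cong) auto
  also have "\<dots>q = cscale \<i> (integral {a..b} (\<lambda>t. H' p t q))" for q
    using integral_linear[OF igq bounded_linear_cscale_right] by (simp add: o_def)
  finally show "cdiff (\<lambda>p. integral {a..b} (H p)) p"
    by (intro cdiffI[OF 1]) (simp add: ap)
qed

lemma holo_cong: "holo F U \<Longrightarrow> (\<And>p. p \<in> U \<Longrightarrow> F p = G p) \<Longrightarrow> holo G U"
  unfolding holo_def cdiff_def by (metis has_derivative_transform_within_open)

lemma holo_local: "(\<And>p. p \<in> U \<Longrightarrow> \<exists>V. p \<in> V \<and> V \<subseteq> U \<and> holo F V) \<Longrightarrow> holo F U"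
  unfolding holo_def by (meson open_subopen)

text \<open>
  Differentiating Cauchy's formula under the integral sign.
\<close>

lemma holo_directional_derivative:
  fixes F :: "'a::euclidean_space \<times> 'a \<Rightarrow> 'b::euclidean_space \<times> 'b"
  assumes F: "holo F U"
  shows "holo (\<lambda>p. cderiv F p q) U"
proof (rule holo_local)
  fix p0 assume "p0 \<in> U"
  then obtain \<delta> r where d: "\<delta> > 0" "r > 0" "ball p0 \<delta> \<subseteq> U"
    and U: "\<And>p w. p \<in> ball p0 \<delta> \<Longrightarrow> norm w \<le> r \<Longrightarrow> p + cscale w q \<in> U"
    using cscale_room[of U p0 q] F unfolding holo_def by blast
  define z where "z t = exp (- (2 * of_real pi * \<i> * of_real t)) / of_real r" for t :: real
  define c where "c t = of_real r * exp (2 * of_real pi * \<i> * of_real t)" for t :: real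
  have cU: "p + cscale (c t) q \<in> U" if "p \<in> ball p0 \<delta>" for p t
    using U[OF that, of "c t"] d by (simp add: c_def norm_mult norm_exp_eq_Re)
  let ?H = "\<lambda>p t. cscale (z t) (F (p + cscale (c t) q))"
  let ?J = "Blinfun (cscale \<i> :: 'b \<times> 'b \<Rightarrow> _)"
  let ?H' = "\<lambda>p t. Re (z t) *\<^sub>R cderiv F (p + cscale (c t) q) + Im (z t) *\<^sub>R (?J o\<^sub>L cderiv F (p + cscale (c t) q))"
  have J: "blinfun_apply ?J p = cscale \<i> p" for p
    by (simp add: bounded_linear_Blinfun_apply bounded_linear_cscale_right)
  have H': "?H' p t v = cscale (z t) (cderiv F (p + cscale (c t) q) v)" for p t v
    by (simp add: blinfun.bilinear_simps J cscale_decomp[of "z t"])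
  have cc: "continuous_on S c" "continuous_on S z" for S
    using d unfolding c_def z_def by (auto intro!: continuous_intros)
  have "holo (\<lambda>p. integral {0..1} (?H p)) (ball p0 \<delta>)"
  proof (rule holo_integral)
    fix p t assume p: "p \<in> ball p0 \<delta>" and t: "t \<in> {0..1::real}"
    have "((\<lambda>p. p + cscale (c t) q) has_derivative (\<lambda>h. h)) (at p)"
      by (auto intro!: derivative_eq_intros)
    from has_derivative_compose[OF this cderiv(1)[OF holo_cdiff[OF F cU[OF p]]]]
    have "((\<lambda>p. F (p + cscale (c t) q)) has_derivative cderiv F (p + cscale (c t) q)) (at p)" by simp
    from bounded_linear.has_derivative[OF bounded_linear_cscale_right this]
    show "((\<lambda>p. ?H p t) has_derivative blinfun_apply (?H' p t)) (at p)"
      by (simp add: H'[abs_def, unfolded fun_eq_iff] ext)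
    show "?H' p t (cscale \<i> v) = cscale \<i> (?H' p t v)" for v
      unfolding H' by (simp add: cderiv(2)[OF holo_cdiff[OF F cU[OF p]]] cscale_mult mult.commute)
  next
    fix p assume p: "p \<in> ball p0 \<delta>"
    have "continuous_on {0..1} (?H p)"
      by (intro bounded_bilinear.continuous_on[OF bounded_bilinear_cscale] cc
        continuous_on_compose2[OF holo_imp_continuous_on[OF F]] continuous_intros) (use cU[OF p] in \<open>simp_all add: image_subset_iff\<close>)
    then show "?H p integrable_on {0..1}" by (rule integrable_continuous_real)
  next
    have "continuous_on (ball p0 \<delta> \<times> {0..1}) (\<lambda>x. cderiv F (fst x + cscale (c (snd x)) q))"
      by (intro continuous_on_compose2[OF holo_imp_continuous_cderiv[OF F]]
          bounded_bilinear.continuous_on[OF bounded_bilinear_cscale] continuous_on_compose2[OF cc(1)[of UNIV]] continuous_intros)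
        (use cU in \<open>simp_all add: image_subset_iff mem_Times_iff\<close>)
    moreover have "continuous_on (ball p0 \<delta> \<times> {0..1}) (\<lambda>x. z (snd x))"
      by (intro continuous_on_compose2[OF cc(2)[of UNIV]] continuous_intros) auto
    ultimately show "continuous_on (ball p0 \<delta> \<times> {0..1}) (\<lambda>(p, t). ?H' p t)"
      unfolding split_beta by (intro continuous_intros)
  qed simp
  then have "holo (\<lambda>p. cderiv F p q) (ball p0 \<delta>)"
  proof (rule holo_cong)
    fix p assume p: "p \<in> ball p0 \<delta>"
    then show "integral {0..1} (?H p) = cderiv F p q"
      using has_integral_directional_derivative[OF F d(2) U[OF p] cderiv[OF holo_cdiff[OF F]]] d
      by (auto simp: z_def c_def)
  qed
  then show "\<exists>V. p0 \<in> V \<and> V \<subseteq> U \<and> holo (\<lambda>p. cderiv F p q) V"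
    using d by (intro exI[of _ "ball p0 \<delta>"]) auto
qed

text \<open>
  On real directions the derivative of an extension is that of the map itself, since extensions are real at
  real points.
\<close>

lemma cderiv_real_direction:
  assumes F: "holo F U" "(y, 0) \<in> U" "\<And>y. (y, 0) \<in> U \<Longrightarrow> F (y, 0) = (f y, 0)"
    and D: "(f has_derivative D) (at y)"
  shows "cderiv F (y, 0) (u, 0) = (D u, 0)"
proof -
  have "((\<lambda>y. (y, 0)) has_derivative (\<lambda>h. (h, 0))) (at y)"
    by (intro derivative_intros)
  from has_derivative_compose[OF this, of F "cderiv F (y, 0)"]
  have 1: "((\<lambda>y. F (y, 0)) has_derivative (\<lambda>h. cderiv F (y, 0) (h, 0))) (at y)"
    using cderiv(1)[OF holo_cdiff[OF F(1,2)]] by simp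
  have "open ((\<lambda>y. (y, 0)) -` U)"
    using F(1) by (intro open_vimage continuous_intros) (auto simp: holo_def)
  from has_derivative_transform_within_open[OF 1 this]
  have "((\<lambda>y. (f y, 0)) has_derivative (\<lambda>h. cderiv F (y, 0) (h, 0))) (at y)"
    using F by auto
  moreover have "((\<lambda>y. (f y, 0)) has_derivative (\<lambda>h. (D h, 0))) (at y)"
    by (intro has_derivative_Pair D has_derivative_const)
  ultimately show ?thesis by (metis has_derivative_unique)
qed

theorem real_analytic_at_directional_derivative:
  fixes f :: "'a::euclidean_space \<Rightarrow> 'b::euclidean_space"
  assumes f: "real_analytic_at f x" and V: "open V" "x \<in> V" "\<And>y. y \<in> V \<Longrightarrow> (f has_derivative D y) (at y)"
  shows "real_analytic_at (\<lambda>y. D y u) x"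
proof -
  obtain F U where F: "holo F U" "(x, 0) \<in> U" "\<And>y. (y, 0) \<in> U \<Longrightarrow> F (y, 0) = (f y, 0)"
    using f by (auto simp: real_analytic_at_def)
  have "open (U \<inter> fst -` V)"
    using F(1) V by (intro open_Int open_vimage continuous_intros) (auto simp: holo_def)
  then have "holo (\<lambda>p. cderiv F p (u, 0)) (U \<inter> fst -` V)"
    using holo_directional_derivative[OF F(1)] by (auto intro: holo_subset)
  then show ?thesis
    unfolding real_analytic_at_def using F V cderiv_real_direction[OF F(1) _ F(3) V(3)]
    by (intro exI[of _ "\<lambda>p. cderiv F p (u, 0)"] exI[of _ "U \<inter> fst -` V"]) auto
qed

text \<open>
  Extensions for different values of \<open>t\<close> may have different domains. On a short interval around \<open>t0\<close> one
  extension serves all parameters, and it can be integrated.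
\<close>

lemma real_analytic_at_integral_local:
  fixes f :: "'a::euclidean_space \<times> real \<Rightarrow> 'b::euclidean_space"
  assumes "real_analytic_at f (x0, t0)"
  shows "\<exists>d>0. \<exists>A. open A \<and> x0 \<in> A \<and> (\<forall>a b. a \<le> t0 \<and> t0 \<le> b \<and> b - a < d \<longrightarrow>
     real_analytic_at (\<lambda>x. integral {a..b} (\<lambda>t. f (x, t))) x0 \<and> (\<forall>x\<in>A. (\<lambda>t. f (x, t)) integrable_on {a..b}))"
proof -
  obtain F U where F: "holo F U" "((x0, t0), 0) \<in> U" "\<And>y. (y, 0) \<in> U \<Longrightarrow> F (y, 0) = (f y, 0)"
    using assms by (auto simp: real_analytic_at_def)
  define j where "j p t = ((fst p, t), (snd p, 0 :: real))" for p :: "'a \<times> 'a" and t :: real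
  have "open ((\<lambda>x. j (fst x) (snd x)) -` U)"
    unfolding j_def using F(1) by (intro open_vimage continuous_intros) (auto simp: holo_def)
  moreover have "((x0, 0), t0) \<in> (\<lambda>x. j (fst x) (snd x)) -` U"
    using F(2) by (simp add: j_def zero_prod_def)
  ultimately obtain A B where AB': "open A" "open B" "((x0, 0), t0) \<in> A \<times> B" "A \<times> B \<subseteq> (\<lambda>x. j (fst x) (snd x)) -` U"
    by (rule open_prod_elim)
  then have AB: "open A" "open B" "(x0, 0) \<in> A" "t0 \<in> B" "A \<times> B \<subseteq> (\<lambda>x. j (fst x) (snd x)) -` U"
    by auto
  obtain d where d: "d > 0" "ball t0 d \<subseteq> B" using AB by (meson openE)
  let ?E = "Blinfun (\<lambda>p :: 'a \<times> 'a. ((fst p, 0::real), (snd p, 0::real)))"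
  have "bounded_linear (\<lambda>p :: 'a \<times> 'a. ((fst p, 0::real), (snd p, 0::real)))"
    by (intro bounded_linear_Pair bounded_linear_fst bounded_linear_snd bounded_linear_zero)
  then have E: "blinfun_apply ?E p = ((fst p, 0), (snd p, 0))" for p
    by (simp add: bounded_linear_Blinfun_apply)
  have main: "real_analytic_at (\<lambda>x. integral {a..b} (\<lambda>t. f (x, t))) x0 \<and> (\<forall>x\<in>(\<lambda>x. (x, 0)) -` A. (\<lambda>t. f (x, t)) integrable_on {a..b})"
    if ab: "a \<le> t0" "t0 \<le> b" "b - a < d" for a b
  proof -
    have jU: "j p t \<in> U" if "p \<in> A" "t \<in> {a..b}" for p t
    proof -
      have "t \<in> ball t0 d" using that ab by (auto simp: dist_real_def)
      then have "(p, t) \<in> A \<times> B" using that d by blast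
      then show ?thesis using AB(5) by force
    qed
    have Hint: "(\<lambda>t. F (j p t)) integrable_on {a..b}" if "p \<in> A" for p
      by (intro integrable_continuous_real continuous_on_compose2[OF holo_imp_continuous_on[OF F(1)]])
        (use that jU in \<open>auto simp: j_def intro!: continuous_intros\<close>)
    have "holo (\<lambda>p. integral {a..b} (\<lambda>t. F (j p t))) A"
    proof (rule holo_integral[where H' = "\<lambda>p t. cderiv F (j p t) o\<^sub>L ?E"])
      fix p t assume pt: "p \<in> A" "t \<in> {a..b}"
      have "((\<lambda>p. j p t) has_derivative (\<lambda>p. ((fst p, 0), (snd p, 0)))) (at p)"
        unfolding j_def by (intro has_derivative_Pair has_derivative_fst has_derivative_snd has_derivative_ident has_derivative_const)
      from has_derivative_compose[OF this cderiv(1)[OF holo_cdiff[OF F(1) jU[OF pt]]]]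
      show "((\<lambda>p. F (j p t)) has_derivative blinfun_apply (cderiv F (j p t) o\<^sub>L ?E)) (at p)"
        by (rule has_derivative_eq_rhs) (simp add: fun_eq_iff E)
      have "?E (cscale \<i> q) = cscale \<i> (?E q)" for q by (simp add: E cscale_def)
      then show "(cderiv F (j p t) o\<^sub>L ?E) (cscale \<i> q) = cscale \<i> ((cderiv F (j p t) o\<^sub>L ?E) q)" for q
        using cderiv(2)[OF holo_cdiff[OF F(1) jU[OF pt]]] by simp
    next
      show "continuous_on (A \<times> {a..b}) (\<lambda>(p, t). cderiv F (j p t) o\<^sub>L ?E)"
        unfolding split_beta
        by (intro continuous_intros continuous_on_compose2[OF holo_imp_continuous_cderiv[OF F(1)]])
          (use jU in \<open>auto simp: j_def intro!: continuous_intros\<close>)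
    qed (use AB Hint in auto)
    moreover have real: "F (j (y, 0) t) = (f (y, t), 0)" if "(y, 0) \<in> A" "t \<in> {a..b}" for y t
      using F(3)[of "(y, t)"] jU[OF that] by (simp add: j_def zero_prod_def)
    moreover have igf: "(\<lambda>t. f (y, t)) integrable_on {a..b}" if y: "(y, 0) \<in> A" for y
    proof -
      have "(\<lambda>t. fst (F (j (y, 0) t))) integrable_on {a..b}"
        using integrable_linear[OF Hint[OF y] bounded_linear_fst] by (simp add: o_def)
      then show ?thesis by (rule integrable_eq) (simp add: real[OF y])
    qed
    moreover have "integral {a..b} (\<lambda>t. F (j (y, 0) t)) = (integral {a..b} (\<lambda>t. f (y, t)), 0)" if y: "(y, 0) \<in> A" for y
    proof -
      have "((\<lambda>t. (f (y, t), 0::'b)) has_integral (integral {a..b} (\<lambda>t. f (y, t)), 0)) {a..b}"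
        using has_integral_linear[OF integrable_integral[OF igf[OF y]], of "\<lambda>v. (v, 0)"]
        by (simp add: o_def bounded_linear_Pair bounded_linear_ident bounded_linear_zero)
      then have "integral {a..b} (\<lambda>t. (f (y, t), 0::'b)) = (integral {a..b} (\<lambda>t. f (y, t)), 0)"
        by (rule integral_unique)
      then show ?thesis using integral_cong[of "{a..b}" "\<lambda>t. F (j (y, 0) t)" "\<lambda>t. (f (y, t), 0)"] real[OF y] by simp
    qed
    ultimately show ?thesis
      using AB unfolding real_analytic_at_def by auto
  qed
  have "open ((\<lambda>x. (x, 0)) -` A)"
    using AB by (intro open_vimage continuous_intros)
  then show ?thesis
    using d AB main by (intro exI[of _ d] conjI exI[of _ "(\<lambda>x. (x, 0)) -` A"]) auto
qed

text \<open>
  Bisection reduces the interval to short ones, so that integrals are added up and no extensions have to be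
  glued.
\<close>

theorem real_analytic_at_integral:
  fixes f :: "'a::euclidean_space \<times> real \<Rightarrow> 'b::euclidean_space"
  assumes "a \<le> b" "\<And>t. t \<in> {a..b} \<Longrightarrow> real_analytic_at f (x0, t)"
  shows "real_analytic_at (\<lambda>x. integral {a..b} (\<lambda>t. f (x, t))) x0"
proof -
  define P where "P a b \<longleftrightarrow> real_analytic_at (\<lambda>x. integral {a..b} (\<lambda>t. f (x, t))) x0 \<and>
     (\<exists>A. open A \<and> x0 \<in> A \<and> (\<forall>x\<in>A. (\<lambda>t. f (x, t)) integrable_on {a..b}))" for a b
  have "P a b"
    using assms(1)
  proof (induction rule: Bolzano)
    case (trans a b c)
    obtain A B where AB: "open A" "x0 \<in> A" "\<And>x. x\<in>A \<Longrightarrow> (\<lambda>t. f (x, t)) integrable_on {a..b}"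
      "open B" "x0 \<in> B" "\<And>x. x\<in>B \<Longrightarrow> (\<lambda>t. f (x, t)) integrable_on {b..c}"
      using trans(1,2) unfolding P_def by blast
    have ig: "(\<lambda>t. f (x, t)) integrable_on {a..c}" if "x \<in> A \<inter> B" for x
      using that AB trans by (intro Henstock_Kurzweil_Integration.integrable_combine[OF trans(3,4)]) auto
    have eq: "integral {a..b} (\<lambda>t. f (x, t)) + integral {b..c} (\<lambda>t. f (x, t)) = integral {a..c} (\<lambda>t. f (x, t))"
      if "x \<in> A \<inter> B" for x
      by (rule Henstock_Kurzweil_Integration.integral_combine[OF trans(3,4) ig[OF that]])
    have "real_analytic_at (\<lambda>x. integral {a..b} (\<lambda>t. f (x, t)) + integral {b..c} (\<lambda>t. f (x, t))) x0"
      using trans(1,2) unfolding P_def by (intro real_analytic_at_add) auto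
    then have "real_analytic_at (\<lambda>x. integral {a..c} (\<lambda>t. f (x, t))) x0"
      by (rule real_analytic_at_cong[where V = "A \<inter> B"]) (use AB eq in auto)
    then show ?case
      unfolding P_def using AB ig by (intro conjI exI[of _ "A \<inter> B"]) auto
  next
    case (local t)
    then have "real_analytic_at f (x0, t)" using assms(2) by auto
    from real_analytic_at_integral_local[OF this] show ?case
      unfolding P_def by blast
  qed
  then show ?thesis by (simp add: P_def)
qed

text \<open>
  The derivative of the extension of \<open>f\<close> at the real point \<open>s x0\<close> is \<open>D\<close> on real and on imaginary parts, hence
  invertible, and the extension has a local inverse \<open>h\<close> with complex linear derivatives. Continuity of \<open>s\<close> keeps
  \<open>s x\<close> in the range of \<open>h\<close>, so \<open>s x = h (k x)\<close>; in particular this composition is real at real points.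
\<close>

theorem real_analytic_at_lift:
  fixes f :: "'e::euclidean_space \<Rightarrow> 'e" and k s :: "'a::euclidean_space \<Rightarrow> 'e"
  assumes f: "real_analytic_at f (s x0)" and k: "real_analytic_at k x0"
    and D: "(f has_derivative D) (at (s x0))" "\<And>v. D v = 0 \<Longrightarrow> v = 0"
    and s: "isCont s x0" and V: "open V" "x0 \<in> V" "\<And>x. x \<in> V \<Longrightarrow> f (s x) = k x"
  shows "real_analytic_at s x0"
proof -
  obtain F U where F: "holo F U" "(s x0, 0) \<in> U" "\<And>y. (y, 0) \<in> U \<Longrightarrow> F (y, 0) = (f y, 0)"
    using f by (auto simp: real_analytic_at_def)
  obtain K W where K: "holo K W" "(x0, 0) \<in> W" "\<And>y. (y, 0) \<in> W \<Longrightarrow> K (y, 0) = (k y, 0)"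
    using k by (auto simp: real_analytic_at_def)
  let ?p = "(s x0, 0)"
  have "cderiv F ?p (h, l) = (D h, D l)" for h l
  proof -
    have hl: "(h, l) = (h, 0) + cscale \<i> (l, 0)" by (simp add: cscale_i)
    have "cderiv F ?p (h, l) = cderiv F ?p (h, 0) + cscale \<i> (cderiv F ?p (l, 0))"
      unfolding hl blinfun.add_right cderiv(2)[OF holo_cdiff[OF F(1,2)]] ..
    then show ?thesis by (simp add: cderiv_real_direction[OF F D(1)] cscale_i)
  qed
  then have "inj (cderiv F ?p)"
    using D(2) by (subst linear_injective_0) (auto simp: blinfun.bounded_linear_right bounded_linear.linear zero_prod_def)
  then obtain g where g: "linear g" "g \<circ> cderiv F ?p = id"
    using linear_injective_left_inverse[OF bounded_linear.linear[OF blinfun.bounded_linear_right]] by blast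
  have "Blinfun g o\<^sub>L cderiv F ?p = id_blinfun"
    using g(1) fun_cong[OF g(2)]
    by (intro blinfun_eqI) (simp add: bounded_linear_Blinfun_apply linear_conv_bounded_linear[symmetric])
  then obtain U' V' h h' where inv: "open U'" "U' \<subseteq> U" "?p \<in> U'" "open V'" "F ?p \<in> V'" "homeomorphism U' V' F h"
    and h': "\<And>y. y \<in> V' \<Longrightarrow> (h has_derivative h' y) (at y)"
      "\<And>y. y \<in> V' \<Longrightarrow> h' y = inv (cderiv F (h y))" "\<And>y. y \<in> V' \<Longrightarrow> bij (cderiv F (h y))"
    using inverse_function_theorem[of U F "cderiv F" ?p "Blinfun g"] F cderiv(1)[OF holo_cdiff[OF F(1)]]
      holo_imp_continuous_cderiv[OF F(1)] unfolding holo_def by metis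
  have hol: "holo h V'"
    unfolding holo_def
  proof (intro conjI ballI inv)
    fix y assume y: "y \<in> V'"
    then have "h y \<in> U" using inv by (auto simp: homeomorphism_def)
    note c = cderiv(2)[OF holo_cdiff[OF F(1) this]]
    have "h' y (cscale \<i> q) = cscale \<i> (h' y q)" for q
    proof -
      have "cderiv F (h y) (cscale \<i> (h' y q)) = cscale \<i> q"
        unfolding c h'(2)[OF y] using h'(3)[OF y] by (simp add: bij_is_surj surj_f_inv_f)
      then show ?thesis
        unfolding h'(2)[OF y] using h'(3)[OF y] by (metis bij_inv_eq_iff)
    qed
    then show "cdiff h y" using cdiffI[OF h'(1)[OF y]] by blast
  qed
  have "open ((\<lambda>y. (y, 0)) -` U')" "s x0 \<in> (\<lambda>y. (y, 0)) -` U'"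
    using inv by (auto intro!: open_vimage continuous_intros)
  then obtain T where T: "open T" "x0 \<in> T" "\<And>x. x \<in> T \<Longrightarrow> (s x, 0) \<in> U'"
    using s unfolding continuous_at_open by (metis vimageE)
  let ?S = "(W \<inter> K -` V') \<inter> fst -` (T \<inter> V)"
  have "open ?S"
    using K(1) inv T V
    by (intro open_Int continuous_open_preimage[OF holo_imp_continuous_on[OF K(1)]] open_vimage continuous_intros) (auto simp: holo_def)
  moreover have "cdiff (\<lambda>p. h (K p)) p" if "p \<in> ?S" for p
    using that by (intro cdiff_compose[of K p h] holo_cdiff[OF K(1)] holo_cdiff[OF hol]) auto
  ultimately have "holo (\<lambda>p. h (K p)) ?S" by (simp add: holo_def)
  moreover have "h (k y, 0) = (s y, 0)" if "y \<in> T" "y \<in> V" for y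
  proof -
    have "F (s y, 0) = (k y, 0)" using F(3) T(3)[OF that(1)] V(3)[OF that(2)] inv by auto
    then show ?thesis using inv(6) T(3)[OF that(1)] by (metis homeomorphism_apply1)
  qed
  moreover have "(x0, 0) \<in> ?S"
    using K T V inv F by auto
  ultimately show ?thesis
    unfolding real_analytic_at_def using K(3)
    by (intro exI[of _ "\<lambda>p. h (K p)"] exI[of _ ?S]) auto
qed

text \<open>
  The solution \<open>x \<mapsto> (x, s x)\<close> is the lift of \<open>x \<mapsto> (x, 0)\<close> along \<open>(x, y) \<mapsto> (x, G (x, y))\<close>.
\<close>

theorem real_analytic_at_implicit:
  fixes G :: "'a::euclidean_space \<times> 'b::euclidean_space \<Rightarrow> 'b" and s :: "'a \<Rightarrow> 'b"
  assumes G: "real_analytic_at G (x0, s x0)"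
    and D: "(G has_derivative D) (at (x0, s x0))" "\<And>v. D (0, v) = 0 \<Longrightarrow> v = 0"
    and s: "isCont s x0" and V: "open V" "x0 \<in> V" "\<And>x. x \<in> V \<Longrightarrow> G (x, s x) = 0"
  shows "real_analytic_at s x0"
proof -
  have "real_analytic_at (\<lambda>x. (x, s x)) x0"
  proof (rule real_analytic_at_lift)
    show "real_analytic_at (\<lambda>p. (fst p, G p)) (x0, s x0)"
      by (intro real_analytic_at_Pair G real_analytic_at_linear bounded_linear_fst)
    show "real_analytic_at (\<lambda>x. (x, 0)) x0"
      by (intro real_analytic_at_Pair real_analytic_at_ident real_analytic_at_const)
    show "((\<lambda>p. (fst p, G p)) has_derivative (\<lambda>h. (fst h, D h))) (at (x0, s x0))"
      by (intro has_derivative_Pair D has_derivative_fst has_derivative_ident)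
    show "v = 0" if "(fst v, D v) = 0" for v
      using that D(2)[of "snd v"] by (cases v) (auto simp: zero_prod_def)
    show "isCont (\<lambda>x. (x, s x)) x0" using s by (intro continuous_intros)
  qed (use V in auto)
  from real_analytic_at_linear_compose[OF bounded_linear_snd this] show ?thesis by simp
qed

section \<open>Matrix algebra\<close>

lemma bounded_bilinear_matrix_mult:
  "bounded_bilinear ((**) :: real^'n^'m \<Rightarrow> real^'k^'n \<Rightarrow> real^'k^'m)"
proof -
  have "bilinear ((**) :: real^'n^'m \<Rightarrow> real^'k^'n \<Rightarrow> real^'k^'m)"
    unfolding bilinear_def
    by (auto intro!: linearI simp: vec_eq_iff matrix_matrix_mult_def sum.distrib sum_distrib_left algebra_simps)
  then show ?thesis by (simp add: bilinear_conv_bounded_bilinear)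
qed

lemmas mm_left_diff = bounded_bilinear.diff_left[OF bounded_bilinear_matrix_mult]
lemmas mm_right_diff = bounded_bilinear.diff_right[OF bounded_bilinear_matrix_mult]
lemmas mm_left_add = bounded_bilinear.add_left[OF bounded_bilinear_matrix_mult]
lemmas mm_right_add = bounded_bilinear.add_right[OF bounded_bilinear_matrix_mult]
lemmas mm_left_scaleR = bounded_bilinear.scaleR_left[OF bounded_bilinear_matrix_mult]
lemmas mm_right_scaleR = bounded_bilinear.scaleR_right[OF bounded_bilinear_matrix_mult]
lemmas mm_left_zero = bounded_bilinear.zero_left[OF bounded_bilinear_matrix_mult]
lemmas mm_right_zero = bounded_bilinear.zero_right[OF bounded_bilinear_matrix_mult]
lemmas mm_bilinear = mm_left_diff mm_right_diff mm_left_add mm_right_add mm_left_scaleR mm_right_scaleR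
  mm_left_zero mm_right_zero

lemma linear_transpose: "linear (transpose :: real^'n^'m \<Rightarrow> _)"
  by (rule linearI) (auto simp: transpose_def vec_eq_iff)

lemma bounded_linear_transpose: "bounded_linear (transpose :: real^'n^'m \<Rightarrow> _)"
  using linear_transpose by (simp add: linear_conv_bounded_linear)

lemma linear_trace: "linear (trace :: real^'n^'n \<Rightarrow> _)"
  by (rule linearI) (auto simp: trace_def sum.distrib sum_distrib_left)

lemma bounded_linear_trace: "bounded_linear (trace :: real^'n^'n \<Rightarrow> _)"
  using linear_trace by (simp add: linear_conv_bounded_linear)

lemma matrix_cancel: "A ** B = mat 1 \<Longrightarrow> A ** (B ** X) = X" for A :: "real^'n^'m"
  by (simp add: matrix_mul_assoc)

lemma trace_mult_commute: "trace (A ** B) = trace (B ** A)" for A :: "real^'n^'m" and B :: "real^'m^'n"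
proof -
  have "trace (A ** B) = (\<Sum>i\<in>UNIV. \<Sum>k\<in>UNIV. A$i$k * B$k$i)"
    by (simp add: trace_def matrix_matrix_mult_def)
  also have "\<dots> = (\<Sum>k\<in>UNIV. \<Sum>i\<in>UNIV. B$k$i * A$i$k)"
    by (subst sum.swap) (simp add: mult.commute)
  finally show ?thesis by (simp add: trace_def matrix_matrix_mult_def)
qed

lemma inner_matrix: "X \<bullet> Y = trace (transpose X ** Y)" for X Y :: "real^'n^'m"
proof -
  have "X \<bullet> Y = (\<Sum>i\<in>UNIV. \<Sum>j\<in>UNIV. X$i$j * Y$i$j)" by (simp add: inner_vec_def)
  also have "\<dots> = (\<Sum>j\<in>UNIV. \<Sum>i\<in>UNIV. X$i$j * Y$i$j)" by (rule sum.swap)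
  finally show ?thesis by (simp add: trace_def matrix_matrix_mult_def transpose_def)
qed

lemma norm_matrix_squared: "(norm X)\<^sup>2 = (\<Sum>i\<in>UNIV. \<Sum>j\<in>UNIV. (X$i$j)\<^sup>2)" for X :: "real^'n^'m"
  unfolding power2_norm_eq_inner inner_vec_def by (simp add: power2_eq_square)

lemma norm_transpose: "norm (transpose X) = norm X" for X :: "real^'n^'m"
proof -
  have "(norm (transpose X))\<^sup>2 = (norm X)\<^sup>2"
    unfolding norm_matrix_squared transpose_def by simp (rule sum.swap)
  then show ?thesis by simp
qed

lemma diag_mat_mult_right: "(X ** diag_mat a) $ i $ j = X $ i $ j * a j" for X :: "real^'n^'m"
  by (simp add: matrix_matrix_mult_def diag_mat_def if_distrib[of "\<lambda>x. _ * x"] cong: if_cong)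

lemma diag_mat_mult_left: "(diag_mat a ** X) $ i $ j = a i * X $ i $ j" for X :: "real^'n^'m"
  by (simp add: matrix_matrix_mult_def diag_mat_def if_distrib[of "\<lambda>x. x * _"] cong: if_cong)

lemma diag_mat_mult: "diag_mat a ** diag_mat b = diag_mat (\<lambda>i. a i * b i)"
  by (simp add: vec_eq_iff diag_mat_mult_left) (simp add: diag_mat_def)

lemma diag_mat_one: "diag_mat (\<lambda>_. 1) = mat 1"
  by (simp add: diag_mat_def mat_def)

lemma transpose_diag_mat: "transpose (diag_mat a) = diag_mat a"
  by (simp add: diag_mat_def transpose_def vec_eq_iff)

lemma trace_diag_mat: "trace (diag_mat a) = (\<Sum>i\<in>UNIV. a i)"
  by (simp add: trace_def diag_mat_def)

lemma norm_diag_mat: "(norm (diag_mat a))\<^sup>2 = (\<Sum>i\<in>UNIV. (a i)\<^sup>2)"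
  by (simp add: norm_matrix_squared diag_mat_def if_distrib[of "\<lambda>x. x^2"] cong: if_cong)

lemma diag_mat_add: "diag_mat a + diag_mat b = diag_mat (\<lambda>i. a i + b i)"
  and diag_mat_diff: "diag_mat a - diag_mat b = diag_mat (\<lambda>i. a i - b i)"
  and diag_mat_scaleR: "c *\<^sub>R diag_mat a = diag_mat (\<lambda>i. c * a i)"
  by (simp_all add: vec_eq_iff diag_mat_def)

text \<open>Orthogonal matrices whose row and column index types may differ.\<close>

definition orth :: "real^'k^'d \<Rightarrow> bool" where
  "orth W \<longleftrightarrow> transpose W ** W = mat 1 \<and> W ** transpose W = mat 1"

lemma orth_square: "orth W \<longleftrightarrow> orthogonal_matrix W" for W :: "real^'k^'k"
  by (auto simp: orth_def orthogonal_matrix_def)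

lemma orth_mult: "orth V \<Longrightarrow> orth W \<Longrightarrow> orth (V ** W)" for V :: "real^'k^'d" and W :: "real^'l^'k"
  by (simp add: orth_def matrix_transpose_mul matrix_mul_assoc[symmetric] matrix_cancel)

lemma orth_transpose: "orth W \<Longrightarrow> orth (transpose W)"
  by (simp add: orth_def)

lemma norm_orth_mult:
  fixes W :: "real^'k^'d" and X :: "real^'l^'k"
  assumes "orth W"
  shows "norm (W ** X) = norm X" "norm (Y ** transpose W) = norm Y"
proof -
  have *: "norm (W ** X) = norm X" for X :: "real^'l^'k"
    using assms by (simp add: norm_eq_sqrt_inner inner_matrix matrix_transpose_mul matrix_mul_assoc[symmetric] matrix_cancel orth_def)
  show "norm (W ** X) = norm X" by (rule *)
  have "norm (transpose (W ** transpose Y)) = norm (transpose (transpose Y))"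
    unfolding norm_transpose[of "W ** _"] norm_transpose[of "transpose Y"]
    using assms by (simp add: norm_eq_sqrt_inner inner_matrix matrix_transpose_mul matrix_mul_assoc[symmetric] matrix_cancel orth_def)
  then show "norm (Y ** transpose W) = norm Y" by (simp add: matrix_transpose_mul)
qed

lemma norm_orth_conj:
  fixes W :: "real^'k^'d"
  assumes "orth W" shows "norm (W ** X ** transpose W) = norm X"
  using norm_orth_mult[OF assms] by metis

lemma matrix_inv_eqI:
  fixes A :: "real^'n^'m"
  assumes "A ** B = mat 1" "B ** A = mat 1"
  shows "matrix_inv A = B"
proof -
  have "A ** matrix_inv A = mat 1 \<and> matrix_inv A ** A = mat 1"
    unfolding matrix_inv_def using assms by (rule_tac someI[of _ B]) auto
  then show ?thesis using assms by (metis matrix_mul_assoc matrix_mul_lid matrix_mul_rid)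
qed

lemma matrix_inv_left: "invertible A \<Longrightarrow> matrix_inv A ** A = mat 1"
  and matrix_inv_right: "invertible A \<Longrightarrow> A ** matrix_inv A = mat 1" for A :: "real^'n^'m"
  unfolding invertible_def by (auto simp: matrix_inv_eqI)

lemma invertibleI: "A ** B = mat 1 \<Longrightarrow> B ** A = mat 1 \<Longrightarrow> invertible A" for A :: "real^'n^'m"
  by (auto simp: invertible_def)

lemma invertible_mult_rect: "invertible A \<Longrightarrow> invertible B \<Longrightarrow> invertible (A ** B)"
  for A :: "real^'n^'m" and B :: "real^'k^'n"
  by (rule invertibleI[where B = "matrix_inv B ** matrix_inv A"])
    (simp_all add: matrix_mul_assoc[symmetric] matrix_cancel matrix_inv_left matrix_inv_right)

lemma matrix_inv_mult: "invertible A \<Longrightarrow> invertible B \<Longrightarrow> matrix_inv (A ** B) = matrix_inv B ** matrix_inv A"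
  for A :: "real^'n^'m" and B :: "real^'k^'n"
  by (rule matrix_inv_eqI)
    (simp_all add: matrix_mul_assoc[symmetric] matrix_cancel matrix_inv_left matrix_inv_right)

lemma transpose_matrix_inv: "invertible A \<Longrightarrow> matrix_inv (transpose A) = transpose (matrix_inv A)"
  for A :: "real^'n^'m"
  by (rule matrix_inv_eqI) (simp_all add: matrix_transpose_mul[symmetric] matrix_inv_left matrix_inv_right)

lemma invertible_transpose: "invertible A \<Longrightarrow> invertible (transpose A)" for A :: "real^'n^'m"
  unfolding invertible_def by (metis matrix_transpose_mul transpose_mat)

lemma invertible_matrix_inv: "invertible A \<Longrightarrow> invertible (matrix_inv A)" for A :: "real^'n^'m"
  by (rule invertibleI[of _ A]) (simp_all add: matrix_inv_left matrix_inv_right)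

lemma orth_invertible: "orth W \<Longrightarrow> invertible W"
  by (auto simp: orth_def invertible_def)

lemma invertible_diag_mat: "(\<And>i. a i \<noteq> 0) \<Longrightarrow> invertible (diag_mat a)"
  by (rule invertibleI[of _ "diag_mat (\<lambda>i. 1 / a i)"]) (simp_all add: diag_mat_mult diag_mat_one)

section \<open>The spectral theorem\<close>

text \<open>
  A maximizer \<open>x\<close> of the quadratic form on the unit sphere of \<open>S\<close>: the first variation shows that \<open>f x\<close> is
  orthogonal to every vector of \<open>S\<close> orthogonal to \<open>x\<close>.
\<close>

lemma self_adjoint_eigenvector:
  fixes f :: "'a::euclidean_space \<Rightarrow> 'a"
  assumes f: "linear f" "\<And>x y. f x \<bullet> y = x \<bullet> f y" and S: "subspace S" "\<And>x. x \<in> S \<Longrightarrow> f x \<in> S" "S \<noteq> {0}"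
  obtains x c where "x \<in> S" "norm x = 1" "f x = c *\<^sub>R x"
proof -
  have "compact (S \<inter> sphere 0 1)" using closed_subspace[OF S(1)] by (simp add: closed_Int_compact)
  moreover obtain y where y: "y \<in> S" "y \<noteq> 0" using S subspace_0 by blast
  then have "y /\<^sub>R norm y \<in> S \<inter> sphere 0 1" using S(1) by (simp add: subspace_scale)
  then have "S \<inter> sphere 0 1 \<noteq> {}" by blast
  moreover have "continuous_on (S \<inter> sphere 0 1) (\<lambda>x. x \<bullet> f x)"
    using f(1) by (intro continuous_intros linear_continuous_on) (simp add: linear_conv_bounded_linear)
  ultimately obtain x where "x \<in> S \<inter> sphere 0 1" and m: "\<forall>y\<in>S \<inter> sphere 0 1. y \<bullet> f y \<le> x \<bullet> f x"
    using continuous_attains_sup[of "S \<inter> sphere 0 1" "\<lambda>x. x \<bullet> f x"] by blast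
  then have x: "x \<in> S" "norm x = 1" by auto
  have max: "y \<bullet> f y \<le> x \<bullet> f x" if "y \<in> S" "norm y = 1" for y
    using m that by simp
  define c where "c = x \<bullet> f x"
  have le: "y \<bullet> f y \<le> c * (y \<bullet> y)" if "y \<in> S" for y
  proof (cases "y = 0")
    case False
    have "(y /\<^sub>R norm y) \<bullet> f (y /\<^sub>R norm y) \<le> c"
      unfolding c_def using that False S(1) by (intro max) (auto simp: subspace_scale)
    then show ?thesis
      using False by (simp add: linear_scale[OF f(1)] divide_simps power2_norm_eq_inner[symmetric] power2_eq_square mult_ac)
  qed (simp add: linear_0[OF f(1)])
  have orth: "y \<bullet> f x = 0" if y: "y \<in> S" "y \<bullet> x = 0" for y
  proof -
    define b where "b = y \<bullet> f x"
    define k where "k = c * (y \<bullet> y) - y \<bullet> f y"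
    have ineq: "2 * t * b \<le> t\<^sup>2 * k" for t
    proof -
      have "(x + t *\<^sub>R y) \<bullet> f (x + t *\<^sub>R y) \<le> c * ((x + t *\<^sub>R y) \<bullet> (x + t *\<^sub>R y))"
        using x y S(1) by (intro le) (simp add: subspace_add subspace_scale)
      moreover have "x \<bullet> f y = b" unfolding b_def by (metis f(2) inner_commute)
      moreover have "x \<bullet> x = 1" "x \<bullet> y = 0" using x y by (simp_all add: norm_eq_1 inner_commute)
      ultimately show ?thesis using y
        by (simp add: linear_add[OF f(1)] linear_scale[OF f(1)] inner_add_left inner_add_right b_def[symmetric] c_def[symmetric] k_def power2_eq_square algebra_simps)
    qed
    have "b = 0"
    proof (rule ccontr)
      assume b: "b \<noteq> 0"
      have "k > 0"
      proof (rule ccontr)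
        assume "\<not> k > 0"
        then have "b\<^sup>2 * k \<le> 0" by (simp add: mult_nonneg_nonpos)
        with ineq[of b] b show False by (simp add: power2_eq_square) (smt (verit) mult_pos_pos zero_less_mult_iff not_real_square_gt_zero)
      qed
      with ineq[of "b / k"] have "2 * (b\<^sup>2 / k) \<le> b\<^sup>2 / k" by (simp add: power2_eq_square field_simps)
      moreover have "b\<^sup>2 / k > 0" using b \<open>k > 0\<close> by simp
      ultimately show False by linarith
    qed
    then show ?thesis by (simp add: b_def)
  qed
  define y where "y = f x - c *\<^sub>R x"
  have "y \<in> S" using x S by (simp add: y_def subspace_diff subspace_scale)
  moreover have "x \<bullet> y = 0" using x by (simp add: y_def inner_diff_right c_def norm_eq_1)
  then have "y \<bullet> x = 0" by (simp add: inner_commute)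
  moreover have "y \<bullet> y = y \<bullet> f x - c * (y \<bullet> x)" by (subst (2) y_def) (simp add: inner_diff_right)
  ultimately have "y \<bullet> y = 0" using orth[of y] by simp
  then show thesis using x by (intro that[of x c]) (auto simp: y_def)
qed

text \<open>
  An orthonormal set of eigenvectors of maximal size spans the space: its orthogonal complement is invariant
  and would otherwise contain one more eigenvector.
\<close>

theorem spectral_theorem:
  fixes P :: "real^'k^'k"
  assumes sym: "transpose P = P"
  shows "\<exists>W l. orthogonal_matrix W \<and> P = W ** diag_mat l ** transpose W"
proof -
  let ?f = "\<lambda>x. P *v x"
  have f: "linear ?f" "\<And>x y. ?f x \<bullet> y = x \<bullet> ?f y"
  proof -
    show "?f x \<bullet> y = x \<bullet> ?f y" for x y
      using dot_lmul_matrix[of x P y] sym by (metis transpose_matrix_vector)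
  qed simp
  define Q where "Q B \<longleftrightarrow> pairwise orthogonal B \<and> (\<forall>x\<in>B. norm x = 1 \<and> (\<exists>c. P *v x = c *\<^sub>R x))" for B
  have ind: "independent B" if "Q B" for B
    using that by (intro pairwise_orthogonal_independent) (auto simp: Q_def)
  have "Q {}" by (simp add: Q_def)
  then have "\<exists>B. Q B \<and> (\<forall>B'. Q B' \<longrightarrow> card B' \<le> card B)"
    using independent_bound[OF ind] by (intro ex_has_greatest_nat[of Q "{}" card "Suc DIM(real^'k)"]) (auto simp: less_Suc_eq_le)
  then obtain B where B: "Q B" "\<And>B'. Q B' \<Longrightarrow> card B' \<le> card B" by blast
  have fin: "finite B" using independent_bound[OF ind[OF B(1)]] by simp
  have "span B = UNIV"
  proof (rule ccontr)
    assume "span B \<noteq> UNIV"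
    then obtain a where a: "a \<noteq> 0" "\<forall>x\<in>span B. a \<bullet> x = 0" using span_not_UNIV_orthogonal by blast
    define S where "S = {y. \<forall>b\<in>B. b \<bullet> y = 0}"
    have "subspace S" by (auto simp: S_def subspace_def inner_add_right)
    moreover have "P *v y \<in> S" if "y \<in> S" for y
    proof -
      have "b \<bullet> (P *v y) = 0" if b: "b \<in> B" for b
      proof -
        obtain c where "P *v b = c *\<^sub>R b" using B(1) b by (auto simp: Q_def)
        then show ?thesis using f(2)[of b y] b \<open>y \<in> S\<close> by (simp add: S_def)
      qed
      then show ?thesis by (simp add: S_def)
    qed
    moreover have "a \<in> S" using a by (auto simp: S_def inner_commute span_base)
    then have "S \<noteq> {0}" using a by auto
    ultimately obtain x c where x: "x \<in> S" "norm x = 1" "P *v x = c *\<^sub>R x"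
      using self_adjoint_eigenvector[OF f, of S] by blast
    have "x \<notin> B" using x by (auto simp: S_def)
    moreover have "Q (insert x B)"
      using B(1) x by (auto simp: Q_def pairwise_insert S_def orthogonal_def inner_commute)
    ultimately show False using B(2)[of "insert x B"] fin by simp
  qed
  then have "card B = CARD('k)"
    using dim_eq_card_independent[OF ind[OF B(1)]] dim_span[of B] by simp
  then obtain w where w: "bij_betw w (UNIV :: 'k set) B"
    using fin finite_same_card_bij[of "UNIV :: 'k set" B] by auto
  define W :: "real^'k^'k" where "W = (\<chi> i j. w j $ i)"
  have wB: "w j \<in> B" for j using w by (auto simp: bij_betw_def)
  then have "\<forall>j. \<exists>c. P *v w j = c *\<^sub>R w j" using B(1) unfolding Q_def by blast
  from choice[OF this] obtain l where l: "\<And>j. P *v w j = l j *\<^sub>R w j" by blast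
  have on: "w i \<bullet> w j = (if i = j then 1 else 0)" for i j
  proof (cases "i = j")
    case True then show ?thesis using wB[of i] B(1) by (auto simp: Q_def norm_eq_1)
  next
    case False
    then have "w i \<noteq> w j" using w by (auto simp: bij_betw_def inj_on_def)
    then show ?thesis using wB B(1) False by (auto simp: Q_def pairwise_def orthogonal_def)
  qed
  have "transpose W ** W = mat 1"
    using on by (simp add: vec_eq_iff matrix_matrix_mult_def W_def transpose_def mat_def inner_vec_def)
  then have W: "orthogonal_matrix W" by (simp add: orthogonal_matrix)
  have "P ** W = W ** diag_mat l"
  proof -
    have "(P ** W) $ i $ j = (P *v w j) $ i" for i j
      by (simp add: matrix_matrix_mult_def matrix_vector_mult_def W_def)
    then show ?thesis unfolding vec_eq_iff diag_mat_mult_right l by (simp add: W_def)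
  qed
  then have "P ** W ** transpose W = W ** diag_mat l ** transpose W" by simp
  then have "P = W ** diag_mat l ** transpose W"
    using W by (simp add: matrix_mul_assoc[symmetric] orthogonal_matrix_def)
  with W show ?thesis by blast
qed

text \<open>
  The matrix \<open>K = V\<^sup>T W\<close> satisfies \<open>K\<^sub>i\<^sub>j a\<^sub>j = b\<^sub>i K\<^sub>i\<^sub>j\<close>, so \<open>a\<^sub>j = b\<^sub>i\<close>, and therefore \<open>f (a\<^sub>j) = f (b\<^sub>i)\<close>, wherever \<open>K\<^sub>i\<^sub>j\<close> is
  not zero.
\<close>

lemma orth_intertwine:
  fixes W :: "real^'k^'d" and V :: "real^'l^'d"
  assumes "orth W" "orth V" and eq: "W ** diag_mat a ** transpose W = V ** diag_mat b ** transpose V"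
  shows "W ** diag_mat (\<lambda>i. f (a i)) ** transpose W = V ** diag_mat (\<lambda>i. f (b i)) ** transpose V"
proof -
  define K where "K = transpose V ** W"
  have "transpose V ** (W ** diag_mat a ** transpose W) ** W = transpose V ** (V ** diag_mat b ** transpose V) ** W"
    unfolding eq ..
  then have "K ** diag_mat a = diag_mat b ** K"
    using assms(1,2) by (simp add: K_def orth_def matrix_mul_assoc[symmetric] matrix_cancel)
  then have "K$i$j * a j = b i * K$i$j" for i j
    by (metis diag_mat_mult_left diag_mat_mult_right)
  then have "K$i$j = 0 \<or> a j = b i" for i j by (metis mult.commute mult_cancel_left)
  then have "K ** diag_mat (\<lambda>i. f (a i)) = diag_mat (\<lambda>i. f (b i)) ** K"
    unfolding vec_eq_iff diag_mat_mult_left diag_mat_mult_right by (metis mult.commute mult_zero_left)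
  then have "V ** (K ** diag_mat (\<lambda>i. f (a i))) ** transpose W = V ** (diag_mat (\<lambda>i. f (b i)) ** K) ** transpose W"
    by simp
  then show ?thesis
    using assms(1,2) by (simp add: K_def orth_def matrix_mul_assoc[symmetric] matrix_cancel)
qed

theorem spectral_fun_eq:
  fixes W :: "real^'k^'d"
  assumes W: "orth W" and P: "P = W ** diag_mat l ** transpose W"
  shows "spectral_fun f P = W ** diag_mat (\<lambda>i. f (l i)) ** transpose W"
proof -
  have "transpose P = P" unfolding P by (simp add: matrix_transpose_mul transpose_diag_mat matrix_mul_assoc)
  from spectral_theorem[OF this] obtain V b where V: "orthogonal_matrix V" "P = V ** diag_mat b ** transpose V" by blast
  have eq: "Z ** diag_mat (\<lambda>i. f (c i)) ** transpose Z = W ** diag_mat (\<lambda>i. f (l i)) ** transpose W"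
    if "orthogonal_matrix Z" "P = Z ** diag_mat c ** transpose Z" for Z c
    by (rule orth_intertwine[OF orth_square[THEN iffD2, OF that(1)] W]) (simp only: that(2)[symmetric] P[symmetric])
  show ?thesis
    unfolding spectral_fun_def
  proof (rule the_equality)
    show "\<exists>Z c. orthogonal_matrix Z \<and> P = Z ** diag_mat c ** transpose Z \<and>
        W ** diag_mat (\<lambda>i. f (l i)) ** transpose W = Z ** diag_mat (\<lambda>i. f (c i)) ** transpose Z"
      using V(1) V(2) eq[OF V] by (intro exI[of _ V] exI[of _ b]) simp
  qed (use eq in blast)
qed

section \<open>Positive definite matrices and the affine-invariant distance\<close>

lemma inner_congruence: "x \<bullet> ((W ** X ** transpose W) *v x) = (transpose W *v x) \<bullet> (X *v (transpose W *v x))"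
  for W :: "real^'k^'d"
  by (metis dot_lmul_matrix matrix_vector_mul_assoc transpose_matrix_vector)

lemma inner_diag_mat: "y \<bullet> (diag_mat l *v y) = (\<Sum>i\<in>UNIV. l i * (y $ i)\<^sup>2)"
proof -
  have "(diag_mat l *v y) $ i = l i * y $ i" for i
    by (simp add: matrix_vector_mult_def diag_mat_def if_distrib[of "\<lambda>x. x * _"] cong: if_cong)
  then show ?thesis by (simp add: inner_vec_def power2_eq_square mult_ac)
qed

lemma congruence_spd:
  fixes W :: "real^'k^'d"
  assumes W: "invertible W" and P: "P \<in> spd"
  shows "W ** P ** transpose W \<in> spd"
proof -
  have "transpose (W ** P ** transpose W) = W ** P ** transpose W"
    using P by (simp add: spd_def matrix_transpose_mul matrix_mul_assoc)
  moreover have "x \<bullet> ((W ** P ** transpose W) *v x) > 0" if "x \<noteq> 0" for x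
  proof -
    have "transpose (matrix_inv W) *v (transpose W *v x) = x"
      using W by (simp only: matrix_vector_mul_assoc matrix_transpose_mul[symmetric] matrix_inv_right transpose_mat matrix_vector_mul_lid)
    then have "transpose W *v x \<noteq> 0" using that by (metis matrix_vector_mult_0_right)
    then show ?thesis unfolding inner_congruence using P by (simp add: spd_def)
  qed
  ultimately show ?thesis by (simp add: spd_def)
qed

lemma diag_mat_spd: "(\<And>i. l i > 0) \<Longrightarrow> diag_mat l \<in> spd"
proof -
  assume l: "\<And>i. l i > 0"
  have "x \<bullet> (diag_mat l *v x) > 0" if "x \<noteq> 0" for x
  proof -
    obtain i where i: "x $ i \<noteq> 0" using \<open>x \<noteq> 0\<close> by (auto simp: vec_eq_iff)
    have "0 < l i * (x $ i)\<^sup>2" using l[of i] i by simp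
    also have "\<dots> \<le> (\<Sum>i\<in>UNIV. l i * (x $ i)\<^sup>2)"
      using l by (intro member_le_sum mult_nonneg_nonneg) (auto intro: less_imp_le)
    finally show ?thesis by (simp add: inner_diag_mat)
  qed
  then show ?thesis by (simp add: spd_def transpose_diag_mat)
qed

lemma mat_1_spd: "mat 1 \<in> spd"
  using diag_mat_spd[of "\<lambda>_. 1"] by (simp add: diag_mat_one)

lemma spd_diagonal:
  fixes P :: "real^'k^'k"
  assumes "P \<in> spd"
  shows "\<exists>(W :: real^'k^'k) l. orth W \<and> (\<forall>i. l i > 0) \<and> P = W ** diag_mat l ** transpose W"
proof -
  obtain W l where W: "orthogonal_matrix W" "P = W ** diag_mat l ** transpose W"
    using spectral_theorem[of P] assms by (auto simp: spd_def)
  then have oW: "orth W" by (simp add: orth_square)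
  have "l i > 0" for i
  proof -
    have e: "transpose W *v (W *v axis i 1) = axis i 1"
      using oW unfolding matrix_vector_mul_assoc orth_def by simp
    then have "W *v axis i 1 \<noteq> 0" by (metis axis_eq_0_iff matrix_vector_mult_0_right zero_neq_one)
    then have "(W *v axis i 1) \<bullet> (P *v (W *v axis i 1)) > 0" using assms by (simp add: spd_def)
    then have "(\<Sum>j\<in>UNIV. l j * (axis i 1 $ j)\<^sup>2) > 0" unfolding W(2) inner_congruence e inner_diag_mat .
    moreover have "(\<Sum>j\<in>UNIV. l j * (axis i 1 $ j)\<^sup>2) = (\<Sum>j\<in>UNIV. if j = i then l j else 0)"
      by (intro sum.cong) (auto simp: axis_def)
    ultimately show ?thesis by simp
  qed
  then show ?thesis using oW W(2) by blast
qed

lemma spd_conj_diag: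
  fixes W :: "real^'k^'d"
  shows "invertible W \<Longrightarrow> (\<And>i. l i > 0) \<Longrightarrow> W ** diag_mat l ** transpose W \<in> spd"
  by (rule congruence_spd[OF _ diag_mat_spd])

lemma spd_sqrt:
  fixes P :: "real^'k^'k"
  assumes "P \<in> spd"
  obtains S where "S \<in> spd" "invertible S" "S ** S = P" "mat_inv_sqrt P = matrix_inv S"
proof -
  obtain W :: "real^'k^'k" and l where W: "orth W" "\<And>i. l i > 0" "P = W ** diag_mat l ** transpose W"
    using spd_diagonal[OF assms] by blast
  define S where "S = W ** diag_mat (\<lambda>i. sqrt (l i)) ** transpose W"
  have c: "transpose W ** W = mat 1" "W ** transpose W = mat 1" using W(1) by (auto simp: orth_def)
  have li: "l i > 0" for i using W(2) by blast
  have l0: "sqrt (l i) \<noteq> 0" "sqrt (l i) * sqrt (l i) = l i" "\<bar>l i\<bar> = l i" for i using li[of i] by auto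
  have "S ** S = P"
    unfolding S_def W(3)
    by (simp add: matrix_mul_assoc[symmetric] matrix_cancel[OF c(1)])
      (simp add: matrix_mul_assoc diag_mat_mult l0(2,3) matrix_mul_assoc[symmetric, of W "diag_mat _" "diag_mat _"])
  moreover have "S ** mat_inv_sqrt P = mat 1" "mat_inv_sqrt P ** S = mat 1"
    unfolding mat_inv_sqrt_def spectral_fun_eq[OF W(1,3)] S_def using l0
    by (simp_all add: matrix_mul_assoc[symmetric] matrix_cancel[OF c(1)])
      (simp_all add: matrix_mul_assoc matrix_mul_assoc[symmetric, of W "diag_mat _" "diag_mat _"] diag_mat_mult diag_mat_one c)
  moreover have "S \<in> spd" unfolding S_def using W by (intro spd_conj_diag orth_invertible) auto
  ultimately show thesis
    using that[of S] by (metis invertibleI matrix_inv_eqI)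
qed

lemma spd_sym: "P \<in> spd \<Longrightarrow> transpose P = P"
  by (simp add: spd_def)

lemma spd_invertible: "P \<in> spd \<Longrightarrow> invertible P"
  by (metis invertible_mult_rect spd_sqrt)

text \<open>
  Simultaneous diagonalization by a congruence: diagonalize \<open>P\<^sup>-\<^sup>1\<^sup>/\<^sup>2 P' P\<^sup>-\<^sup>1\<^sup>/\<^sup>2\<close> and undo the scaling.
\<close>

lemma spd_factor:
  fixes P :: "real^'k^'k"
  assumes "P \<in> spd" "P' \<in> spd"
  shows "\<exists>(Z :: real^'k^'k) l. invertible Z \<and> (\<forall>i. l i > 0) \<and> P = Z ** transpose Z \<and> P' = Z ** diag_mat l ** transpose Z"
proof -
  obtain S where S: "S \<in> spd" "invertible S" "S ** S = P" "mat_inv_sqrt P = matrix_inv S" using spd_sqrt[OF assms(1)] .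
  have tS: "transpose (matrix_inv S) = matrix_inv S"
    using S by (metis spd_sym transpose_matrix_inv)
  have "matrix_inv S ** P' ** transpose (matrix_inv S) \<in> spd"
    by (intro congruence_spd invertible_matrix_inv S assms)
  then obtain V :: "real^'k^'k" and l where V: "orth V" "\<And>i. l i > 0" "matrix_inv S ** P' ** matrix_inv S = V ** diag_mat l ** transpose V"
    using spd_diagonal[of "matrix_inv S ** P' ** transpose (matrix_inv S)"] unfolding tS by blast
  have "S ** V ** transpose (S ** V) = P"
    using V(1) S(3) spd_sym[OF S(1)] by (simp add: matrix_transpose_mul matrix_mul_assoc[symmetric] orth_def matrix_cancel)
  moreover have "S ** V ** diag_mat l ** transpose (S ** V) = S ** (V ** diag_mat l ** transpose V) ** S"
    using spd_sym[OF S(1)] by (simp add: matrix_transpose_mul matrix_mul_assoc)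
  then have "S ** V ** diag_mat l ** transpose (S ** V) = P'"
    unfolding V(3)[symmetric] using S(2)
    by (simp add: matrix_mul_assoc[symmetric] matrix_inv_left matrix_cancel matrix_inv_right)
  moreover have "invertible (S ** V)" using S V orth_invertible invertible_mult_rect by blast
  ultimately show ?thesis using V(2) by (intro exI[of _ "S ** V"] exI[of _ l]) auto
qed

text \<open>
  The matrix \<open>P\<^sup>-\<^sup>1\<^sup>/\<^sup>2 Z\<close> is orthogonal and diagonalizes \<open>P\<^sup>-\<^sup>1\<^sup>/\<^sup>2 P' P\<^sup>-\<^sup>1\<^sup>/\<^sup>2\<close>. The factor \<open>Z\<close> may be rectangular, which
  lets the formula compare matrices of different index types.
\<close>

theorem d_AI_factor:
  fixes Z :: "real^'k^'d"
  assumes Z: "invertible Z" and l: "\<And>i. l i > 0"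
    and P: "P = Z ** transpose Z" "P' = Z ** diag_mat l ** transpose Z"
  shows "d_AI P P' = sqrt (\<Sum>i\<in>UNIV. (ln (l i))\<^sup>2)"
proof -
  have "P \<in> spd"
    using congruence_spd[OF Z mat_1_spd] by (simp add: P)
  then obtain S where S: "S \<in> spd" "invertible S" "S ** S = P" "mat_inv_sqrt P = matrix_inv S" using spd_sqrt by blast
  define V where "V = matrix_inv S ** Z"
  have tS: "transpose (matrix_inv S) = matrix_inv S"
    using S by (metis spd_sym transpose_matrix_inv)
  have "V ** transpose V = matrix_inv S ** (Z ** transpose Z) ** matrix_inv S"
    by (simp add: V_def matrix_transpose_mul tS matrix_mul_assoc)
  also have "\<dots> = mat 1"
    unfolding P(1)[symmetric] S(3)[symmetric] using S(2)
    by (simp add: matrix_mul_assoc[symmetric] matrix_inv_left matrix_cancel matrix_inv_right)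
  finally have VV: "V ** transpose V = mat 1" .
  have "invertible V" unfolding V_def using S Z by (intro invertible_mult_rect invertible_matrix_inv)
  then have "transpose V = matrix_inv V"
    using VV by (metis matrix_inv_left matrix_mul_assoc matrix_mul_lid matrix_mul_rid)
  then have oV: "orth V" using \<open>invertible V\<close> by (simp add: orth_def matrix_inv_left matrix_inv_right)
  have "matrix_inv S ** P' ** matrix_inv S = V ** diag_mat l ** transpose V"
    by (simp add: P(2) V_def matrix_transpose_mul tS matrix_mul_assoc)
  from spectral_fun_eq[OF oV this, of ln]
  have "d_AI P P' = norm (diag_mat (\<lambda>i. ln (l i)))"
    by (simp add: d_AI_def S(4) mat_log_def norm_orth_conj[OF oV])
  then show ?thesis
    by (metis norm_diag_mat norm_ge_zero real_sqrt_unique)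
qed

corollary d_AI_congruence:
  fixes G :: "real^'k^'d"
  assumes "invertible G" "P \<in> spd" "P' \<in> spd"
  shows "d_AI (G ** P ** transpose G) (G ** P' ** transpose G) = d_AI P P'"
proof -
  obtain Z :: "real^'k^'k" and l where Z: "invertible Z" "\<And>i. l i > 0" "P = Z ** transpose Z" "P' = Z ** diag_mat l ** transpose Z"
    using spd_factor[OF assms(2,3)] by blast
  have "d_AI (G ** P ** transpose G) (G ** P' ** transpose G) = sqrt (\<Sum>i\<in>UNIV. (ln (l i))\<^sup>2)"
    using assms Z by (intro d_AI_factor[of "G ** Z"]) (auto simp: invertible_mult_rect matrix_transpose_mul matrix_mul_assoc)
  then show ?thesis using d_AI_factor[OF Z] by simp
qed

lemma mat_log_eq:
  fixes W :: "real^'k^'d"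
  assumes "orth W" "P = W ** diag_mat l ** transpose W"
  shows "mat_log P = W ** diag_mat (\<lambda>i. ln (l i)) ** transpose W"
  unfolding mat_log_def using assms by (rule spectral_fun_eq)

lemma norm_mat_log:
  fixes W :: "real^'k^'d"
  assumes "orth W" "P = W ** diag_mat l ** transpose W"
  shows "(norm (mat_log P))\<^sup>2 = (\<Sum>i\<in>UNIV. (ln (l i))\<^sup>2)"
  unfolding mat_log_eq[OF assms] norm_orth_conj[OF assms(1)] norm_diag_mat ..

lemma radius_eq_norm_log:
  fixes P :: "real^'k^'k"
  assumes "P \<in> spd"
  shows "radius P = norm (mat_log P)"
proof -
  obtain W :: "real^'k^'k" and l where W: "orth W" "\<And>i. l i > 0" "P = W ** diag_mat l ** transpose W"
    using spd_diagonal[OF assms] by blast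
  have "radius P = sqrt (\<Sum>i\<in>UNIV. (ln (l i))\<^sup>2)"
    unfolding radius_def using W by (intro d_AI_factor[of W]) (auto simp: orth_invertible orth_def)
  then show ?thesis using norm_mat_log[OF W(1,3)] by (metis norm_ge_zero real_sqrt_unique)
qed

lemma d_AI_mat_1_right:
  fixes P :: "real^'k^'k"
  assumes "P \<in> spd"
  shows "d_AI P (mat 1) = radius P"
proof -
  obtain W :: "real^'k^'k" and l where W: "orth W" "\<And>i. l i > 0" "P = W ** diag_mat l ** transpose W"
    using spd_diagonal[OF assms] by blast
  have c: "transpose W ** W = mat 1" "W ** transpose W = mat 1" using W(1) by (auto simp: orth_def)
  have li: "l i > 0" for i using W(2) by blast
  have l0: "sqrt (l i) * sqrt (l i) = l i" "\<bar>l i\<bar> = l i" for i using li[of i] by auto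
  define Z where "Z = W ** diag_mat (\<lambda>i. sqrt (l i))"
  have "d_AI P (mat 1) = sqrt (\<Sum>i\<in>UNIV. (ln (1 / l i))\<^sup>2)"
  proof (rule d_AI_factor[of Z])
    have nz: "sqrt (l i) \<noteq> 0" for i using li[of i] by auto
    show "invertible Z" unfolding Z_def using W nz by (intro invertible_mult_rect orth_invertible invertible_diag_mat)
    show "P = Z ** transpose Z"
      by (simp add: Z_def W(3) matrix_transpose_mul transpose_diag_mat matrix_mul_assoc matrix_mul_assoc[symmetric, of W "diag_mat _" "diag_mat _"] diag_mat_mult l0)
    have "sqrt (l i) * (1 / l i) * sqrt (l i) = 1" for i using li[of i] by (simp add: field_simps)
    then show "mat 1 = Z ** diag_mat (\<lambda>i. 1 / l i) ** transpose Z"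
      by (simp add: Z_def matrix_transpose_mul transpose_diag_mat matrix_mul_assoc matrix_mul_assoc[symmetric, of W "diag_mat _" "diag_mat _"] diag_mat_mult diag_mat_one c)
  qed (use W in auto)
  also have "ln (1 / l i) = - ln (l i)" for i using li[of i] by (simp add: ln_div)
  then have "sqrt (\<Sum>i\<in>UNIV. (ln (1 / l i))\<^sup>2) = sqrt (\<Sum>i\<in>UNIV. (ln (l i))\<^sup>2)" by simp
  finally show ?thesis
    using norm_mat_log[OF W(1,3)] radius_eq_norm_log[OF assms] by (metis norm_ge_zero real_sqrt_unique)
qed

lemma d_AI_nonneg: "d_AI P P' \<ge> 0"
  by (simp add: d_AI_def)

text \<open>
  Conjugating with the two eigenbases turns the difference into the matrix with entries \<open>K\<^sub>i\<^sub>j (a\<^sub>j - b\<^sub>i)\<close>,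
  where \<open>K = V\<^sup>T W\<close>.
\<close>

lemma norm_spectral_difference:
  fixes W :: "real^'k^'d" and V :: "real^'l^'d"
  assumes "orth W" "orth V"
  shows "(norm (W ** diag_mat a ** transpose W - V ** diag_mat b ** transpose V))\<^sup>2 =
    (\<Sum>i\<in>UNIV. \<Sum>j\<in>UNIV. ((transpose V ** W)$i$j)\<^sup>2 * (a j - b i)\<^sup>2)"
proof -
  let ?X = "W ** diag_mat a ** transpose W - V ** diag_mat b ** transpose V" and ?K = "transpose V ** W"
  have "norm ?X = norm (transpose V ** ?X ** W)"
    using norm_orth_mult(1)[OF orth_transpose[OF assms(2)]] norm_orth_mult(2)[OF orth_transpose[OF assms(1)]]
    by (metis transpose_transpose)
  also have "transpose V ** ?X ** W = ?K ** diag_mat a - diag_mat b ** ?K"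
    using assms by (simp add: mm_bilinear matrix_mul_assoc[symmetric] orth_def matrix_cancel)
  finally have n: "norm ?X = norm (?K ** diag_mat a - diag_mat b ** ?K)" .
  show ?thesis
    unfolding n norm_matrix_squared
    by (intro sum.cong refl) (simp add: diag_mat_mult_left diag_mat_mult_right power_mult_distrib[symmetric] algebra_simps)
qed

lemma spectral_lipschitz:
  fixes W :: "real^'k^'d" and V :: "real^'l^'d"
  assumes "orth W" "orth V" and C: "C \<ge> 0" "\<And>i j. \<bar>f (a j) - f (b i)\<bar> \<le> C * \<bar>g (a j) - g (b i)\<bar>"
  shows "norm (W ** diag_mat (\<lambda>i. f (a i)) ** transpose W - V ** diag_mat (\<lambda>i. f (b i)) ** transpose V) \<le>
     C * norm (W ** diag_mat (\<lambda>i. g (a i)) ** transpose W - V ** diag_mat (\<lambda>i. g (b i)) ** transpose V)"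
proof (rule power2_le_imp_le)
  have "(f (a j) - f (b i))\<^sup>2 \<le> C\<^sup>2 * (g (a j) - g (b i))\<^sup>2" for i j
    using power_mono[OF C(2)[of j i], of 2] by (simp add: power_mult_distrib)
  then have "((transpose V ** W)$i$j)\<^sup>2 * (f (a j) - f (b i))\<^sup>2 \<le> C\<^sup>2 * (((transpose V ** W)$i$j)\<^sup>2 * (g (a j) - g (b i))\<^sup>2)" for i j
    by (metis mult.left_commute mult_left_mono zero_le_power2)
  then show "(norm (W ** diag_mat (\<lambda>i. f (a i)) ** transpose W - V ** diag_mat (\<lambda>i. f (b i)) ** transpose V))\<^sup>2 \<le>
     (C * norm (W ** diag_mat (\<lambda>i. g (a i)) ** transpose W - V ** diag_mat (\<lambda>i. g (b i)) ** transpose V))\<^sup>2"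
    unfolding power_mult_distrib norm_spectral_difference[OF assms(1,2)] sum_distrib_left
    by (intro sum_mono)
qed (use C in auto)

text \<open>
  The derivative of \<open>x - 1 / x - 2 ln x\<close> is the square of \<open>1 - 1 / x\<close>.
\<close>

lemma ln_le_sinh_ln: "x \<ge> 1 \<Longrightarrow> 2 * ln x \<le> x - 1 / x" for x :: real
proof -
  assume x: "x \<ge> 1"
  let ?g = "\<lambda>x :: real. x - 1 / x - 2 * ln x"
  have "?g 1 \<le> ?g x"
  proof (rule DERIV_nonneg_imp_nondecreasing[OF x])
    fix y :: real assume "1 \<le> y" "y \<le> x"
    then have "(?g has_real_derivative (1 - 1 / y)\<^sup>2) (at y)"
      by (auto intro!: derivative_eq_intros simp: field_simps power2_eq_square)
    then show "\<exists>d. (?g has_real_derivative d) (at y) \<and> d \<ge> 0" by (intro exI[of _ "(1 - 1 / y)\<^sup>2"]) auto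
  qed
  then show ?thesis by simp
qed

text \<open>
  The logarithmic mean \<open>(a - b) / (ln a - ln b)\<close> is at least the geometric mean.
\<close>

lemma ln_diff_squared_le:
  fixes a b :: real
  assumes "a > 0" "b > 0"
  shows "(ln a - ln b)\<^sup>2 \<le> (a - b)\<^sup>2 / (a * b)"
proof -
  have *: "(ln a - ln b)\<^sup>2 \<le> (a - b)\<^sup>2 / (a * b)" if "b \<le> a" "b > 0" for a b :: real
  proof -
    define x where "x = sqrt (a / b)"
    have x: "x \<ge> 1" and x2: "x\<^sup>2 = a / b" using that by (auto simp: x_def)
    have "ln a - ln b = 2 * ln x"
      using that x ln_realpow[of x 2] ln_div[of a b] unfolding x2 by simp
    then have 1: "ln a - ln b \<le> x - 1 / x" "0 \<le> ln a - ln b" using ln_le_sinh_ln[OF x] x by auto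
    then have "(ln a - ln b)\<^sup>2 \<le> (x - 1 / x)\<^sup>2" by (intro power_mono) auto
    also have "(x - 1 / x)\<^sup>2 = x\<^sup>2 + 1 / x\<^sup>2 - 2" using x by (simp add: power2_diff power_divide)
    also have "\<dots> = (a - b)\<^sup>2 / (a * b)"
      unfolding x2 using that by (simp add: field_simps power2_eq_square)
    finally show ?thesis .
  qed
  show ?thesis
  proof (cases "b \<le> a")
    case False
    then show ?thesis using *[of a b] assms by (simp add: power2_commute mult.commute)
  qed (use * assms in blast)
qed

text \<open>
  Applied to the entries in the two eigenbases, the inequality between the means bounds the left side by
  \<open>trace (P\<^sup>-\<^sup>1 (P - P') P'\<^sup>-\<^sup>1 (P - P'))\<close>. This number is invariant under congruence and can be evaluated after
  removing \<open>Z\<close>.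
\<close>

lemma log_distance_le_chordal:
  fixes Z :: "real^'k^'k"
  assumes Z: "invertible Z" and \<nu>: "\<And>i. \<nu> i > 0"
    and P: "P = Z ** transpose Z" "P' = Z ** diag_mat \<nu> ** transpose Z"
  shows "(norm (mat_log P - mat_log P'))\<^sup>2 \<le> (\<Sum>i\<in>UNIV. (1 - \<nu> i)\<^sup>2 / \<nu> i)"
proof -
  have spd: "P \<in> spd" "P' \<in> spd"
    using congruence_spd[OF Z mat_1_spd] spd_conj_diag[OF Z \<nu>] by (auto simp: P)
  obtain W :: "real^'k^'k" and a where W: "orth W" "\<And>i. a i > 0" "P = W ** diag_mat a ** transpose W"
    using spd_diagonal[OF spd(1)] by blast
  obtain V :: "real^'k^'k" and b where V: "orth V" "\<And>i. b i > 0" "P' = V ** diag_mat b ** transpose V"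
    using spd_diagonal[OF spd(2)] by blast
  have c: "transpose W ** W = mat 1" "W ** transpose W = mat 1" "transpose V ** V = mat 1" "V ** transpose V = mat 1"
    using W(1) V(1) by (auto simp: orth_def)
  let ?K = "transpose V ** W"
  have "(norm (mat_log P - mat_log P'))\<^sup>2 = (\<Sum>i\<in>UNIV. \<Sum>j\<in>UNIV. (?K$i$j)\<^sup>2 * (ln (a j) - ln (b i))\<^sup>2)"
    unfolding mat_log_eq[OF W(1,3)] mat_log_eq[OF V(1,3)] by (rule norm_spectral_difference[OF W(1) V(1)])
  also have "\<dots> \<le> (\<Sum>i\<in>UNIV. \<Sum>j\<in>UNIV. (?K$i$j)\<^sup>2 * ((a j - b i)\<^sup>2 / (a j * b i)))"
    by (intro sum_mono mult_left_mono ln_diff_squared_le W V) auto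
  also have "\<dots> = trace (matrix_inv P ** (P - P') ** matrix_inv P' ** (P - P'))"
  proof -
    have nz: "a i \<noteq> 0" "b i \<noteq> 0" for i using W(2)[of i] V(2)[of i] by auto
    have iP: "matrix_inv P = W ** diag_mat (\<lambda>i. 1 / a i) ** transpose W"
      unfolding W(3) using nz
      by (intro matrix_inv_eqI) (simp_all add: matrix_mul_assoc[symmetric] matrix_cancel[OF c(1)], simp_all add: matrix_mul_assoc matrix_mul_assoc[symmetric, of W "diag_mat _" "diag_mat _"] diag_mat_mult diag_mat_one c)
    have iP': "matrix_inv P' = V ** diag_mat (\<lambda>i. 1 / b i) ** transpose V"
      unfolding V(3) using nz
      by (intro matrix_inv_eqI) (simp_all add: matrix_mul_assoc[symmetric] matrix_cancel[OF c(3)], simp_all add: matrix_mul_assoc matrix_mul_assoc[symmetric, of V "diag_mat _" "diag_mat _"] diag_mat_mult diag_mat_one c)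
    let ?D = "transpose V ** (P - P') ** W"
    have D: "?D = ?K ** diag_mat a - diag_mat b ** ?K"
      unfolding W(3) V(3) using c by (simp add: mm_bilinear matrix_mul_assoc[symmetric] matrix_cancel)
    have sym: "transpose (P - P') = P - P'"
      using spd by (simp add: linear_diff[OF linear_transpose] spd_sym)
    have tD: "transpose ?D = transpose W ** (P - P') ** V"
      by (simp add: matrix_transpose_mul sym matrix_mul_assoc)
    have "trace (matrix_inv P ** (P - P') ** matrix_inv P' ** (P - P')) =
       trace (W ** (diag_mat (\<lambda>i. 1 / a i) ** transpose ?D ** diag_mat (\<lambda>i. 1 / b i) ** (transpose V ** (P - P'))))"
      unfolding iP iP' tD by (simp add: matrix_mul_assoc)
    also have "\<dots> = trace (diag_mat (\<lambda>i. 1 / a i) ** transpose ?D ** (diag_mat (\<lambda>i. 1 / b i) ** ?D))"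
      by (subst trace_mult_commute) (simp add: matrix_mul_assoc)
    also have "\<dots> = (\<Sum>j\<in>UNIV. \<Sum>i\<in>UNIV. (1 / a j * ?D$i$j) * (1 / b i * ?D$i$j))"
      unfolding trace_def matrix_matrix_mult_def[of "diag_mat _ ** transpose ?D"]
      by (simp add: diag_mat_mult_left transpose_def)
    also have "\<dots> = (\<Sum>i\<in>UNIV. \<Sum>j\<in>UNIV. (1 / a j * ?D$i$j) * (1 / b i * ?D$i$j))" by (rule sum.swap)
    also have "\<dots> = (\<Sum>i\<in>UNIV. \<Sum>j\<in>UNIV. (?K$i$j)\<^sup>2 * ((a j - b i)\<^sup>2 / (a j * b i)))"
      unfolding D by (intro sum.cong refl) (simp add: diag_mat_mult_left diag_mat_mult_right nz power2_eq_square field_simps)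
    finally show ?thesis ..
  qed
  also have "\<dots> = (\<Sum>i\<in>UNIV. (1 - \<nu> i)\<^sup>2 / \<nu> i)"
  proof -
    have nz: "\<nu> i \<noteq> 0" for i using \<nu>[of i] by auto
    let ?Zi = "matrix_inv Z"
    have cz: "Z ** ?Zi = mat 1" "?Zi ** Z = mat 1" "transpose Z ** transpose ?Zi = mat 1" "transpose ?Zi ** transpose Z = mat 1"
      using Z by (simp_all add: matrix_inv_left matrix_inv_right matrix_transpose_mul[symmetric])
    have iP: "matrix_inv P = transpose ?Zi ** ?Zi"
      unfolding P(1) by (intro matrix_inv_eqI) (simp_all add: matrix_mul_assoc[symmetric] matrix_cancel cz)
    have iP': "matrix_inv P' = transpose ?Zi ** diag_mat (\<lambda>i. 1 / \<nu> i) ** ?Zi"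
      unfolding P(2) using nz
      by (intro matrix_inv_eqI) (simp_all add: matrix_mul_assoc[symmetric] matrix_cancel cz, simp_all add: matrix_mul_assoc matrix_mul_assoc[symmetric, of _ "diag_mat _" "diag_mat _"] diag_mat_mult diag_mat_one cz)
    have d: "P - P' = Z ** diag_mat (\<lambda>i. 1 - \<nu> i) ** transpose Z"
      unfolding P diag_mat_diff[symmetric] by (simp add: mm_bilinear diag_mat_one)
    have "matrix_inv P ** (P - P') ** matrix_inv P' ** (P - P') = transpose ?Zi ** (diag_mat (\<lambda>i. (1 - \<nu> i) * (1 / \<nu> i) * (1 - \<nu> i)) ** transpose Z)"
      unfolding iP iP' d diag_mat_mult[symmetric] by (simp add: matrix_mul_assoc[symmetric] matrix_cancel cz)
    then have "trace (matrix_inv P ** (P - P') ** matrix_inv P' ** (P - P')) = trace (diag_mat (\<lambda>i. (1 - \<nu> i) * (1 / \<nu> i) * (1 - \<nu> i)))"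
      by (simp add: trace_mult_commute[of "transpose ?Zi"] matrix_mul_assoc[symmetric] cz)
    then show ?thesis by (simp add: trace_diag_mat power2_eq_square)
  qed
  finally show ?thesis .
qed

lemma sinh_scaling_limit: "(\<lambda>n. real (Suc n) * (exp (x / (2 * real (Suc n))) - exp (- (x / (2 * real (Suc n)))))) \<longlonglongrightarrow> x"
proof -
  have "((\<lambda>h. exp (x * h / 2) - exp (- (x * h / 2))) has_real_derivative x) (at 0)"
    by (auto intro!: derivative_eq_intros)
  then have "((\<lambda>h. (exp (x * h / 2) - exp (- (x * h / 2))) / h) \<longlongrightarrow> x) (at 0)"
    by (simp add: has_field_derivative_iff)
  moreover have "filterlim (\<lambda>n. inverse (real (Suc n))) (at 0) sequentially"
    unfolding filterlim_at using LIMSEQ_inverse_real_of_nat by auto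
  ultimately have "(\<lambda>n. (exp (x * inverse (real (Suc n)) / 2) - exp (- (x * inverse (real (Suc n)) / 2))) / inverse (real (Suc n))) \<longlonglongrightarrow> x"
    by (rule filterlim_compose)
  moreover have "(exp (x * inverse N / 2) - exp (- (x * inverse N / 2))) / inverse N =
      N * (exp (x / (2 * N)) - exp (- (x / (2 * N))))" for N :: real
  proof -
    have *: "x * inverse N / 2 = x / (2 * N)" by (cases "N = 0") (auto simp: field_simps)
    show ?thesis unfolding * by (simp only: divide_inverse[of _ "inverse N"] inverse_inverse_eq mult.commute[of N])
  qed
  ultimately show ?thesis by (simp only:)
qed

text \<open>
  The exponential metric increasing property. With \<open>\<nu>\<^sub>i = exp x\<^sub>i\<close> the chordal bound is the sum of the squares of
  \<open>2 sinh (x\<^sub>i / 2)\<close>, which agrees with the squared distance to leading order. Subdividing the geodesic from \<open>P\<close>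
  to \<open>P'\<close> into ever shorter pieces turns it into the distance.
\<close>

theorem log_distance_le_d_AI:
  fixes P :: "real^'k^'k"
  assumes "P \<in> spd" "P' \<in> spd"
  shows "norm (mat_log P - mat_log P') \<le> d_AI P P'"
proof -
  obtain Z :: "real^'k^'k" and \<nu> where Z: "invertible Z" "\<And>i. \<nu> i > 0" "P = Z ** transpose Z" "P' = Z ** diag_mat \<nu> ** transpose Z"
    using spd_factor[OF assms] by blast
  define x where "x i = ln (\<nu> i)" for i
  define g where "g t = Z ** diag_mat (\<lambda>i. exp (t * x i)) ** transpose Z" for t
  have step: "norm (mat_log (g s) - mat_log (g (s + h))) \<le> sqrt (\<Sum>i\<in>UNIV. (exp (h * x i / 2) - exp (- (h * x i / 2)))\<^sup>2)" for s h
  proof (rule real_le_rsqrt)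
    let ?Y = "Z ** diag_mat (\<lambda>i. exp (s * x i / 2))"
    have "(norm (mat_log (g s) - mat_log (g (s + h))))\<^sup>2 \<le> (\<Sum>i\<in>UNIV. (1 - exp (h * x i))\<^sup>2 / exp (h * x i))"
    proof (rule log_distance_le_chordal[where Z = ?Y])
      show "invertible ?Y" using Z by (intro invertible_mult_rect invertible_diag_mat) auto
      show "g s = ?Y ** transpose ?Y" "g (s + h) = ?Y ** diag_mat (\<lambda>i. exp (h * x i)) ** transpose ?Y"
        unfolding g_def matrix_transpose_mul transpose_diag_mat matrix_mul_assoc
        unfolding matrix_mul_assoc[symmetric, of Z "diag_mat _" "diag_mat _"] diag_mat_mult exp_add[symmetric]
        by (simp_all add: algebra_simps)
    qed auto
    also have "\<dots> = (\<Sum>i\<in>UNIV. (exp (h * x i / 2) - exp (- (h * x i / 2)))\<^sup>2)"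
    proof (rule sum.cong[OF refl])
      fix i
      have e: "exp (h * x i) = (exp (h * x i / 2))\<^sup>2" by (simp add: exp_double[symmetric])
      show "(1 - exp (h * x i))\<^sup>2 / exp (h * x i) = (exp (h * x i / 2) - exp (- (h * x i / 2)))\<^sup>2"
        unfolding e exp_minus by (simp add: field_simps power2_eq_square)
    qed
    finally show "(norm (mat_log (g s) - mat_log (g (s + h))))\<^sup>2 \<le> (\<Sum>i\<in>UNIV. (exp (h * x i / 2) - exp (- (h * x i / 2)))\<^sup>2)" .
  qed
  have chain: "norm (mat_log (g 0) - mat_log (g (real k * h))) \<le> real k * sqrt (\<Sum>i\<in>UNIV. (exp (h * x i / 2) - exp (- (h * x i / 2)))\<^sup>2)" for k h
  proof (induction k)
    case (Suc k)
    have "norm (mat_log (g 0) - mat_log (g (real (Suc k) * h))) \<le>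
        norm (mat_log (g 0) - mat_log (g (real k * h))) + norm (mat_log (g (real k * h)) - mat_log (g (real k * h + h)))"
      using norm_triangle_ineq[of "mat_log (g 0) - mat_log (g (real k * h))" "mat_log (g (real k * h)) - mat_log (g (real k * h + h))"]
      by (simp add: algebra_simps)
    with Suc step[of "real k * h" h] show ?case by (simp add: algebra_simps)
  qed simp
  have g01: "g 0 = P" "g 1 = P'"
    using Z by (simp_all add: g_def diag_mat_one x_def)
  have bound: "norm (mat_log P - mat_log P') \<le> sqrt (\<Sum>i\<in>UNIV. (real (Suc n) * (exp (x i / (2 * real (Suc n))) - exp (- (x i / (2 * real (Suc n))))))\<^sup>2)" for n
  proof -
    have "norm (mat_log P - mat_log P') \<le> real (Suc n) * sqrt (\<Sum>i\<in>UNIV. (exp (x i / (2 * real (Suc n))) - exp (- (x i / (2 * real (Suc n)))))\<^sup>2)"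
      using chain[of "Suc n" "1 / real (Suc n)"] g01 by (simp add: field_simps del: of_nat_Suc)
    also have "\<dots> = sqrt ((real (Suc n))\<^sup>2 * (\<Sum>i\<in>UNIV. (exp (x i / (2 * real (Suc n))) - exp (- (x i / (2 * real (Suc n)))))\<^sup>2))"
      by (simp add: real_sqrt_mult del: of_nat_Suc)
    finally show ?thesis by (simp add: sum_distrib_left power_mult_distrib)
  qed
  have "(\<lambda>n. sqrt (\<Sum>i\<in>UNIV. (real (Suc n) * (exp (x i / (2 * real (Suc n))) - exp (- (x i / (2 * real (Suc n))))))\<^sup>2)) \<longlonglongrightarrow> sqrt (\<Sum>i\<in>UNIV. (x i)\<^sup>2)"
    by (intro tendsto_intros sinh_scaling_limit)
  from LIMSEQ_le_const[OF this] bound have "norm (mat_log P - mat_log P') \<le> sqrt (\<Sum>i\<in>UNIV. (x i)\<^sup>2)" by blast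
  then show ?thesis
    using d_AI_factor[OF Z] by (simp add: x_def)
qed

section \<open>Nonpositive curvature\<close>

lemma orth_mat_1: "orth (mat 1)"
  by (simp add: orth_def)

text \<open>
  After a congruence the midpoint \<open>m\<close> is the identity and \<open>P\<close>, \<open>P'\<close> are \<open>exp (- X)\<close>, \<open>exp X\<close>. Taking logarithms does
  not increase the distances of these two from the image of the base point, preserves the distance of the midpoint
  from it, and reduces the claim to the parallelogram law.
\<close>

theorem semi_parallelogram_law:
  fixes W :: "real^'k^'k"
  assumes W: "invertible W" and \<nu>: "\<And>i. \<nu> i > 0"
  defines "P \<equiv> W ** transpose W" and "P' \<equiv> W ** diag_mat \<nu> ** transpose W"
    and "m \<equiv> W ** diag_mat (\<lambda>i. sqrt (\<nu> i)) ** transpose W"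
  shows "(radius m)\<^sup>2 \<le> (radius P)\<^sup>2 / 2 + (radius P')\<^sup>2 / 2 - (d_AI P P')\<^sup>2 / 4"
proof -
  \<comment> \<open>With the fourth roots of the \<open>\<nu>\<^sub>i\<close> the midpoint becomes \<open>W1 W1\<^sup>T\<close>.\<close>
  define q where "q i = sqrt (sqrt (\<nu> i))" for i
  define s where "s i = sqrt (\<nu> i)" for i
  have s: "s i > 0" "s i * s i = \<nu> i" for i using \<nu>[of i] by (simp_all add: s_def)
  have q: "q i > 0" "q i * q i = s i" for i using \<nu>[of i] by (simp_all add: q_def s_def)
  have nz: "q i \<noteq> 0" "s i \<noteq> 0" for i using q(1)[of i] s(1)[of i] by auto
  define W1 where "W1 = W ** diag_mat q"
  define G where "G = matrix_inv W1"
  have W1: "invertible W1" unfolding W1_def using W nz by (intro invertible_mult_rect invertible_diag_mat)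
  have G: "invertible G" unfolding G_def by (rule invertible_matrix_inv[OF W1])
  have c: "G ** W1 = mat 1" "transpose W1 ** transpose G = mat 1"
    using W1 by (simp_all add: G_def matrix_inv_left matrix_transpose_mul[symmetric])
  have W1d: "W1 ** diag_mat a ** transpose W1 = W ** diag_mat (\<lambda>i. q i * a i * q i) ** transpose W" for a
    unfolding W1_def matrix_transpose_mul transpose_diag_mat matrix_mul_assoc
    unfolding matrix_mul_assoc[symmetric, of W "diag_mat _" "diag_mat _"] diag_mat_mult ..
  have e: "q i * (1 / s i) * q i = 1" "q i * s i * q i = \<nu> i" "q i * 1 * q i = sqrt (\<nu> i)" for i
  proof -
    have "q i * (1 / s i) * q i = (q i * q i) / s i" "q i * s i * q i = (q i * q i) * s i" by simp_all
    then show "q i * (1 / s i) * q i = 1" "q i * s i * q i = \<nu> i"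
      unfolding q(2) s(2) using nz(2)[of i] by simp_all
    show "q i * 1 * q i = sqrt (\<nu> i)" using q(2)[of i] by (simp add: s_def)
  qed
  have P: "P = W1 ** diag_mat (\<lambda>i. 1 / s i) ** transpose W1" "P' = W1 ** diag_mat s ** transpose W1"
    "m = W1 ** diag_mat (\<lambda>i. 1) ** transpose W1"
    unfolding W1d e by (simp_all add: P_def P'_def m_def diag_mat_one)
  have spd: "P \<in> spd" "P' \<in> spd" "m \<in> spd"
    unfolding P using W1 s(1) by (auto intro!: spd_conj_diag)
  have conj: "G ** (W1 ** diag_mat a ** transpose W1) ** transpose G = diag_mat a" for a
    using c by (simp add: matrix_mul_assoc[symmetric] matrix_cancel)
  define Q where "Q = G ** mat 1 ** transpose G"
  have Q: "Q \<in> spd" unfolding Q_def by (intro congruence_spd G mat_1_spd)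
  have rad: "radius (W1 ** diag_mat a ** transpose W1) = d_AI Q (diag_mat a)" if "\<And>i. a i > 0" for a
  proof -
    have "d_AI (G ** mat 1 ** transpose G) (G ** (W1 ** diag_mat a ** transpose W1) ** transpose G) = d_AI (mat 1) (W1 ** diag_mat a ** transpose W1)"
      by (intro d_AI_congruence G mat_1_spd spd_conj_diag W1 that)
    then show ?thesis by (simp only: conj Q_def radius_def)
  qed
  define X where "X = diag_mat (\<lambda>i. ln (\<nu> i) / 2)"
  have lnd: "mat_log (diag_mat a) = diag_mat (\<lambda>i. ln (a i))" for a :: "'k \<Rightarrow> real"
    using mat_log_eq[OF orth_mat_1, of "diag_mat a" a] by simp
  have lns: "ln (s i) = ln (\<nu> i) / 2" "ln (1 / s i) = - (ln (\<nu> i) / 2)" for i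
    using \<nu>[of i] s(1)[of i] by (simp_all add: s_def ln_sqrt ln_div)
  have "mat_log (diag_mat s) = X" "mat_log (diag_mat (\<lambda>i. 1 / s i)) = - X"
    unfolding lnd lns X_def by (simp_all add: diag_mat_def vec_eq_iff)
  then have 1: "norm (mat_log Q - X) \<le> radius P'" "norm (mat_log Q + X) \<le> radius P"
    using log_distance_le_d_AI[OF Q diag_mat_spd[of s]] log_distance_le_d_AI[OF Q diag_mat_spd[of "\<lambda>i. 1 / s i"]]
      rad[of s] rad[of "\<lambda>i. 1 / s i"] s(1) unfolding P by auto
  have 2: "radius m = norm (mat_log Q)"
    unfolding P(3) using rad[of "\<lambda>_. 1"] d_AI_mat_1_right[OF Q] radius_eq_norm_log[OF Q] by (simp add: diag_mat_one)
  have "(d_AI P P')\<^sup>2 = (\<Sum>i\<in>UNIV. (ln (\<nu> i))\<^sup>2)"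
    using d_AI_factor[OF W \<nu>, of P P'] by (simp add: P_def P'_def sum_nonneg)
  also have "\<dots> = 4 * (norm X)\<^sup>2"
    unfolding X_def norm_diag_mat by (simp add: sum_distrib_left power_divide)
  finally have 3: "(d_AI P P')\<^sup>2 = 4 * (norm X)\<^sup>2" .
  have "(norm (mat_log Q - X))\<^sup>2 + (norm (mat_log Q + X))\<^sup>2 = 2 * (norm (mat_log Q))\<^sup>2 + 2 * (norm X)\<^sup>2"
    unfolding power2_norm_eq_inner by (simp add: inner_diff_left inner_diff_right inner_add_left inner_add_right)
  moreover have "(norm (mat_log Q - X))\<^sup>2 \<le> (radius P')\<^sup>2" "(norm (mat_log Q + X))\<^sup>2 \<le> (radius P)\<^sup>2"
    using 1 by (auto intro: power_mono)
  ultimately show ?thesis unfolding 2 3 by linarith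
qed

lemma det_diag_mat: "det (diag_mat a) = (\<Prod>i\<in>UNIV. a i)"
  by (subst det_diagonal) (auto simp: diag_mat_def)

text \<open>
  With \<open>y = W\<^sup>T A\<close> the condition \<open>P A = P' A\<close> says that row \<open>i\<close> of \<open>y\<close> vanishes unless \<open>\<nu>\<^sub>i = 1\<close>; so \<open>diag \<nu>\<close> may
  be replaced by its square root without changing the product with \<open>A\<close>.
\<close>

theorem fiber_midpoint:
  fixes A :: "real^'m^'d"
  assumes "P \<in> fiber A B" "P' \<in> fiber A B"
  shows "\<exists>m\<in>fiber A B. (radius m)\<^sup>2 \<le> (radius P)\<^sup>2 / 2 + (radius P')\<^sup>2 / 2 - (d_AI P P')\<^sup>2 / 4"
proof -
  have P: "P \<in> spd" "det P = 1" "P ** A = B" and P': "P' \<in> spd" "det P' = 1" "P' ** A = B"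
    using assms by (auto simp: fiber_def spd1_def act_def)
  obtain W :: "real^'d^'d" and \<nu> where W: "invertible W" "\<forall>i. \<nu> i > 0" "P = W ** transpose W" "P' = W ** diag_mat \<nu> ** transpose W"
    using spd_factor[OF P(1) P'(1)] by blast
  define m where "m = W ** diag_mat (\<lambda>i. sqrt (\<nu> i)) ** transpose W"
  define y where "y = transpose W ** A"
  have "W ** (diag_mat \<nu> ** y) = W ** y"
    using P(3) P'(3) by (simp add: W(3,4) y_def matrix_mul_assoc)
  then have "matrix_inv W ** (W ** (diag_mat \<nu> ** y)) = matrix_inv W ** (W ** y)" by simp
  then have "diag_mat \<nu> ** y = y"
    using W(1) by (simp add: matrix_cancel matrix_inv_left)
  then have "\<nu> i * y $ i $ j = y $ i $ j" for i j by (metis diag_mat_mult_left)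
  then have "\<nu> i = 1 \<or> y $ i $ j = 0" for i j by (metis mult_cancel_right1 mult.commute)
  then have "diag_mat (\<lambda>i. sqrt (\<nu> i)) ** y = y"
    unfolding vec_eq_iff diag_mat_mult_left by (metis mult_1 mult_zero_right real_sqrt_one)
  then have mA: "m ** A = B"
    using P(3) unfolding m_def W(3) by (simp add: y_def matrix_mul_assoc[symmetric])
  have d1: "(det W)\<^sup>2 = 1"
    using P(2) by (simp add: W(3) det_mul det_transpose power2_eq_square)
  have d2: "(det W)\<^sup>2 * (\<Prod>i\<in>UNIV. \<nu> i) = 1"
    using P'(2) by (simp add: W(4) det_mul det_transpose det_diag_mat power2_eq_square mult_ac)
  have "(\<Prod>i\<in>UNIV. \<nu> i) = 1" using d2 unfolding d1 by simp
  moreover have "(\<Prod>i\<in>UNIV. sqrt (\<nu> i))\<^sup>2 = (\<Prod>i\<in>UNIV. \<nu> i)"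
    unfolding prod_power_distrib using W(2) by (simp add: less_imp_le)
  ultimately have "(\<Prod>i\<in>UNIV. sqrt (\<nu> i))\<^sup>2 = 1" by simp
  moreover have "(\<Prod>i\<in>UNIV. sqrt (\<nu> i)) > 0" using W(2) by (intro prod_pos) auto
  ultimately have "(\<Prod>i\<in>UNIV. sqrt (\<nu> i)) = 1" by (simp add: power2_eq_1_iff)
  then have "det m = 1"
    using d1 by (simp add: m_def det_mul det_transpose det_diag_mat power2_eq_square)
  moreover have "m \<in> spd" unfolding m_def using W by (intro spd_conj_diag) auto
  ultimately have "m \<in> fiber A B" using mA by (simp add: fiber_def spd1_def act_def)
  then show ?thesis
    using semi_parallelogram_law[of W \<nu>] W unfolding m_def by (intro bexI[of _ m]) (auto simp: m_def)
qed

section \<open>Analyticity of matrix functions\<close>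

lemma real_analytic_at_matrix_mult:
  fixes f :: "'a::real_normed_vector \<Rightarrow> real^'n^'m" and g :: "'a \<Rightarrow> real^'k^'n"
  assumes "real_analytic_at f x" "real_analytic_at g x"
  shows "real_analytic_at (\<lambda>x. f x ** g x) x"
  using real_analytic_at_bilinear[OF bounded_bilinear_matrix_mult assms] .

lemma real_analytic_at_vec:
  fixes f :: "'i::finite \<Rightarrow> 'a::real_normed_vector \<Rightarrow> 'b::euclidean_space"
  assumes "\<And>i. real_analytic_at (f i) x"
  shows "real_analytic_at (\<lambda>x. \<chi> i. f i x) x"
proof -
  have "linear (axis i :: 'b \<Rightarrow> 'b^'i)" for i
    by (rule linearI) (auto simp: axis_def vec_eq_iff)
  then have "bounded_linear (axis i :: 'b \<Rightarrow> 'b^'i)" for i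
    by (simp add: linear_conv_bounded_linear)
  then have "real_analytic_at (\<lambda>x. \<Sum>i\<in>UNIV. axis i (f i x)) x"
    by (intro real_analytic_at_sum real_analytic_at_linear_compose[where L = "axis _"] assms)
  moreover have "(\<Sum>i\<in>UNIV. axis i (f i x)) = (\<chi> i. f i x)" for x
    by (simp add: vec_eq_iff axis_def)
  ultimately show ?thesis by simp
qed

lemma real_analytic_at_entry:
  fixes f :: "'a::real_normed_vector \<Rightarrow> real^'n^'m"
  shows "real_analytic_at f x \<Longrightarrow> real_analytic_at (\<lambda>x. f x $ i $ j) x"
  by (intro real_analytic_at_linear_compose[of "\<lambda>v. v $ j"] real_analytic_at_linear_compose[of "\<lambda>v. v $ i"])
    (auto intro: bounded_linear_vec_nth)

lemma real_analytic_at_det: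
  fixes f :: "'a::real_normed_vector \<Rightarrow> real^'n^'n"
  assumes "real_analytic_at f x"
  shows "real_analytic_at (\<lambda>x. det (f x)) x"
  unfolding det_def
  by (intro real_analytic_at_sum real_analytic_at_mult real_analytic_at_const real_analytic_at_prod real_analytic_at_entry assms)

lemma real_analytic_at_inverse:
  fixes f :: "'a::real_normed_vector \<Rightarrow> real"
  assumes "real_analytic_at f x" "f x \<noteq> 0"
  shows "real_analytic_at (\<lambda>x. inverse (f x)) x"
  by (rule real_analytic_at_compose[OF assms(1)], rule real_analytic_at_holomorphic[where g = inverse and S = "- {0}"])
    (use assms(2) in \<open>auto intro!: holomorphic_intros\<close>)

lemma real_analytic_at_powr:
  fixes f :: "'a::real_normed_vector \<Rightarrow> real"
  assumes "real_analytic_at f x" "f x > 0"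
  shows "real_analytic_at (\<lambda>x. f x powr c) x"
proof (rule real_analytic_at_compose[OF assms(1)], rule real_analytic_at_holomorphic[where g = "\<lambda>z. exp (of_real c * Ln z)" and S = "- \<real>\<^sub>\<le>\<^sub>0"])
  show "(\<lambda>z. exp (complex_of_real c * Ln z)) holomorphic_on - \<real>\<^sub>\<le>\<^sub>0"
    by (intro holomorphic_intros) auto
  fix y :: real assume "complex_of_real y \<in> - \<real>\<^sub>\<le>\<^sub>0"
  then have y: "y > 0" by simp
  then show "exp (complex_of_real c * Ln (complex_of_real y)) = complex_of_real (y powr c)"
    by (simp add: Ln_of_real powr_def exp_of_real[symmetric])
qed (use assms(2) in auto)

lemma open_det_nonzero: "open {X :: real^'n^'n. det X \<noteq> 0}"
proof -
  have "isCont (det :: real^'n^'n \<Rightarrow> real) X" for X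
    by (rule real_analytic_at_imp_isCont[OF real_analytic_at_det[OF real_analytic_at_ident]])
  then have "continuous_on UNIV (det :: real^'n^'n \<Rightarrow> real)" by (simp add: continuous_at_imp_continuous_on)
  then show ?thesis by (intro open_Collect_neq continuous_on_const)
qed

lemma real_analytic_at_matrix_inv:
  fixes f :: "'a::real_normed_vector \<Rightarrow> real^'n^'n"
  assumes "real_analytic_at f x" "invertible (f x)"
  shows "real_analytic_at (\<lambda>x. matrix_inv (f x)) x"
proof (rule real_analytic_at_compose[OF assms(1)])
  let ?h = "\<lambda>X :: real^'n^'n. \<chi> k j. det (\<chi> i l. if l = k then axis j 1 $ i else X $ i $ l) * inverse (det X)"
  have "det (f x) \<noteq> 0" using assms(2) by (simp add: invertible_det_nz)
  moreover have "real_analytic_at (\<lambda>X :: real^'n^'n. if l = k then axis j 1 $ i else X $ i $ l) (f x)" for i j k l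
    by (cases "l = k") (simp_all add: real_analytic_at_const real_analytic_at_entry[OF real_analytic_at_ident])
  ultimately have "real_analytic_at ?h (f x)"
    by (intro real_analytic_at_vec real_analytic_at_mult real_analytic_at_det real_analytic_at_inverse real_analytic_at_ident)
  then show "real_analytic_at matrix_inv (f x)"
  proof (rule real_analytic_at_cong[OF _ open_det_nonzero])
    fix X :: "real^'n^'n" assume "X \<in> {X. det X \<noteq> 0}"
    then have X: "det X \<noteq> 0" "invertible X" by (simp_all add: invertible_det_nz)
    have "matrix_inv X $ k $ j = ?h X $ k $ j" for k j
    proof -
      have "X *v column j (matrix_inv X) = column j (X ** matrix_inv X)"
        by (simp add: vec_eq_iff column_def matrix_vector_mult_def matrix_matrix_mult_def)
      also have "\<dots> = axis j 1"
        using X(2) by (simp add: matrix_inv_right vec_eq_iff column_def mat_def axis_def)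
      finally have "column j (matrix_inv X) = (\<chi> k. det (\<chi> i l. if l = k then axis j 1 $ i else X $ i $ l) / det X)"
        using cramer[OF X(1)] by blast
      then show ?thesis by (simp add: column_def vec_eq_iff divide_inverse)
    qed
    then show "?h X = matrix_inv X" by (simp add: vec_eq_iff)
  qed (use \<open>det (f x) \<noteq> 0\<close> in auto)
qed

text \<open>
  For a positive number \<open>\<lambda>\<close>, \<open>ln \<lambda>\<close> is the integral of \<open>(\<lambda> - 1) / (1 + t (\<lambda> - 1))\<close>. In contrast to a
  diagonalization, this formula is analytic in \<open>X\<close> and extends to nonsymmetric matrices.
\<close>

definition log_integral :: "real^'k^'k \<Rightarrow> real^'k^'k" where
  "log_integral X = integral {0..1} (\<lambda>t. (X - mat 1) ** matrix_inv (mat 1 + t *\<^sub>R (X - mat 1)))"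

lemma log_integrand_diag:
  fixes W :: "real^'k^'k"
  assumes W: "orth W" "\<And>i. l i > 0" and t: "t \<in> {0..1}"
  defines "P \<equiv> W ** diag_mat l ** transpose W"
  shows "invertible (mat 1 + t *\<^sub>R (P - mat 1))"
    "(P - mat 1) ** matrix_inv (mat 1 + t *\<^sub>R (P - mat 1)) = W ** diag_mat (\<lambda>i. (l i - 1) / (1 + t * (l i - 1))) ** transpose W"
    "1 + t * (l i - 1) > 0"
proof -
  have pos: "1 + t * (l i - 1) > 0" for i
  proof (cases "t = 0")
    case False
    then have "0 < t * l i" "1 - t \<ge> 0" using t W(2)[of i] by auto
    then show ?thesis by (simp add: algebra_simps)
  qed simp
  then show "1 + t * (l i - 1) > 0" .
  have nz: "1 + t * (l i - 1) \<noteq> 0" for i using pos[of i] by simp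
  have c: "transpose W ** W = mat 1" "W ** transpose W = mat 1" using W(1) by (auto simp: orth_def)
  have I: "mat 1 = W ** diag_mat (\<lambda>_. 1) ** transpose W" by (simp add: diag_mat_one c)
  have P1: "P - mat 1 = W ** diag_mat (\<lambda>i. l i - 1) ** transpose W"
    unfolding P_def diag_mat_diff[symmetric] by (subst I) (simp add: mm_bilinear)
  have M: "mat 1 + t *\<^sub>R (P - mat 1) = W ** diag_mat (\<lambda>i. 1 + t * (l i - 1)) ** transpose W"
    unfolding P1 diag_mat_add[symmetric] diag_mat_scaleR[symmetric] by (subst I) (simp add: mm_bilinear)
  have inv: "matrix_inv (mat 1 + t *\<^sub>R (P - mat 1)) = W ** diag_mat (\<lambda>i. 1 / (1 + t * (l i - 1))) ** transpose W"
    unfolding M using nz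
    by (intro matrix_inv_eqI) (simp_all add: matrix_mul_assoc[symmetric] matrix_cancel[OF c(1)],
        simp_all add: matrix_mul_assoc matrix_mul_assoc[symmetric, of W "diag_mat _" "diag_mat _"] diag_mat_mult diag_mat_one c)
  show "invertible (mat 1 + t *\<^sub>R (P - mat 1))"
    unfolding M using nz orth_invertible[OF W(1)] by (intro invertible_mult_rect invertible_diag_mat invertible_transpose)
  show "(P - mat 1) ** matrix_inv (mat 1 + t *\<^sub>R (P - mat 1)) = W ** diag_mat (\<lambda>i. (l i - 1) / (1 + t * (l i - 1))) ** transpose W"
    unfolding inv unfolding P1 by (simp add: matrix_mul_assoc[symmetric] matrix_cancel[OF c(1)])
      (simp add: matrix_mul_assoc matrix_mul_assoc[symmetric, of W "diag_mat _" "diag_mat _"] diag_mat_mult)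
qed

lemma log_integral_eq_mat_log:
  fixes P :: "real^'k^'k"
  assumes "P \<in> spd"
  shows "log_integral P = mat_log P"
proof -
  obtain W :: "real^'k^'k" and l where W: "orth W" "\<forall>i. l i > 0" and P: "P = W ** diag_mat l ** transpose W"
    using spd_diagonal[OF assms] by blast
  have li: "l i > 0" for i using W(2) by blast
  define E where "E i = W ** diag_mat (\<lambda>j. if j = i then 1 else 0) ** transpose W" for i
  have dE: "W ** diag_mat a ** transpose W = (\<Sum>i\<in>UNIV. a i *\<^sub>R E i)" for a
  proof -
    have "diag_mat a = (\<Sum>i\<in>UNIV. a i *\<^sub>R diag_mat (\<lambda>j. if j = i then 1 else 0))"
    proof -
      have "(\<Sum>i\<in>UNIV. a i *\<^sub>R diag_mat (\<lambda>j. if j = i then 1 else 0)) $ p $ q = diag_mat a $ p $ q" for p q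
      proof -
        have "a i * (if c then 1 else 0) = (if c then a i else 0)" for i c by simp
        then show ?thesis by (simp add: diag_mat_def)
      qed
      then show ?thesis by (simp add: vec_eq_iff)
    qed
    moreover have "linear (\<lambda>X. W ** X ** transpose W)"
      by (rule linearI) (simp_all add: mm_bilinear)
    note l = linear_sum[OF this] linear_scale[OF this]
    ultimately show ?thesis by (simp add: E_def l)
  qed
  have "((\<lambda>t. \<Sum>i\<in>UNIV. ((l i - 1) / (1 + t * (l i - 1))) *\<^sub>R E i) has_integral
      (\<Sum>i\<in>UNIV. ln (1 + 1 * (l i - 1)) *\<^sub>R E i) - (\<Sum>i\<in>UNIV. ln (1 + 0 * (l i - 1)) *\<^sub>R E i)) {0..1}"
  proof (rule fundamental_theorem_of_calculus)
    fix t :: real assume t: "t \<in> {0..1}"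
    have pos: "1 + t * (l i - 1) > 0" for i
      by (rule log_integrand_diag(3)[of W l t i]) (use W li t in auto)
    have "((\<lambda>t. ln (1 + t * (l i - 1))) has_real_derivative (l i - 1) / (1 + t * (l i - 1))) (at t within {0..1})" for i
      using pos[of i] by (auto intro!: derivative_eq_intros)
    then have "((\<lambda>t. ln (1 + t * (l i - 1)) *\<^sub>R E i) has_vector_derivative ((l i - 1) / (1 + t * (l i - 1))) *\<^sub>R E i) (at t within {0..1})" for i
      using has_vector_derivative_scaleR[where g = "\<lambda>t. E i" and g' = 0] by fastforce
    then show "((\<lambda>t. \<Sum>i\<in>UNIV. ln (1 + t * (l i - 1)) *\<^sub>R E i) has_vector_derivative (\<Sum>i\<in>UNIV. ((l i - 1) / (1 + t * (l i - 1))) *\<^sub>R E i)) (at t within {0..1})"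
      by (intro has_vector_derivative_sum)
  qed simp
  then have "((\<lambda>t. W ** diag_mat (\<lambda>i. (l i - 1) / (1 + t * (l i - 1))) ** transpose W) has_integral mat_log P) {0..1}"
    unfolding mat_log_eq[OF W(1) P] by (simp add: dE)
  then have "((\<lambda>t. (P - mat 1) ** matrix_inv (mat 1 + t *\<^sub>R (P - mat 1))) has_integral mat_log P) {0..1}"
    by (rule has_integral_eq[rotated]) (simp add: P log_integrand_diag(2)[OF W(1) li])
  then show ?thesis unfolding log_integral_def by (rule integral_unique)
qed

lemma real_analytic_at_log_integral:
  fixes P :: "real^'k^'k"
  assumes "P \<in> spd"
  shows "real_analytic_at log_integral P"
proof -
  obtain W :: "real^'k^'k" and l where W: "orth W" "\<forall>i. l i > 0" and P: "P = W ** diag_mat l ** transpose W"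
    using spd_diagonal[OF assms] by blast
  have li: "l i > 0" for i using W(2) by blast
  have inv: "invertible (mat 1 + t *\<^sub>R (P - mat 1))" if "t \<in> {0..1}" for t
    unfolding P by (rule log_integrand_diag(1)[OF W(1) _ that]) (rule li)
  have "real_analytic_at (\<lambda>p. (fst p - mat 1) ** matrix_inv (mat 1 + snd p *\<^sub>R (fst p - mat 1))) (P, t)" if t: "t \<in> {0..1}" for t
    using inv[OF t]
    by (intro real_analytic_at_matrix_mult real_analytic_at_matrix_inv real_analytic_at_add real_analytic_at_scaleR
        real_analytic_at_diff real_analytic_at_const real_analytic_at_linear bounded_linear_fst bounded_linear_snd) simp
  from real_analytic_at_integral[OF _ this]
  show ?thesis unfolding log_integral_def[abs_def] by simp
qed

text \<open>
  An extension of the squared radius to all matrices, analytic near the positive definite ones.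
\<close>

definition radius_sq :: "real^'k^'k \<Rightarrow> real" where
  "radius_sq X = log_integral X \<bullet> log_integral X"

lemma radius_sq_eq: "P \<in> spd \<Longrightarrow> radius_sq P = (radius P)\<^sup>2"
  by (simp add: radius_sq_def log_integral_eq_mat_log radius_eq_norm_log power2_norm_eq_inner)

lemma real_analytic_at_radius_sq: "P \<in> spd \<Longrightarrow> real_analytic_at radius_sq P"
  unfolding radius_sq_def[abs_def] by (intro real_analytic_at_inner real_analytic_at_log_integral)

lemma radius_nonneg: "radius P \<ge> 0"
  by (simp add: radius_def d_AI_nonneg)

lemma continuous_on_radius: "continuous_on spd radius"
proof -
  have "isCont radius_sq P" if "P \<in> spd" for P :: "real^'k^'k"
    using real_analytic_at_imp_isCont[OF real_analytic_at_radius_sq[OF that]] .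
  then have "continuous_on spd (\<lambda>P :: real^'k^'k. sqrt (radius_sq P))"
    by (intro continuous_intros continuous_at_imp_continuous_on) auto
  then show ?thesis
    by (rule continuous_on_eq) (simp add: radius_sq_eq radius_nonneg)
qed

section \<open>Topology of the positive definite matrices\<close>

lemma norm_matrix_vector_le: "norm (X *v v) \<le> norm X * norm v" for X :: "real^'n^'m"
proof -
  have "(norm (X *v v))\<^sup>2 = (\<Sum>i\<in>UNIV. (X $ i \<bullet> v)\<^sup>2)"
    unfolding power2_norm_eq_inner inner_vec_def[of "X *v v"] by (simp add: matrix_mult_dot power2_eq_square)
  also have "\<dots> \<le> (\<Sum>i\<in>UNIV. (norm (X $ i))\<^sup>2 * (norm v)\<^sup>2)"
    by (intro sum_mono) (metis Cauchy_Schwarz_ineq2 abs_ge_zero power2_abs power_mono power_mult_distrib)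
  also have "\<dots> = (norm X * norm v)\<^sup>2"
    unfolding power_mult_distrib sum_distrib_right[symmetric]
    by (simp only: power2_norm_eq_inner inner_vec_def[of X])
  finally show ?thesis by (rule power2_le_imp_le) simp
qed

text \<open>
  The quadratic form of \<open>P\<close> has a positive minimum \<open>e\<close> on the unit sphere, and that of \<open>X\<close> differs from it by
  less than \<open>e\<close>.
\<close>

lemma spd_neighbourhood:
  fixes P :: "real^'k^'k"
  assumes P: "P \<in> spd"
  shows "\<exists>e>0. \<forall>X. transpose X = X \<and> dist X P < e \<longrightarrow> X \<in> spd"
proof -
  have "compact (sphere (0 :: real^'k) 1)" by simp
  moreover have "axis undefined 1 \<in> sphere (0 :: real^'k) 1" by (simp add: norm_axis_1)
  then have "sphere (0 :: real^'k) 1 \<noteq> {}" by blast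
  moreover have "continuous_on (sphere 0 1) (\<lambda>x. x \<bullet> (P *v x))"
    by (intro continuous_intros linear_continuous_on) (simp add: matrix_vector_mul_bounded_linear)
  ultimately obtain z where z: "z \<in> sphere 0 1" "\<forall>x\<in>sphere 0 1. z \<bullet> (P *v z) \<le> x \<bullet> (P *v x)"
    using continuous_attains_inf by blast
  define e where "e = z \<bullet> (P *v z)"
  have "z \<noteq> 0" using z by auto
  then have "e > 0" using P by (simp add: spd_def e_def)
  moreover have "X \<in> spd" if X: "transpose X = X" "dist X P < e" for X
  proof -
    have "x \<bullet> (X *v x) > 0" if x: "x \<noteq> 0" for x
    proof -
      define y where "y = x /\<^sub>R norm x"
      have y: "norm y = 1" and xy: "x = norm x *\<^sub>R y" using x by (simp_all add: y_def)
      have "\<bar>y \<bullet> ((X - P) *v y)\<bar> \<le> norm y * (norm (X - P) * norm y)"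
        by (rule order_trans[OF Cauchy_Schwarz_ineq2 mult_left_mono[OF norm_matrix_vector_le]]) simp
      also have "\<dots> < e" using X y by (simp add: dist_norm)
      finally have "\<bar>y \<bullet> ((X - P) *v y)\<bar> < e" .
      moreover have "e \<le> y \<bullet> (P *v y)" using z y by (simp add: e_def)
      moreover have "y \<bullet> (X *v y) = y \<bullet> (P *v y) + y \<bullet> ((X - P) *v y)"
        by (simp add: matrix_vector_mult_diff_rdistrib inner_diff_right)
      ultimately have "y \<bullet> (X *v y) > 0" by linarith
      moreover have "x \<bullet> (X *v x) = (norm x)\<^sup>2 * (y \<bullet> (X *v y))"
      proof -
        have "X *v x = norm x *\<^sub>R (X *v y)" by (subst xy) (simp add: matrix_vector_mult_scaleR)
        then show ?thesis by (subst xy) (simp add: power2_eq_square)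
      qed
      ultimately show ?thesis using x by simp
    qed
    then show ?thesis using X by (simp add: spd_def)
  qed
  ultimately show ?thesis by blast
qed

definition sym_part :: "real^'k^'k \<Rightarrow> real^'k^'k" where
  "sym_part X = (1 / 2) *\<^sub>R (X + transpose X)"

lemma bounded_linear_sym_part: "bounded_linear sym_part"
  unfolding sym_part_def[abs_def]
  by (intro bounded_linear_compose[OF bounded_linear_scaleR_right] bounded_linear_add bounded_linear_ident bounded_linear_transpose)

lemma transpose_sym_part: "transpose (sym_part X) = sym_part X"
  by (simp add: sym_part_def transpose_scalar linear_add[OF linear_transpose] add.commute)

lemma sym_part_ident: "transpose X = X \<Longrightarrow> sym_part X = X"
  by (simp add: sym_part_def vec_eq_iff)

lemma sym_part_spd_neighbourhood:
  fixes P :: "real^'k^'k"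
  assumes P: "P \<in> spd"
  shows "\<exists>V. open V \<and> P \<in> V \<and> (\<forall>X\<in>V. sym_part X \<in> spd)"
proof -
  obtain e where e: "e > 0" "\<And>X. transpose X = X \<Longrightarrow> dist X P < e \<Longrightarrow> X \<in> spd"
    using spd_neighbourhood[OF P] by blast
  have "open (sym_part -` ball P e)"
    using bounded_linear_sym_part by (intro open_vimage linear_continuous_on) auto
  then show ?thesis
    using e P by (intro exI[of _ "sym_part -` ball P e"]) (auto simp: sym_part_ident spd_sym transpose_sym_part dist_commute)
qed

text \<open>
  A positive semidefinite matrix without zero eigenvalue is positive definite. The conditions on the right are
  closed.
\<close>

lemma spd1_eq: "spd1 = {P :: real^'k^'k. transpose P = P \<and> (\<forall>x. x \<bullet> (P *v x) \<ge> 0) \<and> det P = 1}"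
proof (intro equalityI subsetI)
  fix P :: "real^'k^'k" assume "P \<in> spd1"
  then have P: "P \<in> spd" "det P = 1" by (auto simp: spd1_def)
  have "x \<bullet> (P *v x) \<ge> 0" for x
    using P(1) by (cases "x = 0") (auto simp: spd_def less_imp_le)
  then show "P \<in> {P. transpose P = P \<and> (\<forall>x. x \<bullet> (P *v x) \<ge> 0) \<and> det P = 1}"
    using P by (simp add: spd_sym)
next
  fix P :: "real^'k^'k" assume "P \<in> {P. transpose P = P \<and> (\<forall>x. x \<bullet> (P *v x) \<ge> 0) \<and> det P = 1}"
  then have P: "transpose P = P" "\<And>x. x \<bullet> (P *v x) \<ge> 0" "det P = 1" by auto
  obtain W l where W: "orthogonal_matrix W" "P = W ** diag_mat l ** transpose W" using spectral_theorem[OF P(1)] by blast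
  have oW: "orth W" using W by (simp add: orth_square)
  have "l i \<ge> 0" for i
  proof -
    have e: "transpose W *v (W *v axis i 1) = axis i 1"
      using oW unfolding matrix_vector_mul_assoc orth_def by simp
    have "(\<Sum>j\<in>UNIV. l j * (axis i 1 $ j)\<^sup>2) \<ge> 0"
      using P(2)[of "W *v axis i 1"] unfolding W(2) inner_congruence e inner_diag_mat .
    moreover have "(\<Sum>j\<in>UNIV. l j * (axis i 1 $ j)\<^sup>2) = (\<Sum>j\<in>UNIV. if j = i then l j else 0)"
      by (intro sum.cong) (auto simp: axis_def)
    ultimately show ?thesis by simp
  qed
  moreover have "det W * det W * (\<Prod>i\<in>UNIV. l i) = 1"
    using P(3) by (simp add: W(2) det_mul det_transpose det_diag_mat mult_ac)
  then have "l i \<noteq> 0" for i using prod_zero[of UNIV l] by fastforce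
  ultimately have "l i > 0" for i by (simp add: order_less_le)
  then have "P \<in> spd" unfolding W(2) by (intro spd_conj_diag orth_invertible oW)
  then show "P \<in> spd1" using P by (simp add: spd1_def)
qed

lemma closed_spd1: "closed (spd1 :: (real^'k^'k) set)"
proof -
  have 1: "closed {P :: real^'k^'k. transpose P = P}"
    by (intro closed_Collect_eq linear_continuous_on bounded_linear_transpose continuous_on_id)
  have 2: "closed {P :: real^'k^'k. x \<bullet> (P *v x) \<ge> 0}" for x
  proof -
    have "linear (\<lambda>P :: real^'k^'k. x \<bullet> (P *v x))"
      by (rule linearI) (simp_all add: matrix_vector_mult_add_rdistrib inner_add_right scaleR_matrix_vector_assoc[symmetric])
    then show ?thesis
      by (intro closed_Collect_le linear_continuous_on continuous_on_const) (simp add: linear_conv_bounded_linear)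
  qed
  have "isCont (det :: real^'k^'k \<Rightarrow> real) X" for X
    by (rule real_analytic_at_imp_isCont[OF real_analytic_at_det[OF real_analytic_at_ident]])
  then have "continuous_on UNIV (det :: real^'k^'k \<Rightarrow> real)" by (simp add: continuous_at_imp_continuous_on)
  then have 3: "closed {P :: real^'k^'k. det P = 1}" by (intro closed_Collect_eq continuous_on_const)
  have *: "spd1 = {P :: real^'k^'k. transpose P = P} \<inter> (\<Inter>x. {P. x \<bullet> (P *v x) \<ge> 0}) \<inter> {P. det P = 1}"
    unfolding spd1_eq by auto
  show ?thesis unfolding * by (intro closed_Int closed_INT ballI 1 2 3)
qed

lemma spd1_spd: "P \<in> spd1 \<Longrightarrow> P \<in> spd"
  by (simp add: spd1_def)

lemma spd_eigenvalue_bound: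
  fixes W :: "real^'k^'k"
  assumes W: "orth W" "\<forall>i. l i > 0" "P = W ** diag_mat l ** transpose W" and r: "radius P \<le> c"
  shows "l i \<le> exp c"
proof -
  have P: "P \<in> spd" unfolding W(3) using W by (intro spd_conj_diag orth_invertible) auto
  have "(ln (l i))\<^sup>2 \<le> (\<Sum>i\<in>UNIV. (ln (l i))\<^sup>2)" by (intro member_le_sum) auto
  also have "\<dots> = (radius P)\<^sup>2" unfolding radius_eq_norm_log[OF P] norm_mat_log[OF W(1,3)] ..
  finally have "\<bar>ln (l i)\<bar> \<le> radius P" by (simp add: abs_le_square_iff[symmetric] radius_nonneg)
  then have "ln (l i) \<le> c" using r by linarith
  then show ?thesis using W(2) by (metis exp_le_cancel_iff exp_ln)
qed

text \<open>
  A bound on the radius bounds the logarithms of the eigenvalues.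
\<close>

theorem compact_radius_ball: "compact {P :: real^'k^'k. P \<in> spd1 \<and> radius P \<le> c}"
proof -
  have "closed (spd1 \<inter> radius -` {..c} :: (real^'k^'k) set)"
    by (intro continuous_closed_preimage continuous_on_subset[OF continuous_on_radius] closed_spd1) (auto simp: spd1_spd)
  moreover have "norm P \<le> sqrt (real CARD('k) * (exp c)\<^sup>2)" if P: "P \<in> spd1" "radius P \<le> c" for P :: "real^'k^'k"
  proof (rule real_le_rsqrt)
    obtain W :: "real^'k^'k" and l where W: "orth W" "\<forall>i. l i > 0" "P = W ** diag_mat l ** transpose W"
      using spd_diagonal[OF spd1_spd[OF P(1)]] by blast
    have "(norm P)\<^sup>2 = (\<Sum>i\<in>UNIV. (l i)\<^sup>2)" unfolding W(3) norm_orth_conj[OF W(1)] norm_diag_mat ..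
    also have "\<dots> \<le> (\<Sum>i\<in>(UNIV :: 'k set). (exp c)\<^sup>2)"
      using spd_eigenvalue_bound[OF W P(2)] W(2) by (intro sum_mono power_mono) (auto intro: less_imp_le)
    finally show "(norm P)\<^sup>2 \<le> real CARD('k) * (exp c)\<^sup>2" by simp
  qed
  then have "bounded (spd1 \<inter> radius -` {..c} :: (real^'k^'k) set)" by (auto simp: bounded_iff)
  ultimately have "compact (spd1 \<inter> radius -` {..c} :: (real^'k^'k) set)" by (simp add: compact_eq_bounded_closed)
  moreover have "spd1 \<inter> radius -` {..c} = {P :: real^'k^'k. P \<in> spd1 \<and> radius P \<le> c}" by auto
  ultimately show ?thesis by simp
qed

text \<open>
  On numbers up to \<open>c\<close>, \<open>exp\<close> has Lipschitz constant \<open>exp c\<close>; this transfers to matrices by \<open>spectral_lipschitz\<close>, and the logarithm does not increase distances.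
\<close>

lemma norm_diff_le_d_AI:
  fixes P P' :: "real^'k^'k"
  assumes P: "P \<in> spd" "radius P \<le> c" and P': "P' \<in> spd" "radius P' \<le> c"
  shows "norm (P - P') \<le> exp c * d_AI P P'"
proof -
  obtain W :: "real^'k^'k" and a where W: "orth W" "\<forall>i. a i > 0" "P = W ** diag_mat a ** transpose W"
    using spd_diagonal[OF P(1)] by blast
  obtain V :: "real^'k^'k" and b where V: "orth V" "\<forall>i. b i > 0" "P' = V ** diag_mat b ** transpose V"
    using spd_diagonal[OF P'(1)] by blast
  have lip: "x - y \<le> exp c * (ln x - ln y)" if "0 < y" "y \<le> x" "x \<le> exp c" for x y :: real
  proof -
    have "1 - y / x \<le> - ln (y / x)" using ln_le_minus_one[of "y / x"] that by simp
    then have "x * (1 - y / x) \<le> x * (ln x - ln y)" using that by (intro mult_left_mono) (auto simp: ln_div)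
    also have "\<dots> \<le> exp c * (ln x - ln y)" using that by (intro mult_right_mono) auto
    finally show ?thesis using that by (simp add: right_diff_distrib)
  qed
  have "\<bar>a j - b i\<bar> \<le> exp c * \<bar>ln (a j) - ln (b i)\<bar>" for i j
  proof -
    have *: "a j > 0" "b i > 0" "a j \<le> exp c" "b i \<le> exp c"
      using spd_eigenvalue_bound[OF W P(2)] spd_eigenvalue_bound[OF V P'(2)] W(2) V(2) by auto
    then show ?thesis
      using lip[of "a j" "b i"] lip[of "b i" "a j"] by (cases "a j \<le> b i") (auto simp: abs_if not_le)
  qed
  then have "norm (P - P') \<le> exp c * norm (mat_log P - mat_log P')"
    unfolding mat_log_eq[OF W(1,3)] mat_log_eq[OF V(1,3)] unfolding W(3) V(3)
    by (intro spectral_lipschitz[OF W(1) V(1), where f = "\<lambda>x. x"]) auto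
  also have "\<dots> \<le> exp c * d_AI P P'"
    by (intro mult_left_mono log_distance_le_d_AI P P') auto
  finally show ?thesis .
qed

section \<open>Block matrices\<close>

lemma sum_UNIV_Plus: "(\<Sum>x\<in>(UNIV :: ('m::finite + 'n::finite) set). f x) = (\<Sum>a\<in>UNIV. f (Inl a)) + (\<Sum>b\<in>UNIV. f (Inr b))"
  by (subst UNIV_Plus_UNIV[symmetric], subst sum.Plus) auto

lemma hcat_mult_vcat: "hcat X Y ** vcat Z W = X ** Z + Y ** W"
  by (simp add: vec_eq_iff matrix_matrix_mult_def hcat_def vcat_def sum_UNIV_Plus)

lemma mult_hcat: "Z ** hcat X Y = hcat (Z ** X) (Z ** Y)"
  by (simp add: vec_eq_iff matrix_matrix_mult_def hcat_def split: sum.split)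

lemma vcat_mult: "vcat X Y ** Z = vcat (X ** Z) (Y ** Z)"
  by (simp add: vec_eq_iff matrix_matrix_mult_def vcat_def split: sum.split)

lemma transpose_hcat: "transpose (hcat X Y) = vcat (transpose X) (transpose Y)"
  by (simp add: vec_eq_iff transpose_def hcat_def vcat_def split: sum.split)

lemma transpose_vcat: "transpose (vcat X Y) = hcat (transpose X) (transpose Y)"
  by (simp add: vec_eq_iff transpose_def hcat_def vcat_def split: sum.split)

lemma vcat_hcat: "vcat (hcat X Y) (hcat Z W) = hcat (vcat X Z) (vcat Y W)"
  by (simp add: vec_eq_iff hcat_def vcat_def split: sum.split)

lemma hcat_mult_block: "hcat X Y ** block_mat a b c d = hcat (X ** a + Y ** c) (X ** b + Y ** d)"
  unfolding block_mat_def vcat_hcat mult_hcat hcat_mult_vcat ..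

lemma block_mult_block:
  "block_mat a b c d ** block_mat a' b' c' d' =
    block_mat (a ** a' + b ** c') (a ** b' + b ** d') (c ** a' + d ** c') (c ** b' + d ** d')"
  unfolding block_mat_def[of a b c d] vcat_mult hcat_mult_block unfolding block_mat_def ..

lemma transpose_block: "transpose (block_mat a b c d) = block_mat (transpose a) (transpose c) (transpose b) (transpose d)"
  by (simp add: block_mat_def transpose_vcat transpose_hcat vcat_hcat)

lemma block_mat_one: "block_mat (mat 1) 0 0 (mat 1) = mat 1"
  by (simp add: vec_eq_iff block_mat_def hcat_def vcat_def mat_def split: sum.split)

lemma block_mat_eq_iff: "block_mat a b c d = block_mat a' b' c' d' \<longleftrightarrow> a = a' \<and> b = b' \<and> c = c' \<and> d = d'"
proof
  assume "block_mat a b c d = block_mat a' b' c' d'"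
  then have *: "block_mat a b c d $ i $ j = block_mat a' b' c' d' $ i $ j" for i j by simp
  show "a = a' \<and> b = b' \<and> c = c' \<and> d = d'"
    using *[of "Inl _" "Inl _"] *[of "Inl _" "Inr _"] *[of "Inr _" "Inl _"] *[of "Inr _" "Inr _"]
    by (simp add: vec_eq_iff block_mat_def hcat_def vcat_def)
qed simp

lemma transpose_zero: "transpose (0 :: real^'n^'m) = 0"
  by (simp add: transpose_def vec_eq_iff)

lemma block_diag_diag: "block_mat (diag_mat a) 0 0 (diag_mat b) = diag_mat (case_sum a b)"
  by (simp add: vec_eq_iff block_mat_def hcat_def vcat_def diag_mat_def split: sum.split)

lemma hcat_block_diag: "hcat X Y ** block_mat M 0 0 S ** transpose (hcat X Y) = X ** M ** transpose X + Y ** S ** transpose Y"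
  by (simp add: hcat_mult_block transpose_hcat hcat_mult_vcat mm_bilinear)

lemma block_conj_diag:
  "block_mat (W ** diag_mat a ** transpose W) 0 0 (V ** diag_mat b ** transpose V) =
     block_mat W 0 0 V ** diag_mat (case_sum a b) ** transpose (block_mat W 0 0 V)"
  by (simp add: transpose_block transpose_zero block_mult_block mm_bilinear block_diag_diag[symmetric])

lemma orth_block: "orth W \<Longrightarrow> orth V \<Longrightarrow> orth (block_mat W 0 0 V)"
  for W :: "real^'m^'m" and V :: "real^'n^'n"
  by (simp add: orth_def transpose_block transpose_zero block_mult_block mm_bilinear block_mat_one)

lemma invertible_block_diag:
  fixes W :: "real^'m^'m" and V :: "real^'n^'n"
  assumes "invertible W" "invertible V" shows "invertible (block_mat W 0 0 V)"
  by (rule invertibleI[of _ "block_mat (matrix_inv W) 0 0 (matrix_inv V)"])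
    (simp_all add: assms block_mult_block mm_bilinear block_mat_one matrix_inv_left matrix_inv_right)

lemma matrix_inv_block_diag:
  fixes W :: "real^'m^'m" and V :: "real^'n^'n"
  assumes "invertible W" "invertible V"
  shows "matrix_inv (block_mat W 0 0 V) = block_mat (matrix_inv W) 0 0 (matrix_inv V)"
  by (rule matrix_inv_eqI)
    (simp_all add: assms block_mult_block mm_bilinear block_mat_one matrix_inv_left matrix_inv_right)

lemma block_diag_spd:
  fixes M :: "real^'m^'m" and S :: "real^'n^'n"
  assumes "M \<in> spd" "S \<in> spd"
  shows "block_mat M 0 0 S \<in> spd"
proof -
  obtain W :: "real^'m^'m" and a where W: "orth W" "\<forall>i. a i > 0" "M = W ** diag_mat a ** transpose W"
    using spd_diagonal[OF assms(1)] by blast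
  obtain V :: "real^'n^'n" and b where V: "orth V" "\<forall>i. b i > 0" "S = V ** diag_mat b ** transpose V"
    using spd_diagonal[OF assms(2)] by blast
  show ?thesis
    unfolding W(3) V(3) block_conj_diag using W V
    by (intro spd_conj_diag orth_invertible orth_block) (auto split: sum.split)
qed

text \<open>
  The determinant of a matrix with one index type is compared with a diagonal matrix of another index type. The
  logarithm of the determinant is the trace of the logarithm, and the trace of a product does not see the index
  types.
\<close>

lemma det_eq_prod_eigenvalues:
  fixes W :: "real^'k^'d" and P :: "real^'d^'d"
  assumes W: "orth W" and l: "\<And>i. l i > 0" and P: "P = W ** diag_mat l ** transpose W"
  shows "det P = (\<Prod>i\<in>UNIV. l i)"
proof -
  have ex: "P \<in> spd" unfolding P using W l by (intro spd_conj_diag orth_invertible)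
  obtain V :: "real^'d^'d" and b where V: "orth V" "\<forall>i. b i > 0" "P = V ** diag_mat b ** transpose V"
    using spd_diagonal[OF ex] by blast
  have tr: "trace (Z ** diag_mat c ** transpose Z) = (\<Sum>i\<in>UNIV. c i)" if "orth Z" for Z :: "real^'l^'d" and c
    using that by (subst trace_mult_commute) (simp add: matrix_mul_assoc orth_def trace_diag_mat)
  have "det V * det V = 1"
    using V(1) det_mul[of V "transpose V"] by (simp add: orth_def det_transpose)
  then have d: "det P = (\<Prod>i\<in>UNIV. b i)"
    unfolding V(3) det_mul det_transpose det_diag_mat by (simp add: algebra_simps)
  have "(\<Sum>i\<in>UNIV. ln (b i)) = (\<Sum>i\<in>UNIV. ln (l i))"
    using tr[OF W, of "\<lambda>i. ln (l i)"] tr[OF V(1), of "\<lambda>i. ln (b i)"] mat_log_eq[OF W P] mat_log_eq[OF V(1,3)] by simp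
  then have "ln (\<Prod>i\<in>UNIV. b i) = ln (\<Prod>i\<in>UNIV. l i)"
    using V(2)[rule_format, THEN less_imp_neq] l[THEN less_imp_neq] by (subst (1 2) ln_prod) auto
  moreover have "(\<Prod>i\<in>UNIV. b i) > 0" "(\<Prod>i\<in>UNIV. l i) > 0" using V(2) l by (auto intro: prod_pos)
  ultimately show ?thesis unfolding d by (metis exp_ln)
qed

lemma det_spd_pos:
  fixes P :: "real^'k^'k"
  assumes "P \<in> spd" shows "det P > 0"
proof -
  obtain W :: "real^'k^'k" and l where W: "orth W" "\<forall>i. l i > 0" "P = W ** diag_mat l ** transpose W"
    using spd_diagonal[OF assms] by blast
  show ?thesis using det_eq_prod_eigenvalues[OF W(1) _ W(3)] W(2) by (auto intro: prod_pos)
qed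

lemma det_orth_conj:
  fixes Q :: "real^'k^'d"
  assumes "orth Q" "P \<in> spd"
  shows "det (Q ** P ** transpose Q) = det P"
proof -
  obtain W :: "real^'k^'k" and l where W: "orth W" "\<forall>i. l i > 0" "P = W ** diag_mat l ** transpose W"
    using spd_diagonal[OF assms(2)] by blast
  have "det (Q ** P ** transpose Q) = (\<Prod>i\<in>UNIV. l i)"
    by (rule det_eq_prod_eigenvalues[of "Q ** W"]) (use W assms in \<open>auto simp: orth_mult matrix_transpose_mul matrix_mul_assoc\<close>)
  then show ?thesis using det_eq_prod_eigenvalues[OF W(1) _ W(3)] W(2) by simp
qed

lemma det_block_diag:
  fixes M :: "real^'m^'m" and S :: "real^'n^'n"
  assumes "M \<in> spd" "S \<in> spd"
  shows "det (block_mat M 0 0 S) = det M * det S"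
proof -
  obtain W :: "real^'m^'m" and a where W: "orth W" "\<forall>i. a i > 0" "M = W ** diag_mat a ** transpose W"
    using spd_diagonal[OF assms(1)] by blast
  obtain V :: "real^'n^'n" and b where V: "orth V" "\<forall>i. b i > 0" "S = V ** diag_mat b ** transpose V"
    using spd_diagonal[OF assms(2)] by blast
  have "det (block_mat M 0 0 S) = (\<Prod>i\<in>UNIV. case_sum a b i)"
    by (rule det_eq_prod_eigenvalues[OF orth_block[OF W(1) V(1)]]) (use W V in \<open>auto simp: block_conj_diag split: sum.split\<close>)
  also have "\<dots> = (\<Prod>i\<in>UNIV. a i) * (\<Prod>i\<in>UNIV. b i)"
    by (subst UNIV_Plus_UNIV[symmetric], subst prod.Plus) auto
  finally show ?thesis using det_eq_prod_eigenvalues[OF W(1) _ W(3)] det_eq_prod_eigenvalues[OF V(1) _ V(3)] W(2) V(2) by simp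
qed

lemma det_scaleR_matrix: "det (c *\<^sub>R S) = c ^ CARD('n) * det S" for S :: "real^'n^'n"
proof -
  have "c *\<^sub>R S = diag_mat (\<lambda>_. c) ** S" by (simp add: vec_eq_iff diag_mat_mult_left)
  then show ?thesis by (simp add: det_mul det_diag_mat)
qed

text \<open>
  Conjugation by a diagonal matrix doubles \<open>T\<close>, and so does squaring. So the determinant is equal to its square,
  and it is not zero.
\<close>

lemma det_unipotent: "det (block_mat (mat 1) 0 T (mat 1)) = 1" for T :: "real^'m^'n"
proof -
  let ?L = "\<lambda>T :: real^'m^'n. block_mat (mat 1) 0 T (mat 1) :: real^('m + 'n)^('m + 'n)"
  let ?D = "\<lambda>c :: real. block_mat (mat 1) 0 0 (c *\<^sub>R mat 1) :: real^('m + 'n)^('m + 'n)"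
  have conj: "?D c ** ?L T ** ?D (1 / c) = ?L (c *\<^sub>R T)" "?D c ** ?D (1 / c) = mat 1" if "c \<noteq> 0" for c
    using that by (simp_all add: block_mult_block mm_bilinear block_mat_one)
  have "?L T ** ?L T = ?L (2 *\<^sub>R T)"
    unfolding scaleR_2 by (simp add: block_mult_block mm_bilinear)
  then have "?D 2 ** ?L T ** ?D (1 / 2) = ?L T ** ?L T"
    using conj(1)[of 2] by simp
  then have "det (?L T) * det (?L T) = det (?D 2) * det (?L T) * det (?D (1 / 2))"
    by (simp only: det_mul[symmetric])
  moreover have "det (?D 2) * det (?D (1 / 2)) = 1"
    using conj(2)[of 2] by (simp only: det_mul[symmetric] det_I)
  ultimately have "det (?L T) * det (?L T) = det (?L T)" by algebra
  moreover have "?L T ** ?L (- T) = mat 1"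
    by (simp add: block_mult_block mm_bilinear block_mat_one)
  then have "det (?L T) * det (?L (- T)) = 1" by (simp only: det_mul[symmetric] det_I)
  then have "det (?L T) \<noteq> 0" by auto
  ultimately show ?thesis by simp
qed

section \<open>The trivialization\<close>

lemma spd_compress:
  fixes K :: "real^'k^'d" and X :: "real^'d^'d"
  assumes "X \<in> spd" "J ** K = mat 1"
  shows "transpose K ** X ** K \<in> spd"
proof -
  have "transpose (transpose K ** X ** K) = transpose K ** X ** K"
    using assms(1) by (simp add: spd_def matrix_transpose_mul matrix_mul_assoc)
  moreover have "x \<bullet> ((transpose K ** X ** K) *v x) > 0" if "x \<noteq> 0" for x
  proof -
    have "J *v (K *v x) = x" by (simp add: matrix_vector_mul_assoc assms(2))
    then have "K *v x \<noteq> 0" using that by (metis matrix_vector_mult_0_right)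
    then show ?thesis using inner_congruence[of x "transpose K" X] assms(1) by (simp add: spd_def)
  qed
  ultimately show ?thesis by (simp add: spd_def)
qed

lemma scaleR_spd:
  assumes "P \<in> spd" "c > 0" shows "c *\<^sub>R P \<in> spd"
  using assms by (simp add: spd_def transpose_scalar scaleR_matrix_vector_assoc[symmetric])

definition unit_det :: "real^'n^'n \<Rightarrow> real^'n^'n" where
  "unit_det Y = det Y powr (- 1 / real CARD('n)) *\<^sub>R Y"

lemma powr_inverse_power:
  assumes "d > 0" shows "(d powr - (1 / real CARD('n::finite))) ^ CARD('n) = inverse d"
proof -
  have "(d powr - (1 / real CARD('n))) ^ CARD('n) = d powr (- (1 / real CARD('n)) * real CARD('n))"
    using assms by (simp only: powr_powr[symmetric] powr_realpow[symmetric] powr_gt_zero)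
  also have "- (1 / real CARD('n)) * real CARD('n) = - 1" by simp
  finally show ?thesis using assms by (simp add: powr_minus)
qed

lemma unit_det_spd1: "Y \<in> spd \<Longrightarrow> unit_det Y \<in> spd1" for Y :: "real^'n^'n"
  using det_spd_pos[of Y]
  by (simp add: unit_det_def spd1_def scaleR_spd det_scaleR_matrix powr_inverse_power[where 'n = 'n])

lemma unit_det_scaleR:
  fixes S :: "real^'n^'n"
  assumes "S \<in> spd1" "c > 0" shows "unit_det (c *\<^sub>R S) = S"
proof -
  have "det (c *\<^sub>R S) = c powr (real CARD('n))"
    using assms by (simp add: spd1_def det_scaleR_matrix powr_realpow)
  then have "det (c *\<^sub>R S) powr (- 1 / real CARD('n)) = 1 / c"
    using assms(2) by (simp add: powr_powr powr_minus divide_inverse)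
  then show ?thesis using assms(2) by (simp add: unit_det_def)
qed

lemmas analytic_intros = real_analytic_at_matrix_mult real_analytic_at_const real_analytic_at_ident
  real_analytic_at_add real_analytic_at_diff real_analytic_at_scaleR real_analytic_at_matrix_inv real_analytic_at_powr real_analytic_at_det

lemma real_analytic_at_unit_det:
  fixes f :: "'x::real_normed_vector \<Rightarrow> real^'k^'k"
  assumes "real_analytic_at f x" "f x \<in> spd"
  shows "real_analytic_at (\<lambda>x. unit_det (f x)) x"
  unfolding unit_det_def using assms det_spd_pos by (intro analytic_intros) auto

lemma real_analytic_on_cong: "(\<And>x. x \<in> S \<Longrightarrow> f x = g x) \<Longrightarrow> real_analytic_on f S \<longleftrightarrow> real_analytic_on g S"
  by (simp add: real_analytic_on_def)

lemma analytic_diffeo_inverse: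
  assumes "analytic_diffeo S S' f" shows "analytic_diffeo S' S (inv_into S f)"
proof -
  have bij: "bij_betw f S S'" using assms by (simp add: analytic_diffeo_def)
  have "inv_into S' (inv_into S f) x = f x" if "x \<in> S" for x
    using inv_into_inv_into_eq[OF bij that] .
  then have "real_analytic_on (inv_into S' (inv_into S f)) S"
    using real_analytic_on_cong[of S "inv_into S' (inv_into S f)" f] assms by (simp add: analytic_diffeo_def)
  then show ?thesis using assms bij_betw_inv_into[OF bij] by (simp add: analytic_diffeo_def)
qed

locale qr_frame =
  fixes A U :: "real^'m^'d" and C :: "real^'m^'m" and V :: "real^'n^'d"
  assumes qr: "thin_qr_completion A U C V"
begin

lemma A_eq: "A = U ** C" and C: "invertible C" and UU: "transpose U ** U = mat 1" and orth_UV: "orth (hcat U V)"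
  using qr by (auto simp: thin_qr_completion_def orth_def)

lemma frame: "transpose V ** V = mat 1" "transpose U ** V = 0" "transpose V ** U = 0"
  "U ** transpose U + V ** transpose V = mat 1"
proof -
  have "transpose (hcat U V) ** hcat U V = block_mat (transpose U ** U) (transpose U ** V) (transpose V ** U) (transpose V ** V)"
    by (simp add: transpose_hcat vcat_mult mult_hcat block_mat_def vcat_hcat)
  then show "transpose V ** V = mat 1" "transpose U ** V = 0" "transpose V ** U = 0"
    using orth_UV by (simp_all add: orth_def block_mat_one[symmetric] block_mat_eq_iff)
  show "U ** transpose U + V ** transpose V = mat 1"
    using orth_UV by (simp add: orth_def transpose_hcat hcat_mult_vcat)
qed

lemma C_cancel: "C ** matrix_inv C = mat 1" "matrix_inv C ** C = mat 1"
  "transpose (matrix_inv C) ** transpose C = mat 1" "transpose C ** transpose (matrix_inv C) = mat 1"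
  using C by (simp_all add: matrix_inv_left matrix_inv_right matrix_transpose_mul[symmetric])

abbreviation "M \<equiv> M_part A C"
abbreviation "N \<equiv> N_part C V"
abbreviation "T \<equiv> T_part A C V"

lemma M_eq: "M B = transpose U ** B ** matrix_inv C"
  by (simp add: M_part_def A_eq matrix_transpose_mul matrix_mul_assoc C_cancel)

lemma M_spd: "B \<in> base A \<Longrightarrow> M B \<in> spd"
  using congruence_spd[of "transpose (matrix_inv C)" "transpose A ** B"] C
  by (simp add: base_def M_part_def matrix_mul_assoc invertible_transpose invertible_matrix_inv)

lemma decompose: "(U ** M B + V ** N B) ** C = B"
proof -
  have "U ** M B + V ** N B = (U ** transpose U + V ** transpose V) ** (B ** matrix_inv C)"
    by (simp add: M_eq N_part_def mm_bilinear matrix_mul_assoc)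
  then show ?thesis by (simp add: frame matrix_mul_assoc[symmetric] C_cancel)
qed

lemma assemble_base:
  assumes "X \<in> spd"
  shows "(U ** X + V ** Y) ** C \<in> base A" "M ((U ** X + V ** Y) ** C) = X" "N ((U ** X + V ** Y) ** C) = Y"
proof -
  have "transpose A ** ((U ** X + V ** Y) ** C) = transpose C ** X ** transpose (transpose C)"
    by (simp add: A_eq matrix_transpose_mul mm_bilinear matrix_mul_assoc[symmetric] matrix_cancel[OF UU])
      (simp add: matrix_mul_assoc frame mm_bilinear)
  then show "(U ** X + V ** Y) ** C \<in> base A"
    using congruence_spd[OF invertible_transpose[OF C] assms] by (simp add: base_def)
  show "M ((U ** X + V ** Y) ** C) = X" "N ((U ** X + V ** Y) ** C) = Y"
    by (simp_all add: M_eq N_part_def mm_bilinear matrix_mul_assoc UU frame)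
      (simp_all add: matrix_mul_assoc[symmetric] C_cancel)
qed

lemma T_M: "B \<in> base A \<Longrightarrow> T B ** M B = N B"
  by (simp add: T_part_def matrix_mul_assoc[symmetric] matrix_inv_left spd_invertible M_spd)

text \<open>
  The matrix with Schur complement \<open>S\<close> and first block column given by \<open>X\<close> and \<open>Y X\<close>. With \<open>S = \<rho> \<Sigma>\<close> it is \<open>\<Phi>\<close>.
\<close>

definition glue :: "real^'m^'m \<Rightarrow> real^'m^'n \<Rightarrow> real^'n^'n \<Rightarrow> real^'d^'d" where
  "glue X Y S = (U + V ** Y) ** X ** transpose (U + V ** Y) + V ** S ** transpose V"

lemma glue_eq: "glue X Y S = hcat U V ** block_mat (mat 1) 0 Y (mat 1) ** block_mat X 0 0 S **
    transpose (hcat U V ** block_mat (mat 1) 0 Y (mat 1))"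
proof -
  have "hcat U V ** block_mat (mat 1) 0 Y (mat 1) = hcat (U + V ** Y) V"
    by (simp add: hcat_mult_block mm_bilinear)
  then show ?thesis by (simp only: hcat_block_diag glue_def)
qed

lemma frame_invertible: "invertible (hcat U V ** block_mat (mat 1) 0 Y (mat 1))"
  by (intro invertible_mult_rect orth_invertible orth_UV invertibleI[of _ "block_mat (mat 1) 0 (- Y) (mat 1)"])
    (simp_all add: block_mult_block mm_bilinear block_mat_one)

lemma glue_spd: "X \<in> spd \<Longrightarrow> S \<in> spd \<Longrightarrow> glue X Y S \<in> spd"
  unfolding glue_eq by (intro congruence_spd frame_invertible block_diag_spd)

lemma det_glue:
  assumes "X \<in> spd" "S \<in> spd"
  shows "det (glue X Y S) = det X * det S"
proof -
  let ?L = "block_mat (mat 1) 0 Y (mat 1)" and ?D = "block_mat X 0 0 S"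
  have D: "?D \<in> spd" using assms by (rule block_diag_spd)
  have L: "invertible ?L"
    by (rule invertibleI[of _ "block_mat (mat 1) 0 (- Y) (mat 1)"]) (simp_all add: block_mult_block mm_bilinear block_mat_one)
  have "glue X Y S = hcat U V ** (?L ** ?D ** transpose ?L) ** transpose (hcat U V)"
    by (simp add: glue_eq matrix_transpose_mul matrix_mul_assoc)
  then have "det (glue X Y S) = det (?L ** ?D ** transpose ?L)"
    using det_orth_conj[OF orth_UV congruence_spd[OF L D]] by simp
  also have "\<dots> = det ?D" by (simp add: det_mul det_transpose det_unipotent)
  also have "\<dots> = det X * det S" using assms by (rule det_block_diag)
  finally show ?thesis .
qed

lemma glue_blocks:
  "glue X Y S ** U = U ** X + V ** (Y ** X)"
  "transpose U ** glue X Y S ** U = X"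
  "transpose V ** glue X Y S ** U = Y ** X"
  "transpose V ** glue X Y S ** V = Y ** X ** transpose Y + S"
proof -
  have t: "transpose (U + V ** Y) ** U = mat 1" "transpose (U + V ** Y) ** V = transpose Y"
    "transpose V ** (U + V ** Y) = Y" "transpose U ** (U + V ** Y) = mat 1"
    by (simp_all add: linear_add[OF linear_transpose] matrix_transpose_mul mm_bilinear UU frame matrix_mul_assoc[symmetric])
      (simp_all add: matrix_mul_assoc UU frame mm_bilinear)
  have 1: "glue X Y S ** U = (U + V ** Y) ** X" and 2: "glue X Y S ** V = (U + V ** Y) ** X ** transpose Y + V ** S"
    unfolding glue_def by (simp_all only: mm_bilinear matrix_mul_assoc[symmetric] t frame matrix_mul_rid add_0_right add.right_neutral)
  show "glue X Y S ** U = U ** X + V ** (Y ** X)" by (simp add: 1 mm_bilinear matrix_mul_assoc)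
  show "transpose U ** glue X Y S ** U = X" "transpose V ** glue X Y S ** U = Y ** X"
    by (simp_all only: matrix_mul_assoc[symmetric] 1) (simp_all only: matrix_mul_assoc t matrix_mul_lid)
  show "transpose V ** glue X Y S ** V = Y ** X ** transpose Y + S"
    by (simp only: matrix_mul_assoc[symmetric] 2 mm_bilinear) (simp add: matrix_mul_assoc t frame mm_bilinear)
qed

lemma Phi_eq_glue: "Phi A U C V (B, \<Sigma>) = glue (M B) (T B) (rho TYPE('n) A C B *\<^sub>R \<Sigma>)"
  by (simp add: Phi_def glue_eq L_part_def matrix_transpose_mul matrix_mul_assoc)

lemma rho_pos: "B \<in> base A \<Longrightarrow> rho TYPE('n) A C B > 0"
  by (drule M_spd, drule det_spd_pos) (simp add: rho_def)

lemma Phi_spd1: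
  assumes "B \<in> base A" "\<Sigma> \<in> spd1"
  shows "Phi A U C V (B, \<Sigma>) \<in> spd1"
proof -
  have S: "rho TYPE('n) A C B *\<^sub>R \<Sigma> \<in> spd" using assms by (intro scaleR_spd rho_pos spd1_spd)
  have "det (rho TYPE('n) A C B *\<^sub>R \<Sigma>) = inverse (det (M B))"
    using det_spd_pos[OF M_spd[OF assms(1)]] assms(2)
    by (simp add: det_scaleR_matrix rho_def powr_inverse_power[where 'n = 'n] spd1_def)
  then show ?thesis
    using det_spd_pos[OF M_spd[OF assms(1)]] glue_spd[OF M_spd[OF assms(1)] S] det_glue[OF M_spd[OF assms(1)] S]
    by (simp add: spd1_def Phi_eq_glue)
qed

lemma act_Phi: "B \<in> base A \<Longrightarrow> act A (Phi A U C V (B, \<Sigma>)) = B"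
  unfolding act_def Phi_eq_glue
  by (subst A_eq) (simp add: matrix_mul_assoc glue_blocks T_M decompose)

definition schur :: "real^'d^'d \<Rightarrow> real^'n^'n" where
  "schur X = transpose V ** X ** V - transpose V ** X ** U ** matrix_inv (transpose U ** X ** U) ** transpose U ** X ** V"

text \<open>
  The inverse of \<open>\<Phi>\<close> on the determinant-one matrices.
\<close>

definition Psi :: "real^'d^'d \<Rightarrow> (real^'m^'d) \<times> (real^'n^'n)" where
  "Psi X = (X ** A, unit_det (schur X))"

lemma schur_glue:
  assumes "X \<in> spd" "S \<in> spd" shows "schur (glue X Y S) = S"
proof -
  have "transpose (transpose V ** glue X Y S ** U) = transpose (Y ** X)" by (simp only: glue_blocks)
  then have "transpose U ** glue X Y S ** V = X ** transpose Y"
    using assms by (simp add: matrix_transpose_mul spd_sym glue_spd matrix_mul_assoc)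
  then have u: "transpose U ** (glue X Y S ** V) = X ** transpose Y" by (simp add: matrix_mul_assoc)
  have "Y ** X ** matrix_inv X ** transpose U ** glue X Y S ** V = Y ** X ** transpose Y"
    using assms by (simp add: matrix_mul_assoc[symmetric] u matrix_cancel matrix_inv_right matrix_inv_left spd_invertible)
  then show ?thesis unfolding schur_def glue_blocks by simp
qed

lemma Psi_Phi:
  assumes "B \<in> base A" "\<Sigma> \<in> spd1"
  shows "Psi (Phi A U C V (B, \<Sigma>)) = (B, \<Sigma>)"
proof -
  have "rho TYPE('n) A C B *\<^sub>R \<Sigma> \<in> spd" using assms by (intro scaleR_spd rho_pos spd1_spd)
  then have "schur (Phi A U C V (B, \<Sigma>)) = rho TYPE('n) A C B *\<^sub>R \<Sigma>"
    unfolding Phi_eq_glue using assms by (intro schur_glue M_spd)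
  then show ?thesis
    using act_Phi[OF assms(1)] unit_det_scaleR[OF assms(2) rho_pos[OF assms(1)]] by (simp add: Psi_def act_def)
qed

lemma act_base:
  assumes "X \<in> spd" shows "X ** A \<in> base A" "M (X ** A) = transpose U ** X ** U" "N (X ** A) = transpose V ** X ** U"
proof -
  have "matrix_inv C ** transpose U ** A = mat 1"
    by (simp add: A_eq matrix_mul_assoc[symmetric] matrix_cancel[OF UU] C_cancel)
  from spd_compress[OF assms this] show "X ** A \<in> base A" by (simp add: base_def matrix_mul_assoc)
  show "M (X ** A) = transpose U ** X ** U" "N (X ** A) = transpose V ** X ** U"
    unfolding M_eq N_part_def by (simp_all add: A_eq matrix_mul_assoc[symmetric] C_cancel)
qed

text \<open>
  The Schur complement is \<open>K\<^sup>T X K\<close> for the injective matrix \<open>K = V - U M\<^sup>-\<^sup>1 N\<^sup>T\<close>.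
\<close>

lemma schur_spd:
  assumes X: "X \<in> spd" shows "schur X \<in> spd"
proof -
  let ?M = "transpose U ** X ** U"
  have M: "?M \<in> spd" by (rule spd_compress[OF X UU])
  have iM: "transpose (matrix_inv ?M) = matrix_inv ?M"
    using M by (metis spd_invertible spd_sym transpose_matrix_inv)
  have c: "matrix_inv ?M ** ?M = mat 1" using M by (simp add: matrix_inv_left spd_invertible)
  define R where "R = matrix_inv ?M ** (transpose U ** X ** V)"
  have tR: "transpose R = transpose V ** X ** U ** matrix_inv ?M"
    by (simp add: R_def matrix_transpose_mul iM spd_sym[OF X] matrix_mul_assoc)
  have "transpose R ** (transpose U ** X ** U ** R) = transpose V ** X ** U ** (matrix_inv ?M ** ?M) ** R"
    by (simp add: tR matrix_mul_assoc)
  then have e: "transpose R ** (transpose U ** X ** U ** R) = transpose V ** X ** U ** R" unfolding c by simp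
  have e2: "transpose R ** (transpose U ** X ** V) = transpose V ** X ** U ** R"
    unfolding tR by (simp add: R_def matrix_mul_assoc)
  define K where "K = V - U ** R"
  have "transpose K ** X ** K = transpose V ** X ** V - transpose V ** X ** U ** R"
    using e e2 by (simp add: K_def linear_diff[OF linear_transpose] matrix_transpose_mul mm_bilinear matrix_mul_assoc)
  then have "schur X = transpose K ** X ** K"
    by (simp add: schur_def R_def matrix_mul_assoc)
  moreover have "transpose V ** K = mat 1"
    by (simp add: K_def mm_bilinear frame matrix_mul_assoc)
  ultimately show ?thesis using spd_compress[OF X] by simp
qed

text \<open>
  Expanding \<open>(U + V T) M (U + V T)\<^sup>T\<close> gives three of the four blocks of \<open>X\<close>; the Schur complement is what is missing
  in the fourth.
\<close>

lemma glue_schur: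
  assumes X: "X \<in> spd" shows "glue (M (X ** A)) (T (X ** A)) (schur X) = X"
proof -
  let ?M = "transpose U ** X ** U" and ?N = "transpose V ** X ** U"
  have M: "?M \<in> spd" by (rule spd_compress[OF X UU])
  have iM: "transpose (matrix_inv ?M) = matrix_inv ?M"
    using M by (metis spd_invertible spd_sym transpose_matrix_inv)
  have c: "matrix_inv ?M ** ?M = mat 1" "?M ** matrix_inv ?M = mat 1" using M by (simp_all add: matrix_inv_left matrix_inv_right spd_invertible)
  have tN: "transpose ?N = transpose U ** X ** V"
    by (simp add: matrix_transpose_mul spd_sym[OF X] matrix_mul_assoc)
  let ?T = "?N ** matrix_inv ?M"
  have T: "T (X ** A) = ?T" by (simp add: T_part_def act_base[OF X])
  have TM: "?T ** ?M = ?N" unfolding matrix_mul_assoc[symmetric, of ?N "matrix_inv ?M" ?M] c by simp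
  have tT: "transpose ?T = matrix_inv ?M ** transpose ?N" by (simp add: matrix_transpose_mul iM)
  have MT: "?M ** transpose ?T = transpose ?N" by (simp only: tT matrix_mul_assoc c matrix_mul_lid)
  have NT: "?N ** transpose ?T = ?T ** transpose ?N" by (simp only: tT matrix_mul_assoc)
  have exp: "(U + V ** t) ** m ** transpose (U + V ** t) =
     U ** m ** transpose U + U ** (m ** transpose t) ** transpose V + V ** (t ** m) ** transpose U + V ** (t ** m ** transpose t) ** transpose V"
    for t :: "real^'m^'n" and m :: "real^'m^'m"
    by (simp add: linear_add[OF linear_transpose] matrix_transpose_mul mm_bilinear matrix_mul_assoc add_ac)
  have "(U + V ** ?T) ** ?M ** transpose (U + V ** ?T) =
     U ** ?M ** transpose U + U ** (?M ** transpose ?T) ** transpose V + V ** (?T ** ?M) ** transpose U + V ** (?T ** ?M ** transpose ?T) ** transpose V"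
    by (rule exp)
  also have "\<dots> = U ** ?M ** transpose U + U ** transpose ?N ** transpose V + V ** ?N ** transpose U + V ** (?T ** transpose ?N) ** transpose V"
    unfolding TM MT NT ..
  finally have 1: "(U + V ** ?T) ** ?M ** transpose (U + V ** ?T) = \<dots>" .
  have sc: "schur X = transpose V ** X ** V - ?T ** transpose ?N"
    unfolding schur_def tN by (simp add: matrix_mul_assoc)
  have "glue (M (X ** A)) (T (X ** A)) (schur X) =
     U ** ?M ** transpose U + U ** transpose ?N ** transpose V + V ** ?N ** transpose U + V ** (transpose V ** X ** V) ** transpose V"
    unfolding glue_def T act_base(2)[OF X] 1 unfolding sc by (simp add: mm_bilinear)
  also have "\<dots> = (U ** transpose U + V ** transpose V) ** X ** (U ** transpose U + V ** transpose V)"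
    unfolding tN by (simp add: mm_bilinear matrix_mul_assoc add_ac)
  finally show ?thesis by (simp add: frame)
qed

text \<open>
  The determinants of the first block and of the Schur complement have product one, so \<open>\<rho>\<close> undoes the
  normalization of the Schur complement.
\<close>

lemma Phi_Psi:
  assumes X: "X \<in> spd1" shows "Phi A U C V (Psi X) = X"
proof -
  have X': "X \<in> spd" using X by (rule spd1_spd)
  note B = act_base(1)[OF X']
  have "det (M (X ** A)) * det (schur X) = 1"
    using det_glue[OF M_spd[OF B] schur_spd[OF X'], of "T (X ** A)"] glue_schur[OF X'] X by (simp add: spd1_def)
  then have "rho TYPE('n) A C (X ** A) * (det (schur X) powr (- 1 / real CARD('n))) = 1"
    using det_spd_pos[OF M_spd[OF B]] det_spd_pos[OF schur_spd[OF X']]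
    by (simp add: rho_def powr_mult[symmetric])
  then have "rho TYPE('n) A C (X ** A) *\<^sub>R unit_det (schur X) = schur X" by (simp add: unit_det_def)
  then show ?thesis by (simp add: Psi_def Phi_eq_glue glue_schur[OF X'])
qed

lemma Psi_mem: "X \<in> spd \<Longrightarrow> Psi X \<in> base A \<times> spd1"
  by (simp add: Psi_def act_base unit_det_spd1 schur_spd)

lemma Phi_bij: "bij_betw (Phi A U C V) (base A \<times> spd1) spd1"
proof (rule bij_betw_byWitness[where f' = Psi])
  show "\<forall>p\<in>base A \<times> spd1. Psi (Phi A U C V p) = p" using Psi_Phi by auto
  show "\<forall>X\<in>spd1. Phi A U C V (Psi X) = X" using Phi_Psi by blast
  show "Phi A U C V ` (base A \<times> spd1) \<subseteq> spd1" using Phi_spd1 by auto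
  show "Psi ` spd1 \<subseteq> base A \<times> spd1" using Psi_mem spd1_spd by blast
qed

lemma real_analytic_at_schur:
  fixes f :: "'x::real_normed_vector \<Rightarrow> real^'d^'d"
  assumes "real_analytic_at f x" "f x \<in> spd"
  shows "real_analytic_at (\<lambda>x. schur (f x)) x"
  unfolding schur_def using assms by (intro analytic_intros spd_invertible spd_compress[OF _ UU])

lemma real_analytic_at_Phi:
  fixes f :: "'x::real_normed_vector \<Rightarrow> real^'m^'d" and g :: "'x \<Rightarrow> real^'n^'n"
  assumes f: "real_analytic_at f x" "f x \<in> base A" and g: "real_analytic_at g x"
  shows "real_analytic_at (\<lambda>x. Phi A U C V (f x, g x)) x"
proof -
  have M: "real_analytic_at (\<lambda>x. M (f x)) x" unfolding M_part_def by (intro analytic_intros f)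
  have N: "real_analytic_at (\<lambda>x. N (f x)) x" unfolding N_part_def by (intro analytic_intros f)
  have T: "real_analytic_at (\<lambda>x. T (f x)) x"
    unfolding T_part_def by (intro analytic_intros M N spd_invertible M_spd f)
  have r: "real_analytic_at (\<lambda>x. rho TYPE('n) A C (f x)) x"
    unfolding rho_def by (intro analytic_intros M det_spd_pos M_spd f)
  have t: "real_analytic_at (\<lambda>x. transpose (h x)) x" if "real_analytic_at h x" for h :: "'x \<Rightarrow> real^'p^'q"
    using that by (rule real_analytic_at_linear_compose[OF bounded_linear_transpose])
  show ?thesis
    unfolding Phi_eq_glue glue_def by (intro analytic_intros t M N T r g)
qed

theorem Phi_diffeo: "analytic_diffeo (base A \<times> spd1) spd1 (Phi A U C V)"
  unfolding analytic_diffeo_def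
proof (intro conjI Phi_bij real_analytic_onI)
  fix p assume p: "p \<in> base A \<times> (spd1 :: (real^'n^'n) set)"
  have "real_analytic_at (\<lambda>p. Phi A U C V (fst p, snd p)) p"
    using p by (intro real_analytic_at_Phi real_analytic_at_linear bounded_linear_fst bounded_linear_snd) auto
  then show "\<exists>g W. real_analytic_at g p \<and> open W \<and> p \<in> W \<and> (\<forall>y\<in>(base A \<times> spd1) \<inter> W. Phi A U C V y = g y)"
    by (intro exI[of _ "\<lambda>p. Phi A U C V (fst p, snd p)"] exI[of _ UNIV]) auto
next
  fix X :: "real^'d^'d" assume X: "X \<in> spd1"
  have "real_analytic_at Psi X"
    unfolding Psi_def[abs_def] using X
    by (intro real_analytic_at_Pair analytic_intros real_analytic_at_unit_det real_analytic_at_schur schur_spd spd1_spd)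
  moreover have "inv_into (base A \<times> spd1) (Phi A U C V) Y = Psi Y" if "Y \<in> spd1" for Y
    using Psi_mem[OF spd1_spd[OF that]] Phi_Psi[OF that] Phi_bij
    by (intro inv_into_f_eq) (auto simp: bij_betw_def)
  ultimately show "\<exists>g W. real_analytic_at g X \<and> open W \<and> X \<in> W \<and> (\<forall>y\<in>spd1 \<inter> W. inv_into (base A \<times> spd1) (Phi A U C V) y = g y)"
    by (intro exI[of _ Psi] exI[of _ UNIV]) auto
qed

theorem spd1_diffeomorphic: "analytically_diffeomorphic (spd1 :: (real^'d^'d) set) (base A \<times> (spd1 :: (real^'n^'n) set))"
  unfolding analytically_diffeomorphic_def using analytic_diffeo_inverse[OF Phi_diffeo] by blast

theorem base_diffeomorphic: "analytically_diffeomorphic (base A) ((spd :: (real^'m^'m) set) \<times> (UNIV :: (real^'m^'n) set))"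
proof -
  let ?f = "\<lambda>B. (M B, N B)" and ?g = "\<lambda>(X, Y). (U ** X + V ** Y) ** C"
  have bij: "bij_betw ?f (base A) (spd \<times> UNIV)"
    by (rule bij_betw_byWitness[where f' = ?g]) (auto simp: decompose assemble_base M_spd)
  have f: "real_analytic_at ?f B" for B
    unfolding M_part_def N_part_def by (intro real_analytic_at_Pair analytic_intros)
  have g: "real_analytic_at ?g p" for p
    unfolding split_beta by (intro analytic_intros real_analytic_at_linear bounded_linear_fst bounded_linear_snd)
  have inv: "inv_into (base A) ?f p = ?g p" if "p \<in> spd \<times> UNIV" for p
    using that bij by (intro inv_into_f_eq) (auto simp: bij_betw_def assemble_base)
  have "analytic_diffeo (base A) (spd \<times> UNIV) ?f"
    unfolding analytic_diffeo_def
  proof (intro conjI bij real_analytic_onI)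
    fix B
    show "\<exists>g W. real_analytic_at g B \<and> open W \<and> B \<in> W \<and> (\<forall>y\<in>base A \<inter> W. ?f y = g y)"
      using f by (intro exI[of _ ?f] exI[of _ UNIV]) auto
  next
    fix p
    show "\<exists>g W. real_analytic_at g p \<and> open W \<and> p \<in> W \<and> (\<forall>y\<in>(spd \<times> UNIV) \<inter> W. inv_into (base A) ?f y = g y)"
      using g inv by (intro exI[of _ ?g] exI[of _ UNIV]) auto
  qed
  then show ?thesis unfolding analytically_diffeomorphic_def by blast
qed

end

text \<open>
  The polar decomposition of \<open>A\<close> provides \<open>U\<close> and \<open>C\<close>. The columns of \<open>V\<close> are the eigenvectors of the projection
  \<open>U U\<^sup>T\<close> for the eigenvalue zero; the trace of the projection counts the others.
\<close>

lemma thin_qr_completion_exists: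
  fixes A :: "real^'m^'d"
  assumes "CARD('m) < CARD('d)" "CARD('n::finite) = CARD('d) - CARD('m)" "rank A = CARD('m)"
  shows "\<exists>U C (V :: real^'n^'d). thin_qr_completion A U C V"
proof -
  have "inj ((*v) A)" using assms(3) full_rank_injective[of A] by simp
  then obtain J where J: "J ** A = mat 1" using matrix_left_invertible_injective[of A] by (metis)
  have "transpose A ** A \<in> spd"
    using spd_compress[OF mat_1_spd J] by simp
  then obtain C where C: "C \<in> spd" "invertible C" "C ** C = transpose A ** A" using spd_sqrt by metis
  define U where "U = A ** matrix_inv C"
  have AC: "A = U ** C" by (simp add: U_def matrix_mul_assoc[symmetric] matrix_inv_left[OF C(2)])
  have tC: "transpose (matrix_inv C) = matrix_inv C" using C by (metis spd_sym transpose_matrix_inv)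
  have "transpose U ** U = matrix_inv C ** (transpose A ** A) ** matrix_inv C"
    by (simp add: U_def matrix_transpose_mul tC matrix_mul_assoc)
  then have UU: "transpose U ** U = mat 1"
    unfolding C(3)[symmetric] using C(2) by (simp add: matrix_mul_assoc[symmetric] matrix_inv_left matrix_cancel matrix_inv_right)
  define P where "P = U ** transpose U"
  have "transpose P = P" by (simp add: P_def matrix_transpose_mul)
  from spectral_theorem[OF this] obtain W l where W: "orthogonal_matrix W" "P = W ** diag_mat l ** transpose W" by blast
  have c: "transpose W ** W = mat 1" "W ** transpose W = mat 1" using W(1) by (auto simp: orthogonal_matrix_def)
  have PP: "P ** P = P" by (simp add: P_def matrix_mul_assoc[symmetric] matrix_cancel[OF UU])
  have D: "diag_mat l = transpose W ** P ** W"
    unfolding W(2) by (simp add: matrix_mul_assoc[symmetric] c matrix_cancel[OF c(1)])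
  have "diag_mat l ** diag_mat l = transpose W ** (P ** P) ** W"
    unfolding D by (simp add: matrix_mul_assoc[symmetric] matrix_cancel[OF c(2)])
  then have "diag_mat (\<lambda>i. l i * l i) = diag_mat l" unfolding PP D[symmetric] diag_mat_mult .
  then have "diag_mat (\<lambda>i. l i * l i) $ i $ i = diag_mat l $ i $ i" for i by simp
  then have "l i * l i = l i" for i by (simp add: diag_mat_def)
  then have l01: "l i = 0 \<or> l i = 1" for i by (metis mult_cancel_right1)
  have "trace P = real CARD('m)"
    using trace_mult_commute[of U "transpose U"] by (simp add: P_def UU trace_def mat_def)
  moreover have "trace P = (\<Sum>i\<in>UNIV. l i)"
    unfolding W(2) by (subst trace_mult_commute) (simp add: matrix_mul_assoc c trace_diag_mat)
  moreover have "(\<Sum>i\<in>UNIV. l i) = (\<Sum>i\<in>UNIV. if i \<in> {i. l i = 1} then 1 else 0)"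
    using l01 by (intro sum.cong) auto
  ultimately have "card {i. l i = 1} = CARD('m)"
    by (simp add: sum.If_cases)
  moreover have "{i. l i = 0} = UNIV - {i. l i = 1}" using l01 by auto
  ultimately have "card {i. l i = 0} = CARD('n)"
    using assms by (simp add: card_Diff_subset)
  then obtain h where h: "bij_betw h (UNIV :: 'n set) {i. l i = 0}"
    using finite_same_card_bij[of "UNIV :: 'n set" "{i. l i = 0}"] by auto
  define V :: "real^'n^'d" where "V = (\<chi> i k. W $ i $ h k)"
  have hi: "h i = h j \<longleftrightarrow> i = j" for i j using h by (auto simp: bij_betw_def inj_on_def)
  have VV: "transpose V ** V = mat 1"
  proof -
    have "(transpose V ** V) $ i $ j = (transpose W ** W) $ h i $ h j" for i j
      by (simp add: matrix_matrix_mult_def transpose_def V_def)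
    then show ?thesis unfolding c vec_eq_iff by (simp add: mat_def hi)
  qed
  have z: "1 - l k = 0" if "l k \<noteq> 0" for k using l01[of k] that by simp
  have VVt: "V ** transpose V = mat 1 - P"
  proof -
    have "mat 1 - P = W ** diag_mat (\<lambda>i. 1 - l i) ** transpose W"
      unfolding W(2) diag_mat_diff[symmetric] by (simp add: mm_bilinear diag_mat_one c)
    moreover have "(W ** diag_mat (\<lambda>i. 1 - l i) ** transpose W) $ i $ j = (V ** transpose V) $ i $ j" for i j
    proof -
      have "(W ** diag_mat (\<lambda>i. 1 - l i) ** transpose W) $ i $ j = (\<Sum>k\<in>UNIV. (W ** diag_mat (\<lambda>i. 1 - l i)) $ i $ k * W $ j $ k)"
        by (subst matrix_matrix_mult_def) (simp add: transpose_def)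
      also have "\<dots> = (\<Sum>k\<in>UNIV. W $ i $ k * (1 - l k) * W $ j $ k)"
        by (simp add: diag_mat_mult_right)
      also have "\<dots> = (\<Sum>k\<in>{k. l k = 0}. W $ i $ k * W $ j $ k)"
        using z by (intro sum.mono_neutral_cong_right) auto
      also have "\<dots> = (\<Sum>k\<in>UNIV. W $ i $ h k * W $ j $ h k)"
        by (rule sum.reindex_bij_betw[OF h, symmetric])
      finally show ?thesis by (simp add: matrix_matrix_mult_def transpose_def V_def)
    qed
    ultimately show ?thesis by (simp add: vec_eq_iff)
  qed
  have "P ** V = (mat 1 - V ** transpose V) ** V" unfolding VVt by simp
  also have "\<dots> = 0" by (simp add: mm_bilinear matrix_mul_assoc[symmetric] VV)
  finally have "transpose U ** (P ** V) = 0" by (simp add: mm_bilinear)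
  then have UV: "transpose U ** V = 0" by (simp add: P_def matrix_mul_assoc[symmetric] matrix_cancel[OF UU])
  then have VU: "transpose V ** U = 0"
    by (metis matrix_transpose_mul transpose_transpose transpose_zero)
  have "thin_qr_completion A U C V"
    unfolding thin_qr_completion_def
    using AC UU C(2) by (simp add: transpose_hcat hcat_mult_vcat VVt P_def vcat_mult mult_hcat UV VU VV block_mat_one[symmetric] block_mat_def vcat_hcat)
  then show ?thesis by blast
qed

section \<open>The fibers as isometric copies of the determinant-one cone\<close>

lemma airm_congruence:
  fixes G :: "real^'k^'d" and P :: "real^'k^'k"
  assumes G: "invertible G" and P: "invertible P"
  shows "airm (G ** P ** transpose G) (G ** X ** transpose G) (G ** Y ** transpose G) = airm P X Y"
proof -
  have c: "matrix_inv G ** G = mat 1" "transpose G ** transpose (matrix_inv G) = mat 1"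
    using G by (simp_all add: matrix_inv_left matrix_transpose_mul[symmetric])
  have inv: "matrix_inv (G ** P ** transpose G) = transpose (matrix_inv G) ** matrix_inv P ** matrix_inv G"
    using G P by (simp add: matrix_inv_mult invertible_mult_rect invertible_transpose transpose_matrix_inv matrix_mul_assoc)
  have "matrix_inv (G ** P ** transpose G) ** (G ** X ** transpose G) ** matrix_inv (G ** P ** transpose G) ** (G ** Y ** transpose G)
     = transpose (matrix_inv G) ** (matrix_inv P ** X ** matrix_inv P ** Y ** transpose G)"
    unfolding inv by (simp add: matrix_mul_assoc[symmetric] matrix_cancel c)
  then show ?thesis
    unfolding airm_def by (simp add: trace_mult_commute[of "transpose (matrix_inv G)"] matrix_mul_assoc[symmetric] c)
qed

lemma trace_block: "trace (block_mat a b c d) = trace a + trace d"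
  by (simp add: trace_def sum_UNIV_Plus block_mat_def hcat_def vcat_def)

lemma airm_block:
  fixes M :: "real^'m^'m" and S :: "real^'n^'n"
  assumes "invertible M" "invertible S"
  shows "airm (block_mat M 0 0 S) (block_mat 0 0 0 X) (block_mat 0 0 0 Y) = airm S X Y"
  by (simp add: airm_def matrix_inv_block_diag[OF assms] block_mult_block mm_bilinear trace_block linear_0[OF linear_trace])

lemma matrix_inv_scaleR: "invertible P \<Longrightarrow> c \<noteq> 0 \<Longrightarrow> matrix_inv (c *\<^sub>R P) = (1 / c) *\<^sub>R matrix_inv P"
  for P :: "real^'k^'k"
  by (rule matrix_inv_eqI) (simp_all add: mm_bilinear matrix_inv_left matrix_inv_right)

lemma airm_scaleR: "invertible P \<Longrightarrow> c \<noteq> 0 \<Longrightarrow> airm (c *\<^sub>R P) (c *\<^sub>R X) (c *\<^sub>R Y) = airm P X Y"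
  for P :: "real^'k^'k"
  by (simp add: airm_def matrix_inv_scaleR mm_bilinear)

lemma d_AI_block:
  fixes M :: "real^'m^'m" and S :: "real^'n^'n"
  assumes M: "M \<in> spd" and S: "S \<in> spd" "S' \<in> spd"
  shows "d_AI (block_mat M 0 0 S) (block_mat M 0 0 S') = d_AI S S'"
proof -
  obtain Y where Y: "Y \<in> spd" "invertible Y" "Y ** Y = M" using spd_sqrt[OF M] by blast
  obtain Z :: "real^'n^'n" and l where Z: "invertible Z" "\<forall>i. l i > 0" "S = Z ** transpose Z" "S' = Z ** diag_mat l ** transpose Z"
    using spd_factor[OF S] by blast
  let ?W = "block_mat Y 0 0 Z"
  have YY: "Y ** transpose Y = M" using Y by (simp add: spd_sym)
  have "d_AI (block_mat M 0 0 S) (block_mat M 0 0 S') = sqrt (\<Sum>i\<in>UNIV. (ln (case_sum (\<lambda>_ :: 'm. 1) l i))\<^sup>2)"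
  proof (rule d_AI_factor[where Z = ?W and l = "case_sum (\<lambda>_ :: 'm. 1) l"])
    show "invertible ?W" using Y Z by (intro invertible_block_diag)
    show "block_mat M 0 0 S = ?W ** transpose ?W"
      by (simp add: transpose_block transpose_zero block_mult_block mm_bilinear YY Z(3))
    show "block_mat M 0 0 S' = ?W ** diag_mat (case_sum (\<lambda>_ :: 'm. 1) l) ** transpose ?W"
      unfolding block_conj_diag[symmetric] by (simp add: diag_mat_one YY Z(4))
  qed (use Z in \<open>auto split: sum.split\<close>)
  also have "\<dots> = d_AI S S'"
    using d_AI_factor[OF Z(1) _ Z(3,4)] Z(2) by (simp add: sum_UNIV_Plus)
  finally show ?thesis .
qed

lemma d_AI_scaleR:
  fixes P :: "real^'k^'k"
  assumes "c > 0" "P \<in> spd" "P' \<in> spd"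
  shows "d_AI (c *\<^sub>R P) (c *\<^sub>R P') = d_AI P P'"
proof -
  let ?G = "diag_mat (\<lambda>_. sqrt c) :: real^'k^'k"
  have "?G ** X ** transpose ?G = c *\<^sub>R X" for X
    using assms(1) by (simp add: vec_eq_iff transpose_diag_mat diag_mat_mult_left diag_mat_mult_right)
  moreover have "invertible ?G" using assms(1) by (intro invertible_diag_mat) auto
  ultimately show ?thesis using d_AI_congruence[of ?G P P'] assms by simp
qed

lemma closedin_fiber: "closedin (top_of_set spd1) (fiber A B)"
proof -
  have "bounded_linear (\<lambda>P. P ** A)"
    by (rule bounded_bilinear.bounded_linear_left[OF bounded_bilinear_matrix_mult])
  then have "closed {P. P ** A = B}"
    by (intro closed_Collect_eq linear_continuous_on continuous_on_const)
  moreover have "fiber A B = spd1 \<inter> {P. P ** A = B}" by (auto simp: fiber_def act_def)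
  ultimately show ?thesis by (simp add: closedin_closed_Int)
qed

context qr_frame
begin

lemma fiber_eq: "B \<in> base A \<Longrightarrow> fiber A B = (\<lambda>\<Sigma>. Phi A U C V (B, \<Sigma>)) ` spd1"
proof (intro equalityI subsetI)
  fix X assume "X \<in> fiber A B" and B: "B \<in> base A"
  then have X: "X \<in> spd1" "X ** A = B" by (auto simp: fiber_def act_def)
  then have "X = Phi A U C V (B, unit_det (schur X))" using Phi_Psi[OF X(1)] by (simp add: Psi_def)
  moreover have "unit_det (schur X) \<in> spd1" using X by (intro unit_det_spd1 schur_spd spd1_spd)
  ultimately show "X \<in> (\<lambda>\<Sigma>. Phi A U C V (B, \<Sigma>)) ` spd1" by blast
qed (auto simp: fiber_def Phi_spd1 act_Phi)

lemma fiber_nonempty: "B \<in> base A \<Longrightarrow> fiber A B \<noteq> {}"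
proof -
  have "mat 1 \<in> (spd1 :: (real^'n^'n) set)" by (simp add: spd1_def mat_1_spd)
  then show "B \<in> base A \<Longrightarrow> fiber A B \<noteq> {}" unfolding fiber_eq by blast
qed

text \<open>
  On the fiber \<open>f \<Sigma> = G (M \<oplus> r \<Sigma>) G\<^sup>T\<close> with fixed \<open>G\<close>, \<open>M\<close>, \<open>r\<close>. Metric and distance are invariant under
  congruence, under adding a fixed diagonal block and under scaling.
\<close>

theorem fiber_isometry:
  assumes B: "B \<in> base A"
  defines "f \<equiv> \<lambda>\<Sigma>. Phi A U C V (B, \<Sigma>)"
  shows "airm_isometry spd1 (fiber A B) f" "\<forall>\<Sigma>\<in>spd1. \<forall>\<Sigma>'\<in>spd1. d_AI (f \<Sigma>) (f \<Sigma>') = d_AI \<Sigma> \<Sigma>'"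
proof -
  define r where "r = rho TYPE('n) A C B"
  define G where "G = hcat U V ** block_mat (mat 1) 0 (T B) (mat 1)"
  have r: "r > 0" using rho_pos[OF B] by (simp add: r_def)
  have G: "invertible G" unfolding G_def by (rule frame_invertible)
  have M: "M B \<in> spd" by (rule M_spd[OF B])
  have f: "f \<Sigma> = G ** block_mat (M B) 0 0 (r *\<^sub>R \<Sigma>) ** transpose G" for \<Sigma>
    unfolding f_def G_def r_def Phi_eq_glue glue_eq ..
  have bij: "bij_betw f spd1 (fiber A B)"
    unfolding bij_betw_def fiber_eq[OF B] f_def
    by (intro conjI inj_onI refl) (metis Pair_inject Psi_Phi[OF B])
  have inv: "inv_into spd1 f X = unit_det (schur X)" if "X \<in> fiber A B" for X
  proof -
    have "X \<in> f ` spd1" using that unfolding fiber_eq[OF B] f_def .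
    then obtain \<Sigma> where \<Sigma>: "\<Sigma> \<in> spd1" "X = f \<Sigma>" by (elim imageE)
    then have "unit_det (schur X) = \<Sigma>" using Psi_Phi[OF B \<Sigma>(1)] by (simp add: f_def Psi_def)
    then show ?thesis using \<Sigma> bij by (simp add: bij_betw_def)
  qed
  have diffeo: "analytic_diffeo spd1 (fiber A B) f"
    unfolding analytic_diffeo_def
  proof (intro conjI bij real_analytic_onI)
    fix \<Sigma> :: "real^'n^'n"
    have "real_analytic_at f \<Sigma>"
      unfolding f_def by (intro real_analytic_at_Phi analytic_intros B)
    then show "\<exists>g W. real_analytic_at g \<Sigma> \<and> open W \<and> \<Sigma> \<in> W \<and> (\<forall>y\<in>spd1 \<inter> W. f y = g y)"
      by (intro exI[of _ f] exI[of _ UNIV]) auto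
  next
    fix X assume "X \<in> fiber A B"
    then have X: "X \<in> spd" by (auto simp: fiber_def spd1_spd)
    have "real_analytic_at (\<lambda>X. unit_det (schur X)) X"
      by (intro real_analytic_at_unit_det real_analytic_at_schur analytic_intros schur_spd X)
    then show "\<exists>g W. real_analytic_at g X \<and> open W \<and> X \<in> W \<and> (\<forall>y\<in>fiber A B \<inter> W. inv_into spd1 f y = g y)"
      using inv by (intro exI[of _ "\<lambda>X. unit_det (schur X)"] exI[of _ UNIV]) auto
  qed
  define D where "D X = G ** block_mat 0 0 0 (r *\<^sub>R X) ** transpose G" for X
  have "linear (\<lambda>X :: real^'n^'n. block_mat (0::real^'m^'m) 0 0 X)"
    by (rule linearI) (auto simp: vec_eq_iff block_mat_def hcat_def vcat_def split: sum.split)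
  then have "bounded_linear (\<lambda>X :: real^'n^'n. block_mat (0::real^'m^'m) 0 0 X)"
    by (simp add: linear_conv_bounded_linear)
  then have bl: "bounded_linear D"
  proof -
    assume "bounded_linear (\<lambda>X :: real^'n^'n. block_mat (0::real^'m^'m) 0 0 X)"
    from bounded_linear_compose[OF this bounded_linear_scaleR_right[of r]]
    have "bounded_linear (\<lambda>X :: real^'n^'n. block_mat (0::real^'m^'m) 0 0 (r *\<^sub>R X))" .
    from bounded_linear_compose[OF bounded_bilinear.bounded_linear_right[OF bounded_bilinear_matrix_mult] this]
    have "bounded_linear (\<lambda>X :: real^'n^'n. G ** block_mat (0::real^'m^'m) 0 0 (r *\<^sub>R X))" .
    from bounded_linear_compose[OF bounded_bilinear.bounded_linear_left[OF bounded_bilinear_matrix_mult] this]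
    show "bounded_linear D" unfolding D_def .
  qed
  have fD: "f \<Sigma> = G ** block_mat (M B) 0 0 0 ** transpose G + D \<Sigma>" for \<Sigma>
  proof -
    have "block_mat (M B) 0 0 (r *\<^sub>R \<Sigma>) = block_mat (M B) 0 0 0 + block_mat 0 0 0 (r *\<^sub>R \<Sigma>)"
      by (simp add: vec_eq_iff block_mat_def hcat_def vcat_def split: sum.split)
    then show ?thesis unfolding f D_def by (simp add: mm_bilinear)
  qed
  have "(f has_derivative D) (at P within spd1)" for P
  proof -
    have "((\<lambda>\<Sigma>. G ** block_mat (M B) 0 0 0 ** transpose G + D \<Sigma>) has_derivative (\<lambda>X. 0 + D X)) (at P within spd1)"
      by (intro has_derivative_add has_derivative_const bounded_linear_imp_has_derivative bl)
    then show ?thesis by (simp add: fD[abs_def])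
  qed
  moreover have "airm (f P) (D X) (D Y) = airm P X Y" if "P \<in> spd1" for P X Y
  proof -
    have P: "P \<in> spd" using that by (rule spd1_spd)
    then have "invertible (r *\<^sub>R P)" using r by (intro spd_invertible scaleR_spd)
    then show ?thesis
      unfolding f D_def using r P
      by (simp add: airm_congruence[OF G] invertible_block_diag spd_invertible M airm_block airm_scaleR)
  qed
  ultimately show "airm_isometry spd1 (fiber A B) f"
    unfolding airm_isometry_def using diffeo by blast
  show "\<forall>\<Sigma>\<in>spd1. \<forall>\<Sigma>'\<in>spd1. d_AI (f \<Sigma>) (f \<Sigma>') = d_AI \<Sigma> \<Sigma>'"
    unfolding f using r by (auto simp: d_AI_congruence[OF G] block_diag_spd M scaleR_spd spd1_spd d_AI_block d_AI_scaleR)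
qed

end

section \<open>Geodesics\<close>

lemma has_derivative_matrix_inv:
  fixes X :: "real^'k^'k"
  assumes X: "invertible X"
  shows "(matrix_inv has_derivative (\<lambda>H. - (matrix_inv X ** H ** matrix_inv X))) (at X)"
proof -
  obtain D where D: "(matrix_inv has_derivative D) (at X)"
    using real_analytic_at_imp_derivative[OF real_analytic_at_matrix_inv[OF real_analytic_at_ident X]] by blast
  have 1: "((\<lambda>X. X ** matrix_inv X) has_derivative (\<lambda>H. X ** D H + H ** matrix_inv X)) (at X)"
    by (rule bounded_bilinear.FDERIV[OF bounded_bilinear_matrix_mult has_derivative_ident D])
  have "((\<lambda>X :: real^'k^'k. mat 1) has_derivative (\<lambda>H. X ** D H + H ** matrix_inv X)) (at X)"
    by (rule has_derivative_transform_within_open[OF 1 open_det_nonzero])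
      (use X in \<open>auto simp: invertible_det_nz[symmetric] matrix_inv_right\<close>)
  then have "(\<lambda>H. X ** D H + H ** matrix_inv X) = (\<lambda>H. 0)"
    using has_derivative_const has_derivative_unique by blast
  then have "X ** D H = - (H ** matrix_inv X)" for H by (metis add_eq_0_iff2)
  then have "matrix_inv X ** (X ** D H) = - (matrix_inv X ** (H ** matrix_inv X))" for H
    using mm_right_diff[of "matrix_inv X" 0] by (simp add: mm_bilinear)
  moreover have "matrix_inv X ** (X ** D H) = D H" for H
    by (rule matrix_cancel[OF matrix_inv_left[OF X]])
  ultimately have "D H = - (matrix_inv X ** H ** matrix_inv X)" for H
    by (simp add: matrix_mul_assoc)
  then have "D = (\<lambda>H. - (matrix_inv X ** H ** matrix_inv X))" by blast
  then show ?thesis using D by simp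
qed

lemma vector_derivative_matrix_inv:
  fixes \<gamma> :: "real \<Rightarrow> real^'k^'k"
  assumes "(\<gamma> has_vector_derivative v) (at t)" "invertible (\<gamma> t)"
  shows "((\<lambda>s. matrix_inv (\<gamma> s)) has_vector_derivative - (matrix_inv (\<gamma> t) ** v ** matrix_inv (\<gamma> t))) (at t)"
proof -
  have "((\<lambda>s. matrix_inv (\<gamma> s)) has_derivative (\<lambda>h. - (matrix_inv (\<gamma> t) ** (h *\<^sub>R v) ** matrix_inv (\<gamma> t)))) (at t)"
    using has_derivative_compose[OF assms(1)[unfolded has_vector_derivative_def] has_derivative_matrix_inv[OF assms(2)]] .
  then show ?thesis by (simp add: has_vector_derivative_def mm_bilinear)
qed

lemma vector_derivative_matrix_mult:
  fixes f :: "real \<Rightarrow> real^'n^'m" and g :: "real \<Rightarrow> real^'k^'n"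
  assumes "(f has_vector_derivative f') (at t)" "(g has_vector_derivative g') (at t)"
  shows "((\<lambda>s. f s ** g s) has_vector_derivative (f t ** g' + f' ** g t)) (at t)"
  using bounded_bilinear.has_vector_derivative[OF bounded_bilinear_matrix_mult assms] .

text \<open>
  A permutation other than the identity moves two indices, so its term in the Leibniz formula vanishes to second
  order.
\<close>

lemma det_one_derivative: "((\<lambda>t. det (mat 1 + t *\<^sub>R Y)) has_real_derivative trace Y) (at 0)"
  for Y :: "real^'k^'k"
proof -
  let ?e = "\<lambda>p t i. (mat 1 + t *\<^sub>R Y :: real^'k^'k) $ i $ p i"
  have fin: "finite {p. p permutes (UNIV :: 'k set)}" by (rule finite_permutations) simp
  have "((\<lambda>t. \<Prod>i\<in>UNIV. ?e p t i) has_derivative (\<lambda>h. \<Sum>i\<in>UNIV. (h * Y $ i $ p i) * (\<Prod>j\<in>UNIV - {i}. ?e p 0 j))) (at 0)" for p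
    by (rule has_derivative_prod) (auto intro!: derivative_eq_intros)
  then have d: "((\<lambda>t. det (mat 1 + t *\<^sub>R Y)) has_derivative (\<lambda>h. \<Sum>p\<in>{p. p permutes (UNIV :: 'k set)}.
      of_int (sign p) * (\<Sum>i\<in>UNIV. (h * Y $ i $ p i) * (\<Prod>j\<in>UNIV - {i}. ?e p 0 j)))) (at 0)"
    unfolding det_def by (intro has_derivative_sum has_derivative_mult_right)
  have z: "(\<Prod>j\<in>UNIV - {i}. ?e p 0 j) = (if p = id then 1 else 0)" if p: "p permutes UNIV" for p i
  proof (cases "p = id")
    case False
    have "\<exists>j. j \<noteq> i \<and> p j \<noteq> j"
    proof (rule ccontr)
      assume "\<not> ?thesis"
      then have fx: "p j = j" if "j \<noteq> i" for j using that by blast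
      have "p i = i"
        using permutes_inj[OF p] fx by (metis injD)
      then show False using False fx by (metis eq_id_iff)
    qed
    then obtain j where "j \<noteq> i" "p j \<noteq> j" by blast
    then have "j \<in> UNIV - {i}" "?e p 0 j = 0" by (auto simp: mat_def)
    then have "(\<Prod>j\<in>UNIV - {i}. ?e p 0 j) = 0" by (intro prod_zero) auto
    then show ?thesis using False by simp
  qed (simp add: mat_def)
  have "(\<lambda>h. \<Sum>p\<in>{p. p permutes (UNIV :: 'k set)}. of_int (sign p) * (\<Sum>i\<in>UNIV. (h * Y $ i $ p i) * (\<Prod>j\<in>UNIV - {i}. ?e p 0 j)))
     = (\<lambda>h. trace Y * h)"
  proof
    fix h
    have "(\<Sum>p\<in>{p. p permutes (UNIV :: 'k set)}. of_int (sign p) * (\<Sum>i\<in>UNIV. (h * Y $ i $ p i) * (\<Prod>j\<in>UNIV - {i}. ?e p 0 j)))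
      = (\<Sum>p\<in>{p. p permutes (UNIV :: 'k set)}. if p = id then \<Sum>i\<in>UNIV. h * Y $ i $ i else 0)"
      by (intro sum.cong refl) (simp add: z[simplified] sign_id)
    also have "\<dots> = (\<Sum>i\<in>UNIV. h * Y $ i $ i)"
      using fin by (subst sum.delta) (auto simp: permutes_id)
    finally show "(\<Sum>p\<in>{p. p permutes (UNIV :: 'k set)}. of_int (sign p) * (\<Sum>i\<in>UNIV. (h * Y $ i $ p i) * (\<Prod>j\<in>UNIV - {i}. ?e p 0 j))) = trace Y * h"
      by (simp add: trace_def sum_distrib_left[symmetric] mult.commute)
  qed
  with d show ?thesis by (simp add: has_field_derivative_def)
qed

text \<open>
  Jacobi's formula along a curve; factoring out \<open>\<gamma> t\<close> reduces it to the identity matrix.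
\<close>

lemma vector_derivative_det:
  fixes \<gamma> :: "real \<Rightarrow> real^'k^'k"
  assumes \<gamma>: "(\<gamma> has_vector_derivative v) (at t)" "invertible (\<gamma> t)"
  shows "((\<lambda>s. det (\<gamma> s)) has_real_derivative det (\<gamma> t) * trace (matrix_inv (\<gamma> t) ** v)) (at t)"
proof -
  let ?X = "\<gamma> t"
  obtain D where D: "(det has_derivative D) (at ?X)"
    using real_analytic_at_imp_derivative[OF real_analytic_at_det[OF real_analytic_at_ident]] by blast
  have "((\<lambda>s. ?X + s *\<^sub>R v) has_derivative (\<lambda>h. 0 + h *\<^sub>R v)) (at 0)"
    by (intro has_derivative_add has_derivative_const has_derivative_scaleR_left has_derivative_ident)
  from has_derivative_compose[OF this, of det D] D
  have "((\<lambda>s. det (?X + s *\<^sub>R v)) has_derivative (\<lambda>h. D (h *\<^sub>R v))) (at 0)" by simp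
  moreover have "?X + s *\<^sub>R v = ?X ** (mat 1 + s *\<^sub>R (matrix_inv ?X ** v))" for s
    using assms(2) by (simp add: mm_bilinear matrix_mul_assoc matrix_inv_right)
  then have "(\<lambda>s. det (?X + s *\<^sub>R v)) = (\<lambda>s. det ?X * det (mat 1 + s *\<^sub>R (matrix_inv ?X ** v)))"
    by (simp add: det_mul)
  moreover have "((\<lambda>s. det ?X * det (mat 1 + s *\<^sub>R (matrix_inv ?X ** v))) has_derivative (\<lambda>h. det ?X * (trace (matrix_inv ?X ** v) * h))) (at 0)"
    using det_one_derivative[of "matrix_inv ?X ** v"] unfolding has_field_derivative_def by (rule has_derivative_mult_right)
  ultimately have "(\<lambda>h. D (h *\<^sub>R v)) = (\<lambda>h. det ?X * (trace (matrix_inv ?X ** v) * h))"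
    using has_derivative_unique by metis
  moreover have "((\<lambda>s. det (\<gamma> s)) has_derivative (\<lambda>h. D (h *\<^sub>R v))) (at t)"
    using has_derivative_compose[OF \<gamma>(1)[unfolded has_vector_derivative_def] D] .
  moreover have "(\<lambda>h. det ?X * (trace (matrix_inv ?X ** v) * h)) = (*) (det ?X * trace (matrix_inv ?X ** v))"
    by (simp add: fun_eq_iff)
  ultimately show ?thesis by (simp only: has_field_derivative_def)
qed

text \<open>
  The line \<open>P + t Z\<close>, normalized to determinant one; the trace condition makes the normalizing factor
  stationary at \<open>P\<close>.
\<close>

lemma tangent_space_spd1:
  fixes P Z :: "real^'k^'k"
  assumes P: "P \<in> spd1" and Z: "transpose Z = Z" "trace (matrix_inv P ** Z) = 0"
  shows "Z \<in> tangent_space spd1 P"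
proof -
  have P': "P \<in> spd" "det P = 1" "transpose P = P" using P by (auto simp: spd1_def spd_sym)
  obtain e where e: "e > 0" "\<And>X. transpose X = X \<Longrightarrow> dist X P < e \<Longrightarrow> X \<in> spd"
    using spd_neighbourhood[OF P'(1)] by blast
  define c where "c t = unit_det (P + t *\<^sub>R Z)" for t
  define \<delta> where "\<delta> = e / (norm Z + 1)"
  have nZ: "norm Z + 1 > 0" using norm_ge_zero[of Z] by linarith
  have \<delta>: "\<delta> > 0" using e nZ by (simp add: \<delta>_def)
  have "c t \<in> spd1" if "\<bar>t\<bar> < \<delta>" for t
  proof -
    have "dist (P + t *\<^sub>R Z) P \<le> \<bar>t\<bar> * (norm Z + 1)" by (simp add: dist_norm algebra_simps)
    also have "\<dots> < e" using that nZ by (simp add: \<delta>_def field_simps)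
    finally have "P + t *\<^sub>R Z \<in> spd"
      using e(2)[of "P + t *\<^sub>R Z"] P' Z by (simp add: linear_add[OF linear_transpose] transpose_scalar)
    then show ?thesis by (simp add: c_def unit_det_spd1)
  qed
  moreover have "c 0 = P" by (simp add: c_def unit_det_def P'(2))
  moreover have "(c has_vector_derivative Z) (at 0)"
  proof -
    have line: "((\<lambda>t. P + t *\<^sub>R Z) has_vector_derivative Z) (at 0)"
      by (auto intro!: derivative_eq_intros)
    then have "((\<lambda>t. det (P + t *\<^sub>R Z)) has_real_derivative 0) (at 0)"
      using vector_derivative_det[OF line] spd_invertible[OF P'(1)] Z(2) by simp
    then have "((\<lambda>t. det (P + t *\<^sub>R Z) powr (- 1 / real CARD('k))) has_real_derivative 0) (at 0)"
      using P'(2) by (auto intro!: derivative_eq_intros)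
    from has_vector_derivative_scaleR[OF this line]
    show ?thesis unfolding c_def unit_det_def by (simp add: P'(2))
  qed
  ultimately show ?thesis unfolding tangent_space_def using \<delta> by blast
qed

lemma trace_square_eq_0:
  fixes P Z :: "real^'k^'k"
  assumes P: "P \<in> spd" and Z: "transpose Z = Z" "trace (matrix_inv P ** Z ** matrix_inv P ** Z) = 0"
  shows "Z = 0"
proof -
  obtain S where S: "S \<in> spd" "invertible S" "S ** S = P" using spd_sqrt[OF P] by blast
  let ?R = "matrix_inv S"
  have tR: "transpose ?R = ?R" using S by (metis spd_sym transpose_matrix_inv)
  have iP: "matrix_inv P = ?R ** ?R" using S(2,3) matrix_inv_mult by blast
  have "(?R ** Z ** ?R) \<bullet> (?R ** Z ** ?R) = trace (?R ** (Z ** ?R ** ?R ** Z ** ?R))"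
    by (simp add: inner_matrix matrix_transpose_mul tR Z matrix_mul_assoc)
  also have "\<dots> = trace (Z ** matrix_inv P ** Z ** matrix_inv P)"
    by (subst trace_mult_commute) (simp add: iP matrix_mul_assoc)
  also have "\<dots> = 0" using Z(2) trace_mult_commute[of "Z ** matrix_inv P ** Z" "matrix_inv P"] by (simp add: matrix_mul_assoc)
  finally have "?R ** Z ** ?R = 0" by simp
  then have "S ** (?R ** (Z ** (?R ** S))) = S ** 0 ** S" by (simp add: matrix_mul_assoc)
  then show ?thesis using S(2) by (simp add: matrix_inv_left matrix_cancel[OF matrix_inv_right] mm_bilinear)
qed

text \<open>
  Let \<open>g = \<gamma>\<^sup>-\<^sup>1\<close>, \<open>w = \<gamma>''\<close> and \<open>Z = w - v g v\<close>. The Euler-Lagrange equation says that \<open>Z\<close> is orthogonal to every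
  tangent vector, and differentiating \<open>det \<gamma> = 1\<close> twice shows that \<open>Z\<close> is itself tangent. So \<open>Z = 0\<close>, and
  \<open>g Z\<close> is the derivative of \<open>g v\<close>.
\<close>

lemma geodesic_velocity:
  fixes \<gamma> :: "real \<Rightarrow> real^'k^'k"
  assumes I: "open I" and geo: "airm_geodesic spd1 I \<gamma>" and t: "t \<in> I"
  defines "v \<equiv> \<lambda>t. vector_derivative \<gamma> (at t)"
  shows "\<gamma> t \<in> spd1" "(\<gamma> has_vector_derivative v t) (at t)"
    "((\<lambda>s. matrix_inv (\<gamma> s) ** v s) has_vector_derivative 0) (at t)"
proof -
  have G: "\<gamma> t \<in> spd1" "\<gamma> differentiable (at t)" "v differentiable (at t)"
    "\<And>Z. Z \<in> tangent_space spd1 (\<gamma> t) \<Longrightarrow> deriv (\<lambda>s. airm (\<gamma> s) (v s) Z) t = 1 / 2 * deriv (\<lambda>e. airm (\<gamma> t + e *\<^sub>R Z) (v t) (v t)) 0"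
    if "t \<in> I" for t
    using geo that unfolding airm_geodesic_def Let_def v_def by blast+
  have dg: "(\<gamma> has_vector_derivative v t) (at t)" if "t \<in> I" for t
    using G(2)[OF that] unfolding v_def by (simp add: vector_derivative_works)
  define w where "w = vector_derivative v (at t)"
  have dv: "(v has_vector_derivative w) (at t)"
    using G(3)[OF t] unfolding w_def by (simp add: vector_derivative_works)
  have spd: "\<gamma> t \<in> spd" if "t \<in> I" for t using G(1)[OF that] by (rule spd1_spd)
  have inv: "invertible (\<gamma> t)" if "t \<in> I" for t using spd[OF that] by (rule spd_invertible)
  let ?g = "\<lambda>s. matrix_inv (\<gamma> s)"
  have sym_deriv: "transpose f' = f'" if "(f has_vector_derivative f') (at t)" "\<And>s. s \<in> I \<Longrightarrow> transpose (f s) = f s" "t \<in> I"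
    for f :: "real \<Rightarrow> real^'k^'k" and f' t
  proof -
    have "((\<lambda>s. transpose (f s)) has_vector_derivative transpose f') (at t)"
      using bounded_linear.has_vector_derivative[OF bounded_linear_transpose that(1)] .
    then have "(f has_vector_derivative transpose f') (at t)"
      by (rule has_vector_derivative_transform_within_open[OF _ I that(3)]) (rule that(2))
    then show ?thesis using that(1) by (rule vector_derivative_unique_at)
  qed
  have v_sym: "transpose (v t) = v t" if "t \<in> I" for t
    using sym_deriv[OF dg[OF that] _ that] spd spd_sym by blast
  have w_sym: "transpose w = w" using sym_deriv[OF dv _ t] v_sym by blast
  have tr: "trace (?g s ** v s) = 0" if "s \<in> I" for s
  proof -
    have "((\<lambda>s. det (\<gamma> s)) has_real_derivative trace (?g s ** v s)) (at s)"
      using vector_derivative_det[OF dg[OF that] inv[OF that]] G(1)[OF that] by (simp add: spd1_def)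
    moreover have "((\<lambda>s. det (\<gamma> s)) has_real_derivative 0) (at s)"
      by (rule DERIV_cong_ev[THEN iffD1, OF refl _ refl DERIV_const[of 1]])
        (use I that G(1) in \<open>auto simp: eventually_nhds spd1_def intro!: exI[of _ I]\<close>)
    ultimately show ?thesis by (rule DERIV_unique)
  qed
  have dgi: "(?g has_vector_derivative - (?g t ** v t ** ?g t)) (at t)"
    by (rule vector_derivative_matrix_inv[OF dg[OF t] inv[OF t]])
  have dX: "((\<lambda>s. ?g s ** v s) has_vector_derivative (?g t ** w - ?g t ** v t ** ?g t ** v t)) (at t)"
    using vector_derivative_matrix_mult[OF dgi dv] mm_left_diff[of 0 "?g t ** v t ** ?g t" "v t"] by (simp add: mm_bilinear)
  have "trace (?g t ** w - ?g t ** v t ** ?g t ** v t) = 0"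
  proof -
    have "((\<lambda>s. trace (?g s ** v s)) has_vector_derivative trace (?g t ** w - ?g t ** v t ** ?g t ** v t)) (at t)"
      by (rule bounded_linear.has_vector_derivative[OF bounded_linear_trace dX])
    moreover have "((\<lambda>s. 0 :: real) has_vector_derivative 0) (at t)" by simp
    then have "((\<lambda>s. trace (?g s ** v s)) has_vector_derivative 0) (at t)"
      by (rule has_vector_derivative_transform_within_open[OF _ I t]) (simp add: tr)
    ultimately show ?thesis by (rule vector_derivative_unique_at)
  qed
  define Z where "Z = w - v t ** ?g t ** v t"
  have gs: "transpose (?g t) = ?g t" using spd[OF t] inv[OF t] by (metis spd_sym transpose_matrix_inv)
  have Z_sym: "transpose Z = Z"
    by (simp add: Z_def linear_diff[OF linear_transpose] matrix_transpose_mul w_sym v_sym[OF t] gs matrix_mul_assoc)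
  have gZ: "?g t ** Z = ?g t ** w - ?g t ** v t ** ?g t ** v t" by (simp add: Z_def mm_bilinear matrix_mul_assoc)
  have "trace (?g t ** Z) = 0" unfolding gZ by fact
  then have "Z \<in> tangent_space spd1 (\<gamma> t)" using Z_sym G(1)[OF t] by (intro tangent_space_spd1)
  note eq = G(4)[OF t this]
  let ?q = "trace (?g t ** v t ** ?g t ** v t ** ?g t ** Z)"
  have neg: "- X ** Y = - (X ** Y)" "X ** - Y = - (X ** Y)" for X :: "real^'k^'k" and Y :: "real^'k^'k"
    using mm_left_diff[of 0 X Y] mm_right_diff[of X 0 Y] by (simp_all add: mm_bilinear)
  have L: "deriv (\<lambda>s. airm (\<gamma> s) (v s) Z) t = trace (?g t ** w ** ?g t ** Z) - 2 * ?q"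
  proof -
    have "((\<lambda>s. ?g s ** v s ** ?g s ** Z) has_vector_derivative
       (?g t ** v t ** ?g t ** 0 + (?g t ** v t ** - (?g t ** v t ** ?g t) + (?g t ** w - ?g t ** v t ** ?g t ** v t) ** ?g t) ** Z)) (at t)"
      by (intro vector_derivative_matrix_mult dX dgi has_vector_derivative_const)
    from bounded_linear.has_vector_derivative[OF bounded_linear_trace this]
    have d: "((\<lambda>s. airm (\<gamma> s) (v s) Z) has_real_derivative trace (?g t ** v t ** ?g t ** 0 +
       (?g t ** v t ** - (?g t ** v t ** ?g t) + (?g t ** w - ?g t ** v t ** ?g t ** v t) ** ?g t) ** Z)) (at t)"
      unfolding airm_def has_real_derivative_iff_has_vector_derivative .
    have "trace (?g t ** v t ** ?g t ** 0 +
       (?g t ** v t ** - (?g t ** v t ** ?g t) + (?g t ** w - ?g t ** v t ** ?g t ** v t) ** ?g t) ** Z) =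
       trace (0 :: real^'k^'k) + (- ?q + (trace (?g t ** w ** ?g t ** Z) - ?q))"
      by (simp only: mm_bilinear neg matrix_mul_assoc linear_add[OF linear_trace] linear_diff[OF linear_trace] linear_neg[OF linear_trace])
    then have "((\<lambda>s. airm (\<gamma> s) (v s) Z) has_real_derivative (trace (?g t ** w ** ?g t ** Z) - 2 * ?q)) (at t)"
      using d by (simp add: linear_0[OF linear_trace])
    then show ?thesis by (rule DERIV_imp_deriv)
  qed
  have R: "deriv (\<lambda>e. airm (\<gamma> t + e *\<^sub>R Z) (v t) (v t)) 0 = - 2 * ?q"
  proof -
    have line: "((\<lambda>e. \<gamma> t + e *\<^sub>R Z) has_vector_derivative Z) (at 0)"
      by (auto intro!: derivative_eq_intros)
    have dh: "((\<lambda>e. matrix_inv (\<gamma> t + e *\<^sub>R Z)) has_vector_derivative - (?g t ** Z ** ?g t)) (at 0)"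
      using vector_derivative_matrix_inv[OF line] inv[OF t] by simp
    have dhv: "((\<lambda>e. matrix_inv (\<gamma> t + e *\<^sub>R Z) ** v t) has_vector_derivative - (?g t ** Z ** ?g t ** v t)) (at 0)"
      using vector_derivative_matrix_mult[OF dh has_vector_derivative_const[of "v t"]] by (simp add: mm_bilinear neg)
    have "((\<lambda>e. matrix_inv (\<gamma> t + e *\<^sub>R Z) ** v t ** (matrix_inv (\<gamma> t + e *\<^sub>R Z) ** v t)) has_vector_derivative
       (?g t ** v t ** - (?g t ** Z ** ?g t ** v t) + - (?g t ** Z ** ?g t ** v t) ** (?g t ** v t))) (at 0)"
      using vector_derivative_matrix_mult[OF dhv dhv] by simp
    from bounded_linear.has_vector_derivative[OF bounded_linear_trace this]
    have "((\<lambda>e. airm (\<gamma> t + e *\<^sub>R Z) (v t) (v t)) has_real_derivative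
       (- trace (?g t ** v t ** ?g t ** Z ** ?g t ** v t) - trace (?g t ** Z ** ?g t ** v t ** ?g t ** v t))) (at 0)"
      by (simp add: airm_def has_real_derivative_iff_has_vector_derivative mm_bilinear neg matrix_mul_assoc
          linear_add[OF linear_trace] linear_diff[OF linear_trace] linear_neg[OF linear_trace])
    moreover have "trace (?g t ** v t ** ?g t ** Z ** ?g t ** v t) = ?q"
      using trace_mult_commute[of "?g t ** v t ** ?g t ** Z" "?g t ** v t"] by (simp add: matrix_mul_assoc)
    moreover have "trace (?g t ** Z ** ?g t ** v t ** ?g t ** v t) = ?q"
      using trace_mult_commute[of "?g t ** Z" "?g t ** v t ** ?g t ** v t"] by (simp add: matrix_mul_assoc)
    ultimately show ?thesis by (intro DERIV_imp_deriv) simp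
  qed
  have "trace (?g t ** w ** ?g t ** Z) - ?q = 0" using eq unfolding L R by simp
  moreover have "?g t ** Z ** ?g t ** Z = ?g t ** w ** ?g t ** Z - ?g t ** v t ** ?g t ** v t ** ?g t ** Z"
    unfolding gZ by (simp add: mm_bilinear)
  ultimately have "trace (?g t ** Z ** ?g t ** Z) = 0" by (simp add: linear_diff[OF linear_trace])
  then have "Z = 0" by (rule trace_square_eq_0[OF spd[OF t] Z_sym])
  then show "((\<lambda>s. ?g s ** v s) has_vector_derivative 0) (at t)"
    using dX gZ by (simp add: mm_bilinear)
  show "\<gamma> t \<in> spd1" "(\<gamma> has_vector_derivative v t) (at t)" using G(1) dg t by auto
qed

lemma vanishing_derivative_imp_constant:
  fixes f :: "real \<Rightarrow> 'a::real_normed_vector"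
  assumes "is_interval I" "\<And>t. t \<in> I \<Longrightarrow> (f has_vector_derivative 0) (at t)" "s \<in> I" "t \<in> I"
  shows "f s = f t"
proof -
  have "(f has_derivative (\<lambda>h. 0)) (at t within I)" if "t \<in> I" for t
    using assms(2)[OF that] by (auto simp: has_vector_derivative_def intro: has_derivative_at_withinI)
  then have "\<exists>c. \<forall>x\<in>I. f x = c"
    using assms(1) by (intro has_derivative_zero_constant) (auto simp: is_interval_convex)
  then show ?thesis using assms(3,4) by auto
qed

theorem totally_geodesic_fiber: "totally_geodesic spd1 (fiber A B)"
  for A :: "real^'m^'d"
  unfolding totally_geodesic_def
proof (intro conjI allI impI)
  show "fiber A B \<subseteq> spd1" by (auto simp: fiber_def)
  fix I \<gamma> t0
  assume "open I \<and> is_interval I \<and> airm_geodesic spd1 I \<gamma> \<and> t0 \<in> I \<and> \<gamma> t0 \<in> fiber A B \<and>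
     vector_derivative \<gamma> (at t0) \<in> tangent_space (fiber A B) (\<gamma> t0)"
  then have I: "open I" "is_interval I" "airm_geodesic spd1 I \<gamma>" "t0 \<in> I" "\<gamma> t0 \<in> fiber A B"
    and tan: "vector_derivative \<gamma> (at t0) \<in> tangent_space (fiber A B) (\<gamma> t0)" by auto
  define v where "v t = vector_derivative \<gamma> (at t)" for t
  note G = geodesic_velocity[OF I(1,3), folded v_def]
  obtain c e where c: "0 < e" "\<And>t. \<bar>t\<bar> < e \<Longrightarrow> c t \<in> fiber A B" "(c has_vector_derivative v t0) (at 0)"
    using tan unfolding tangent_space_def v_def by blast
  have "((\<lambda>t. c t ** A) has_vector_derivative v t0 ** A) (at 0)"
    using bounded_linear.has_vector_derivative[OF bounded_bilinear.bounded_linear_left[OF bounded_bilinear_matrix_mult] c(3)] .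
  moreover have "((\<lambda>t. B) has_vector_derivative 0) (at 0)" by simp
  then have "((\<lambda>t. c t ** A) has_vector_derivative 0) (at 0)"
    by (rule has_vector_derivative_transform_within_open[where S = "ball 0 e"])
      (use c in \<open>auto simp: fiber_def act_def\<close>)
  ultimately have vA: "v t0 ** A = 0" by (rule vector_derivative_unique_at)
  have vtA: "v t ** A = 0" if t: "t \<in> I" for t
  proof -
    have "matrix_inv (\<gamma> t) ** v t = matrix_inv (\<gamma> t0) ** v t0"
      using vanishing_derivative_imp_constant[where f = "\<lambda>s. matrix_inv (\<gamma> s) ** v s", OF I(2) G(3) t I(4)] by simp
    then have "matrix_inv (\<gamma> t) ** v t ** A = 0" using vA by (simp add: matrix_mul_assoc[symmetric] mm_bilinear)
    then have "\<gamma> t ** (matrix_inv (\<gamma> t) ** (v t ** A)) = 0" by (simp add: matrix_mul_assoc mm_bilinear)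
    then show ?thesis
      using spd_invertible[OF spd1_spd[OF G(1)[OF t]]] by (simp add: matrix_cancel[OF matrix_inv_right])
  qed
  have "\<gamma> t \<in> fiber A B" if t: "t \<in> I" for t
  proof -
    have "\<gamma> t ** A = \<gamma> t0 ** A"
    proof (rule vanishing_derivative_imp_constant[OF I(2) _ t I(4)])
      fix s assume s: "s \<in> I"
      have "((\<lambda>t. \<gamma> t ** A) has_vector_derivative v s ** A) (at s)"
        using bounded_linear.has_vector_derivative[OF bounded_bilinear.bounded_linear_left[OF bounded_bilinear_matrix_mult] G(2)[OF s]] .
      then show "((\<lambda>t. \<gamma> t ** A) has_vector_derivative 0) (at s)" by (simp add: vtA[OF s])
    qed
    then show ?thesis using I(5) G(1)[OF t] by (simp add: fiber_def act_def)
  qed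
  then show "\<exists>e>0. \<forall>t\<in>I. \<bar>t - t0\<bar> < e \<longrightarrow> \<gamma> t \<in> fiber A B" by (intro exI[of _ 1]) auto
qed

section \<open>The nearest controller\<close>

text \<open>
  The midpoint of \<open>P0\<close> and \<open>P\<close> lies in the fiber and cannot be nearer than \<open>P0\<close>.
\<close>

lemma minimizer_growth:
  assumes P0: "P0 \<in> fiber A B" "\<And>P. P \<in> fiber A B \<Longrightarrow> radius P0 \<le> radius P" and P: "P \<in> fiber A B"
  shows "(radius P0)\<^sup>2 + (d_AI P0 P)\<^sup>2 / 2 \<le> (radius P)\<^sup>2"
proof -
  obtain m where m: "m \<in> fiber A B" "(radius m)\<^sup>2 \<le> (radius P0)\<^sup>2 / 2 + (radius P)\<^sup>2 / 2 - (d_AI P0 P)\<^sup>2 / 4"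
    using fiber_midpoint[OF P0(1) P] by blast
  have "(radius P0)\<^sup>2 \<le> (radius m)\<^sup>2" using P0(2)[OF m(1)] radius_nonneg by (intro power_mono)
  then show ?thesis using m(2) by linarith
qed

lemma minimizer_unique:
  assumes P0: "P0 \<in> fiber A B" "\<And>P. P \<in> fiber A B \<Longrightarrow> radius P0 \<le> radius P"
    and P: "P \<in> fiber A B" "radius P \<le> radius P0"
  shows "P = P0"
proof -
  have "(radius P)\<^sup>2 \<le> (radius P0)\<^sup>2" using P(2) radius_nonneg by (intro power_mono)
  then have "(d_AI P0 P)\<^sup>2 \<le> 0" using minimizer_growth[OF P0 P(1)] by linarith
  then have "d_AI P0 P = 0" by simp
  moreover have "P0 \<in> spd" "P \<in> spd" using P0 P by (auto simp: fiber_def spd1_spd)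
  ultimately have "norm (P0 - P) \<le> 0" using norm_diff_le_d_AI[of P0 "radius P0" P] P(2) by auto
  then show ?thesis by simp
qed

lemma minimizer_exists:
  assumes "fiber A B \<noteq> {}"
  shows "\<exists>P0\<in>fiber A B. \<forall>P\<in>fiber A B. radius P0 \<le> radius P"
proof -
  obtain P1 where P1: "P1 \<in> fiber A B" using assms by blast
  let ?K = "{P. P \<in> spd1 \<and> radius P \<le> radius P1} \<inter> {P. P ** A = B}"
  have "bounded_linear (\<lambda>P. P ** A)"
    by (rule bounded_bilinear.bounded_linear_left[OF bounded_bilinear_matrix_mult])
  then have "closed {P. P ** A = B}"
    by (intro closed_Collect_eq linear_continuous_on continuous_on_const)
  then have "compact ?K" by (intro compact_Int_closed compact_radius_ball)
  moreover have "P1 \<in> ?K" using P1 by (auto simp: fiber_def act_def)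
  moreover have "continuous_on ?K radius"
    by (rule continuous_on_subset[OF continuous_on_radius]) (auto simp: spd1_spd)
  ultimately obtain P0 where P0: "P0 \<in> ?K" "\<forall>P\<in>?K. radius P0 \<le> radius P"
    using continuous_attains_inf[of ?K radius] by blast
  have "radius P0 \<le> radius P" if "P \<in> fiber A B" for P
  proof (cases "radius P \<le> radius P1")
    case True
    then show ?thesis using P0(2) that by (auto simp: fiber_def act_def)
  next
    case False
    then show ?thesis using P0(1) by auto
  qed
  moreover have "P0 \<in> fiber A B" using P0(1) by (auto simp: fiber_def act_def)
  ultimately show ?thesis by blast
qed

lemma nearest_eqI:
  assumes "P0 \<in> fiber A B" "\<And>P. P \<in> fiber A B \<Longrightarrow> radius P0 \<le> radius P"
  shows "nearest A B = P0"
proof -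
  have "is_arg_min radius (\<lambda>P. P \<in> fiber A B) P0"
    using assms by (auto simp: is_arg_min_def not_less)
  then have "is_arg_min radius (\<lambda>P. P \<in> fiber A B) (nearest A B)"
    unfolding nearest_def arg_min_on_def arg_min_def by (rule someI)
  then have "nearest A B \<in> fiber A B" "radius (nearest A B) \<le> radius P0"
    using assms(1) by (auto simp: is_arg_min_def not_less)
  then show ?thesis using minimizer_unique[OF assms] by blast
qed

lemma nearest_minimizes:
  assumes "fiber A B \<noteq> {}"
  shows "nearest A B \<in> fiber A B" "P \<in> fiber A B \<Longrightarrow> radius (nearest A B) \<le> radius P"
proof -
  obtain P0 where "P0 \<in> fiber A B" "\<forall>P\<in>fiber A B. radius P0 \<le> radius P" using minimizer_exists[OF assms] by blast
  moreover from this have "nearest A B = P0" by (intro nearest_eqI) auto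
  ultimately show "nearest A B \<in> fiber A B" "P \<in> fiber A B \<Longrightarrow> radius (nearest A B) \<le> radius P" by auto
qed

lemma ex1_minimizer:
  assumes "fiber A B \<noteq> {}"
  shows "\<exists>!P. is_arg_min radius (\<lambda>P. P \<in> fiber A B) P"
proof (rule ex1I[of _ "nearest A B"])
  show "is_arg_min radius (\<lambda>P. P \<in> fiber A B) (nearest A B)"
    using nearest_minimizes[OF assms] by (auto simp: is_arg_min_def not_less)
  fix P assume "is_arg_min radius (\<lambda>P. P \<in> fiber A B) P"
  then show "P = nearest A B"
    by (intro nearest_eqI[symmetric]) (auto simp: is_arg_min_def not_less)
qed

text \<open>
  If \<open>Dg v = 0\<close>, then \<open>k\<close> grows along the line \<open>x0 + t v\<close> only by \<open>o (t\<^sup>2)\<close>, because its slope \<open>g (x0 + t v) \<bullet> v\<close> is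
  \<open>o t\<close>.
\<close>

lemma quadratic_growth_imp_injective_hessian:
  fixes k :: "'b::euclidean_space \<Rightarrow> real"
  assumes e: "e > 0" and c: "c > 0"
    and g: "\<And>x. x \<in> ball x0 e \<Longrightarrow> (k has_derivative (\<lambda>h. g x \<bullet> h)) (at x)"
    and Dg: "(g has_derivative Dg) (at x0)"
    and grow: "\<And>x. x \<in> ball x0 e \<Longrightarrow> k x0 + c * (norm (x - x0))\<^sup>2 \<le> k x"
    and v: "Dg v = 0"
  shows "v = 0"
proof (rule ccontr)
  assume v0: "v \<noteq> 0"
  have "(\<lambda>h. g x0 \<bullet> h) = (\<lambda>h. 0)"
  proof (rule differential_zero_maxmin[of x0 "ball x0 e"])
    have "k x0 \<le> k y" if "y \<in> ball x0 e" for y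
      using grow[OF that] c by (smt (verit) mult_nonneg_nonneg zero_le_power2)
    then show "(\<forall>y\<in>ball x0 e. k y \<le> k x0) \<or> (\<forall>y\<in>ball x0 e. k x0 \<le> k y)" by blast
  qed (use e g in auto)
  then have g0: "g x0 \<bullet> v = 0" by metis
  define \<psi> where "\<psi> t = g (x0 + t *\<^sub>R v) \<bullet> v" for t
  have line: "((\<lambda>t. x0 + t *\<^sub>R v) has_derivative (\<lambda>h. h *\<^sub>R v)) (at t)" for t
    by (auto intro!: derivative_eq_intros)
  have "((\<lambda>t. g (x0 + t *\<^sub>R v)) has_derivative (\<lambda>h. Dg (h *\<^sub>R v))) (at 0)"
    using has_derivative_compose[OF line[of 0], of g Dg] Dg by simp
  moreover have "Dg (h *\<^sub>R v) = 0" for h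
    using linear_scale[OF has_derivative_linear[OF Dg], of h v] v by simp
  ultimately have "(\<psi> has_derivative (\<lambda>h. 0)) (at 0)"
    unfolding \<psi>_def using has_derivative_inner_left[of "\<lambda>t. g (x0 + t *\<^sub>R v)" "\<lambda>h. 0" "at 0" v] by simp
  moreover have "(*) (0 :: real) = (\<lambda>h. 0)" by auto
  ultimately have "(\<psi> has_field_derivative 0) (at 0)" by (simp only: has_field_derivative_def)
  moreover have "\<psi> 0 = 0" using g0 by (simp add: \<psi>_def)
  ultimately have "((\<lambda>t. \<psi> t / t) \<longlongrightarrow> 0) (at 0)"
    by (simp add: has_field_derivative_iff)
  moreover define \<eta> where "\<eta> = c * (norm v)\<^sup>2"
  have \<eta>: "\<eta> > 0" using c v0 by (simp add: \<eta>_def)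
  ultimately obtain d where d: "d > 0" "\<And>t. t \<noteq> 0 \<Longrightarrow> \<bar>t\<bar> < d \<Longrightarrow> \<bar>\<psi> t / t\<bar> < \<eta>"
    unfolding LIM_def by (auto simp: dist_real_def)
  define t where "t = min (d / 2) (e / (2 * (norm v + 1)))"
  have nv: "norm v + 1 > 0" using norm_ge_zero[of v] by linarith
  have t: "t > 0" "t < d" using d e nv by (auto simp: t_def)
  have tb: "x0 + s *\<^sub>R v \<in> ball x0 e" if "0 \<le> s" "s \<le> t" for s
  proof -
    have "s * norm v \<le> t * (norm v + 1)" using that by (intro mult_mono) auto
    also have "\<dots> \<le> e / (2 * (norm v + 1)) * (norm v + 1)" using nv by (intro mult_right_mono) (auto simp: t_def)
    also have "e / (2 * k) * k < e" if "k > 0" for k :: real using that e by (simp add: field_simps)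
    then have "e / (2 * (norm v + 1)) * (norm v + 1) < e" using nv by blast
    finally show ?thesis using that by (simp add: dist_norm)
  qed
  have "\<exists>z. 0 < z \<and> z < t \<and> k (x0 + t *\<^sub>R v) - k (x0 + 0 *\<^sub>R v) = (t - 0) * \<psi> z"
  proof (rule MVT2[OF t(1)])
    fix s assume s: "0 \<le> s" "s \<le> t"
    have "((\<lambda>t. k (x0 + t *\<^sub>R v)) has_derivative (\<lambda>h. g (x0 + s *\<^sub>R v) \<bullet> (h *\<^sub>R v))) (at s)"
      by (rule has_derivative_compose[OF line g[OF tb[OF s]]])
    then show "((\<lambda>t. k (x0 + t *\<^sub>R v)) has_real_derivative \<psi> s) (at s)"
      by (simp add: has_field_derivative_def \<psi>_def mult.commute[of _ "g _ \<bullet> v"])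
  qed
  then obtain z where z: "0 < z" "z < t" "k (x0 + t *\<^sub>R v) - k x0 = t * \<psi> z" by auto
  have "\<eta> * t\<^sup>2 \<le> k (x0 + t *\<^sub>R v) - k x0"
    using grow[OF tb[of t]] t by (simp add: \<eta>_def power_mult_distrib mult_ac)
  then have "\<eta> * t \<le> \<psi> z" using t z by (simp add: power2_eq_square)
  moreover have "\<bar>\<psi> z / z\<bar> < \<eta>" using d(2)[of z] z t by auto
  then have "\<psi> z < \<eta> * z" using z(1) by (auto simp: abs_less_iff field_simps)
  moreover have "\<eta> * z \<le> \<eta> * t" using \<eta> z by simp
  ultimately show False by linarith
qed

context qr_frame
begin

text \<open>
  The nearest points for a convergent sequence \<open>b\<close> stay in a compact ball, since moving a fixed \<open>\<Sigma>\<close> along the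
  fibers bounds their radii. A limit of a subsequence lies in the limit fiber and minimizes there, so it is the
  nearest point by uniqueness.
\<close>

lemma continuous_on_nearest: "continuous_on (base A) (nearest A)"
  unfolding continuous_on_sequentially
proof (intro allI ballI impI)
  fix b B0 assume B0: "B0 \<in> base A" and "(\<forall>n. b n \<in> base A) \<and> b \<longlonglongrightarrow> B0"
  then have b: "\<And>n. b n \<in> base A" "b \<longlonglongrightarrow> B0" by auto
  let ?s = "nearest A"
  have min: "?s B \<in> fiber A B" "\<And>P. P \<in> fiber A B \<Longrightarrow> radius (?s B) \<le> radius P" if "B \<in> base A" for B
    using nearest_minimizes[OF fiber_nonempty[OF that]] by auto
  obtain \<Sigma> where \<Sigma>: "\<Sigma> \<in> spd1" "?s B0 = Phi A U C V (B0, \<Sigma>)"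
    using min(1)[OF B0] fiber_eq[OF B0] by blast
  define q where "q n = Phi A U C V (b n, \<Sigma>)" for n
  have q: "q n \<in> fiber A (b n)" for n using b \<Sigma> fiber_eq[OF b(1)] by (auto simp: q_def)
  have "isCont (\<lambda>B. Phi A U C V (B, \<Sigma>)) B0"
    by (intro real_analytic_at_imp_isCont real_analytic_at_Phi analytic_intros B0)
  from isCont_tendsto_compose[OF this b(2)] have "q \<longlonglongrightarrow> ?s B0" unfolding q_def[abs_def] \<Sigma>(2) .
  moreover have "isCont radius_sq (?s B0)"
    using min(1)[OF B0] by (intro real_analytic_at_imp_isCont real_analytic_at_radius_sq) (auto simp: fiber_def spd1_spd)
  ultimately have "(\<lambda>n. radius_sq (q n)) \<longlonglongrightarrow> radius_sq (?s B0)" by (rule isCont_tendsto_compose[rotated])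
  then have "(\<lambda>n. sqrt (radius_sq (q n))) \<longlonglongrightarrow> sqrt (radius_sq (?s B0))" by (intro tendsto_intros)
  moreover have "sqrt (radius_sq P) = radius P" if "P \<in> spd" for P :: "real^'d^'d"
    using that by (simp add: radius_sq_eq radius_nonneg)
  moreover have "q n \<in> spd" "?s B0 \<in> spd" for n using q min(1)[OF B0] by (auto simp: fiber_def spd1_spd)
  ultimately have rq: "(\<lambda>n. radius (q n)) \<longlonglongrightarrow> radius (?s B0)" by simp
  then obtain c where c: "\<And>n. radius (q n) \<le> c"
    by (metis abs_le_D1 convergentI convergent_imp_Bseq BseqE real_norm_def)
  have sK: "?s (b n) \<in> {P. P \<in> spd1 \<and> radius P \<le> c}" for n
    using min(1)[OF b(1)] order_trans[OF min(2)[OF b(1) q] c] by (auto simp: fiber_def)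
  show "(?s \<circ> b) \<longlonglongrightarrow> ?s B0"
  proof (rule ccontr)
    assume "\<not> (?s \<circ> b) \<longlonglongrightarrow> ?s B0"
    then obtain e where e: "e > 0" "\<exists>\<^sub>F n in sequentially. \<not> dist (?s (b n)) (?s B0) < e"
      unfolding tendsto_iff by (auto simp: frequently_def)
    then have "infinite {n. \<not> dist (?s (b n)) (?s B0) < e}"
      by (simp add: frequently_cofinite[symmetric] cofinite_eq_sequentially)
    from infinite_enumerate[OF this] obtain r :: "nat \<Rightarrow> nat"
      where r: "strict_mono r" "\<forall>n. r n \<in> {n. \<not> dist (?s (b n)) (?s B0) < e}" by (elim exE conjE)
    then have r2: "\<not> dist (?s (b (r n))) (?s B0) < e" for n by simp
    have "\<exists>P\<in>{P. P \<in> spd1 \<and> radius P \<le> c}. \<exists>r'. strict_mono r' \<and> ((\<lambda>n. ?s (b (r n))) \<circ> r') \<longlonglongrightarrow> P"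
      by (rule compact_radius_ball[of c, unfolded compact_def, rule_format]) (rule sK)
    then obtain P r' where P: "P \<in> {P. P \<in> spd1 \<and> radius P \<le> c}" "strict_mono r'" "((\<lambda>n. ?s (b (r n))) \<circ> r') \<longlonglongrightarrow> P"
      by (elim bexE exE conjE)
    define h where "h = r \<circ> r'"
    have h: "strict_mono h" using r P by (simp add: h_def strict_mono_o)
    have lim: "(\<lambda>n. ?s (b (h n))) \<longlonglongrightarrow> P" using P(3) by (simp add: h_def o_def)
    have "(\<lambda>n. ?s (b (h n)) ** A) \<longlonglongrightarrow> P ** A"
      by (rule bounded_linear.tendsto[OF bounded_bilinear.bounded_linear_left[OF bounded_bilinear_matrix_mult] lim])
    moreover have "?s (b (h n)) ** A = b (h n)" for n using min(1)[OF b(1)] by (auto simp: fiber_def act_def)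
    moreover have "(\<lambda>n. b (h n)) \<longlonglongrightarrow> B0" using LIMSEQ_subseq_LIMSEQ[OF b(2) h] by (simp add: o_def)
    ultimately have "P ** A = B0" using LIMSEQ_unique by fastforce
    then have Pf: "P \<in> fiber A B0" using P(1) by (simp add: fiber_def act_def)
    have "isCont radius_sq P"
      using P(1) by (intro real_analytic_at_imp_isCont real_analytic_at_radius_sq) (auto simp: spd1_spd)
    from isCont_tendsto_compose[OF this lim] have "(\<lambda>n. sqrt (radius_sq (?s (b (h n))))) \<longlonglongrightarrow> sqrt (radius_sq P)" by (intro tendsto_intros)
    moreover have "sqrt (radius_sq P) = radius P" if "P \<in> spd1" for P :: "real^'d^'d"
      using that by (simp add: radius_sq_eq radius_nonneg spd1_spd)
    ultimately have "(\<lambda>n. radius (?s (b (h n)))) \<longlonglongrightarrow> radius P" using P(1) sK by simp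
    moreover have "(\<lambda>n. radius (q (h n))) \<longlonglongrightarrow> radius (?s B0)" using LIMSEQ_subseq_LIMSEQ[OF rq h] by (simp add: o_def)
    ultimately have "radius P \<le> radius (?s B0)"
      by (rule LIMSEQ_le) (use min(2)[OF b(1) q] in auto)
    then have "P = ?s B0" using minimizer_unique[OF min[OF B0] Pf] by blast
    moreover have "e \<le> dist P (?s B0)"
    proof (rule LIMSEQ_le_const[OF tendsto_dist[OF lim tendsto_const]])
      show "\<exists>N. \<forall>n\<ge>N. e \<le> dist (?s (b (h n))) (?s B0)" using r2 by (simp add: h_def not_less)
    qed
    ultimately show False using e by simp
  qed
qed

text \<open>
  Retractions of neighborhoods in the ambient matrix spaces: onto the base, by symmetrizing \<open>M B\<close>, and onto the
  fiber over \<open>B\<close>, by keeping only the normalized Schur complement of the symmetric part. They replace charts.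
\<close>

definition base_retract :: "real^'m^'d \<Rightarrow> real^'m^'d" where
  "base_retract B = (U ** sym_part (M B) + V ** N B) ** C"

definition fiber_retract :: "real^'m^'d \<Rightarrow> real^'d^'d \<Rightarrow> real^'d^'d" where
  "fiber_retract B X = Phi A U C V (B, unit_det (schur (sym_part X)))"

lemma base_retract_ident: "B \<in> base A \<Longrightarrow> base_retract B = B"
  by (simp add: base_retract_def sym_part_ident spd_sym M_spd decompose)

lemma base_retract_mem: "sym_part (M B) \<in> spd \<Longrightarrow> base_retract B \<in> base A"
  by (simp add: base_retract_def assemble_base)

lemma fiber_retract_mem: "B \<in> base A \<Longrightarrow> sym_part X \<in> spd \<Longrightarrow> fiber_retract B X \<in> fiber A B"
  unfolding fiber_eq fiber_retract_def by (intro image_eqI[OF refl] unit_det_spd1 schur_spd)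

lemma fiber_retract_ident: "B \<in> base A \<Longrightarrow> X \<in> fiber A B \<Longrightarrow> fiber_retract B X = X"
  using Phi_Psi[of X] by (auto simp: fiber_retract_def fiber_def act_def Psi_def sym_part_ident spd_sym spd1_spd)

lemma real_analytic_at_base_retract: "real_analytic_at base_retract B"
proof -
  have "real_analytic_at (\<lambda>B. sym_part (M B)) B" unfolding M_part_def
    by (intro real_analytic_at_linear_compose[OF bounded_linear_sym_part] analytic_intros)
  moreover have "real_analytic_at N B" unfolding N_part_def by (intro analytic_intros)
  ultimately show ?thesis unfolding base_retract_def by (intro analytic_intros)
qed

text \<open>
  For \<open>B\<close> near \<open>B0\<close> the nearest point minimizes \<open>K (B, X) = radius\<^sup>2 (R (B, X)) + |X - R (B, X)|\<^sup>2\<close> over all matrices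
  \<open>X\<close> near it, where \<open>R (B, _)\<close> is the retraction onto the fiber. At \<open>B0\<close> the first term grows quadratically along the
  fiber, by the semi-parallelogram law, and the second one transversally to it. So the derivative of the gradient
  is injective, and the implicit function theorem applies to the zeros \<open>X = s B\<close> of the gradient.
\<close>

theorem real_analytic_at_nearest:
  assumes B0: "B0 \<in> base A"
  shows "real_analytic_at (\<lambda>B. nearest A (base_retract B)) B0"
proof -
  define s where "s B = nearest A (base_retract B)" for B
  have min: "nearest A B \<in> fiber A B" "\<And>P. P \<in> fiber A B \<Longrightarrow> radius (nearest A B) \<le> radius P" if "B \<in> base A" for B
    using nearest_minimizes[OF fiber_nonempty[OF that]] by auto
  define P0 where "P0 = s B0"
  have P0': "P0 = nearest A B0" by (simp add: P0_def s_def base_retract_ident[OF B0])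
  have P0: "P0 \<in> fiber A B0" "P0 \<in> spd" using min(1)[OF B0] by (auto simp: P0' fiber_def spd1_spd)
  have symP0: "sym_part P0 = P0" using P0 by (simp add: sym_part_ident spd_sym)
  define R where "R p = fiber_retract (base_retract (fst p)) (snd p)" for p
  define K where "K p = radius_sq (R p) + (snd p - R p) \<bullet> (snd p - R p)" for p
  have R0: "R (B0, P0) = P0"
    using fiber_retract_ident[OF B0 P0(1)] by (simp add: R_def base_retract_ident[OF B0])
  have fs: "real_analytic_at fst p" "real_analytic_at snd p" for p :: "(real^'m^'d) \<times> (real^'d^'d)"
    by (intro real_analytic_at_linear bounded_linear_fst bounded_linear_snd)+
  have Ran: "real_analytic_at R (B0, P0)"
    unfolding R_def fiber_retract_def
    by (intro real_analytic_at_Phi real_analytic_at_unit_det real_analytic_at_schur schur_spd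
        real_analytic_at_compose[OF fs(1) real_analytic_at_base_retract]
        real_analytic_at_linear_compose[OF bounded_linear_sym_part fs(2)])
      (use B0 P0 in \<open>simp_all add: base_retract_ident symP0\<close>)
  have Kan: "real_analytic_at K (B0, P0)"
    unfolding K_def using P0 R0
    by (intro real_analytic_at_add real_analytic_at_inner real_analytic_at_diff fs Ran
        real_analytic_at_compose[OF Ran] real_analytic_at_radius_sq) simp
  obtain W where W: "open W" "(B0, P0) \<in> W" "\<forall>p\<in>W. real_analytic_at K p"
    using real_analytic_at_open[OF Kan] by blast
  define DK where "DK p = frechet_derivative K (at p)" for p
  have DK: "(K has_derivative DK p) (at p)" if "p \<in> W" for p
    using real_analytic_at_imp_derivative W(3) that unfolding DK_def
    by (metis differentiableI frechet_derivative_works)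
  define G where "G p = (\<Sum>E\<in>Basis. DK p (0, E) *\<^sub>R E)" for p
  have Gan: "real_analytic_at G (B0, P0)"
    unfolding G_def
    by (intro real_analytic_at_sum real_analytic_at_scaleR real_analytic_at_const
        real_analytic_at_directional_derivative[OF Kan W(1,2) DK])
  have partial: "((\<lambda>X. K (B, X)) has_derivative (\<lambda>h. DK (B, X) (0, h))) (at X)" if "(B, X) \<in> W" for B X
  proof -
    have "((\<lambda>X. (B, X)) has_derivative (\<lambda>h. (0, h))) (at X)" by (intro derivative_intros)
    from has_derivative_compose[OF this DK[OF that]] show ?thesis .
  qed
  have G_inner: "DK (B, X) (0, h) = G (B, X) \<bullet> h" if "(B, X) \<in> W" for B X h
  proof -
    have lin: "linear (\<lambda>h. DK (B, X) (0, h))" by (rule has_derivative_linear[OF partial[OF that]])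
    have "DK (B, X) (0, h) = DK (B, X) (0, \<Sum>E\<in>Basis. (h \<bullet> E) *\<^sub>R E)" by (simp add: euclidean_representation)
    also have "\<dots> = (\<Sum>E\<in>Basis. (h \<bullet> E) *\<^sub>R DK (B, X) (0, E))"
      by (subst linear_sum[OF lin]) (simp only: linear_scale[OF lin])
    also have "\<dots> = G (B, X) \<bullet> h"
      unfolding G_def inner_sum_left by (intro sum.cong refl) (simp add: inner_commute)
    finally show ?thesis .
  qed
  obtain V1 where V1: "open V1" "M B0 \<in> V1" "\<forall>Y\<in>V1. sym_part Y \<in> spd"
    using sym_part_spd_neighbourhood[OF M_spd[OF B0]] by blast
  obtain V2 where V2: "open V2" "P0 \<in> V2" "\<forall>Y\<in>V2. sym_part Y \<in> spd"
    using sym_part_spd_neighbourhood[OF P0(2)] by blast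
  have Mcont: "isCont M B" for B
    unfolding M_part_def by (intro real_analytic_at_imp_isCont analytic_intros)
  define V1' where "V1' = M -` V1"
  have V1': "open V1'" "B0 \<in> V1'" "\<And>B. B \<in> V1' \<Longrightarrow> base_retract B \<in> base A"
    unfolding V1'_def using V1 Mcont base_retract_mem
    by (auto intro!: open_vimage continuous_at_imp_continuous_on)
  have "continuous_on V1' s"
    unfolding s_def using V1'(3)
    by (intro continuous_on_compose2[OF continuous_on_nearest] continuous_at_imp_continuous_on)
      (auto intro: real_analytic_at_imp_isCont real_analytic_at_base_retract)
  then have s_cont: "isCont s B0" using V1' by (simp add: continuous_on_eq_continuous_at)
  \<comment> \<open>\<open>K (B, X)\<close> dominates the squared radius of the point \<open>R (B, X)\<close> of the fiber, with equality at \<open>s B\<close>;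
    so \<open>s B\<close> is a critical point of \<open>K (B, _)\<close>.\<close>
  have "isCont (\<lambda>B. (B, s B)) B0" using s_cont by (intro continuous_intros)
  moreover have "open (W \<inter> UNIV \<times> V2)" "(B0, s B0) \<in> W \<inter> UNIV \<times> V2"
    using W V2 by (auto simp: P0_def open_Times)
  ultimately obtain V3 where V3: "open V3" "B0 \<in> V3" "\<forall>B\<in>V3. (B, s B) \<in> W \<inter> UNIV \<times> V2"
    unfolding continuous_at_open by blast
  have crit: "G (B, s B) = 0" if B: "B \<in> V1' \<inter> V3" for B
  proof -
    let ?B = "base_retract B"
    have BW: "(B, s B) \<in> W" "s B \<in> V2" using V3(3) B by auto
    have bB: "?B \<in> base A" using V1'(3) B by blast
    have sB: "s B \<in> fiber A ?B" "\<And>P. P \<in> fiber A ?B \<Longrightarrow> radius (s B) \<le> radius P" using min[OF bB] by (auto simp: s_def)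
    have spd: "P \<in> spd" if "P \<in> fiber A ?B" for P using that by (auto simp: fiber_def spd1_spd)
    have "K (B, s B) = (radius (s B))\<^sup>2"
      using fiber_retract_ident[OF bB sB(1)] spd[OF sB(1)] by (simp add: K_def R_def radius_sq_eq)
    moreover have "(radius (s B))\<^sup>2 \<le> K (B, X)" if "X \<in> V2" for X
    proof -
      have f: "R (B, X) \<in> fiber A ?B" using fiber_retract_mem[OF bB] V2(3) that by (simp add: R_def)
      then have "(radius (s B))\<^sup>2 \<le> radius_sq (R (B, X))"
        using power_mono[OF sB(2)[OF f] radius_nonneg, of 2] spd[OF f] by (simp add: radius_sq_eq)
      then show ?thesis unfolding K_def by (simp add: add_increasing2)
    qed
    ultimately have "(\<lambda>h. DK (B, s B) (0, h)) = (\<lambda>h. 0)"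
      using BW by (intro differential_zero_maxmin[OF _ V2(1) partial[OF BW(1)]]) auto
    then have "DK (B, s B) (0, E) = 0" for E by metis
    then show ?thesis by (simp add: G_def)
  qed
  \<comment> \<open>The bound \<open>c\<close> holds for the radius near \<open>P0\<close>, where the norm of a difference is at most \<open>exp c\<close> times the distance;
    \<open>a\<close> is the constant that this leaves of the growth \<open>d_AI\<^sup>2 / 2\<close> along the fiber.\<close>
  define c where "c = radius P0 + 1"
  define a where "a = 1 / (2 * (exp c)\<^sup>2)"
  have "exp c \<ge> 1" using radius_nonneg[of P0] by (simp add: c_def)
  then have "(exp c)\<^sup>2 \<ge> 1" by (simp add: one_le_power)
  then have a: "a > 0" "a \<le> 1" by (auto simp: a_def field_simps)
  define k where "k X = K (B0, X)" for X
  have "isCont R (B0, P0)" by (rule real_analytic_at_imp_isCont[OF Ran])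
  moreover have "isCont (\<lambda>X. (B0, X)) P0" by (intro continuous_intros)
  ultimately have "isCont (\<lambda>X. R (B0, X)) P0" by (rule isCont_o2[rotated])
  moreover have "isCont radius_sq (R (B0, P0))"
    using P0 unfolding R0 by (intro real_analytic_at_imp_isCont real_analytic_at_radius_sq)
  ultimately have rcont: "isCont (\<lambda>X. radius_sq (R (B0, X))) P0" by (rule isCont_o2)
  have "radius_sq (R (B0, P0)) < c\<^sup>2"
    unfolding R0 radius_sq_eq[OF P0(2)] c_def using radius_nonneg[of P0] by (intro power_strict_mono) auto
  then have ev: "\<forall>\<^sub>F X in nhds P0. radius_sq (R (B0, X)) < c\<^sup>2"
    using rcont by (intro order_tendstoD(2)[of _ "radius_sq (R (B0, P0))"]) (simp_all add: isCont_def tendsto_nhds_iff)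
  have "\<forall>\<^sub>F X in nhds P0. X \<in> V2" using V2 by (auto simp: eventually_nhds)
  moreover have "open ((\<lambda>X. (B0, X)) -` W)" using W(1) by (intro open_vimage continuous_intros)
  then have "\<forall>\<^sub>F X in nhds P0. (B0, X) \<in> W" using W(2) by (auto simp: eventually_nhds)
  ultimately have "\<forall>\<^sub>F X in nhds P0. radius_sq (R (B0, X)) < c\<^sup>2 \<and> X \<in> V2 \<and> (B0, X) \<in> W"
    using ev by eventually_elim auto
  then obtain e where e: "e > 0" "\<And>X. X \<in> ball P0 e \<Longrightarrow> radius_sq (R (B0, X)) < c\<^sup>2 \<and> X \<in> V2 \<and> (B0, X) \<in> W"
    unfolding eventually_nhds_metric by (auto simp: dist_commute)
  have grow: "k P0 + a / 2 * (norm (X - P0))\<^sup>2 \<le> k X" if X: "X \<in> ball P0 e" for X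
  proof -
    let ?R = "R (B0, X)"
    have Rf: "?R \<in> fiber A B0"
      using fiber_retract_mem[OF B0] V2(3) e(2)[OF X] by (simp add: R_def base_retract_ident[OF B0])
    then have Rs: "?R \<in> spd" by (auto simp: fiber_def spd1_spd)
    have c0: "c \<ge> 0" using radius_nonneg[of P0] by (simp add: c_def)
    have "(radius ?R)\<^sup>2 \<le> c\<^sup>2" using e(2)[OF X] radius_sq_eq[OF Rs] by simp
    then have "radius ?R \<le> c" using c0 by (rule power2_le_imp_le)
    then have "norm (P0 - ?R) \<le> exp c * d_AI P0 ?R"
      using P0 Rs by (intro norm_diff_le_d_AI) (auto simp: c_def)
    then have "(norm (P0 - ?R))\<^sup>2 \<le> (exp c)\<^sup>2 * (d_AI P0 ?R)\<^sup>2"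
      unfolding power_mult_distrib[symmetric] by (intro power_mono) auto
    then have "a * (norm (P0 - ?R))\<^sup>2 \<le> (d_AI P0 ?R)\<^sup>2 / 2"
      by (simp add: a_def field_simps)
    moreover have "(radius P0)\<^sup>2 + (d_AI P0 ?R)\<^sup>2 / 2 \<le> (radius ?R)\<^sup>2"
      using min[OF B0] Rf unfolding P0' by (intro minimizer_growth) auto
    moreover have "a * (norm (X - ?R))\<^sup>2 \<le> (norm (X - ?R))\<^sup>2"
      using a by (intro mult_left_le_one_le) auto
    moreover have "a / 2 * (norm (X - P0))\<^sup>2 \<le> a * (norm (P0 - ?R))\<^sup>2 + a * (norm (X - ?R))\<^sup>2"
    proof -
      have "norm (X - P0) \<le> norm (X - ?R) + norm (P0 - ?R)"
        using norm_triangle_ineq4[of "X - ?R" "P0 - ?R"] by simp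
      then have "(norm (X - P0))\<^sup>2 \<le> (norm (X - ?R) + norm (P0 - ?R))\<^sup>2" by (intro power_mono) auto
      also have "\<dots> \<le> 2 * (norm (X - ?R))\<^sup>2 + 2 * (norm (P0 - ?R))\<^sup>2"
        using zero_le_power2[of "norm (X - ?R) - norm (P0 - ?R)"] by (simp add: power2_diff power2_sum)
      finally have "a / 2 * (norm (X - P0))\<^sup>2 \<le> a / 2 * (2 * (norm (X - ?R))\<^sup>2 + 2 * (norm (P0 - ?R))\<^sup>2)"
        using a by (intro mult_left_mono) auto
      then show ?thesis by (simp add: algebra_simps)
    qed
    moreover have "k X = (radius ?R)\<^sup>2 + (norm (X - ?R))\<^sup>2"
      by (simp add: k_def K_def radius_sq_eq[OF Rs] power2_norm_eq_inner)
    moreover have "k P0 = (radius P0)\<^sup>2"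
      by (simp add: k_def K_def R0 radius_sq_eq[OF P0(2)])
    ultimately show ?thesis by linarith
  qed
  obtain D where D: "(G has_derivative D) (at (B0, P0))"
    using real_analytic_at_imp_derivative[OF Gan] by blast
  have inj: "v = 0" if v: "D (0, v) = 0" for v
  proof (rule quadratic_growth_imp_injective_hessian[OF e(1), of "a / 2" P0 k "\<lambda>X. G (B0, X)" "\<lambda>h. D (0, h)"])
    show "(k has_derivative (\<lambda>h. G (B0, X) \<bullet> h)) (at X)" if "X \<in> ball P0 e" for X
      using partial[of B0 X] G_inner[of B0 X] e(2)[OF that] by (simp add: k_def[abs_def])
    have "((\<lambda>X. (B0, X)) has_derivative (\<lambda>h. (0, h))) (at P0)" by (intro derivative_intros)
    from has_derivative_compose[OF this D] show "((\<lambda>X. G (B0, X)) has_derivative (\<lambda>h. D (0, h))) (at P0)" .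
  qed (use a grow v in auto)
  have "real_analytic_at s B0"
    by (rule real_analytic_at_implicit[of G B0 s D "V1' \<inter> V3"])
      (use Gan D inj s_cont V1' V3 crit in \<open>auto simp: P0_def\<close>)
  then show ?thesis by (simp add: s_def[abs_def])
qed

theorem nearest_analytic: "real_analytic_on (nearest A) (base A)" "real_analytic_on (\<lambda>B. (cost A B)\<^sup>2) (base A)"
proof -
  let ?s = "\<lambda>B. nearest A (base_retract B)"
  show "real_analytic_on (nearest A) (base A)"
  proof (rule real_analytic_onI)
    fix B assume "B \<in> base A"
    then show "\<exists>g W. real_analytic_at g B \<and> open W \<and> B \<in> W \<and> (\<forall>y\<in>base A \<inter> W. nearest A y = g y)"
      using real_analytic_at_nearest base_retract_ident by (intro exI[of _ ?s] exI[of _ UNIV]) auto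
  qed
  show "real_analytic_on (\<lambda>B. (cost A B)\<^sup>2) (base A)"
  proof (rule real_analytic_onI)
    fix B assume B: "B \<in> base A"
    have spd: "nearest A B \<in> spd" if "B \<in> base A" for B
      using nearest_minimizes(1)[OF fiber_nonempty[OF that]] by (auto simp: fiber_def spd1_spd)
    have "real_analytic_at (\<lambda>B. radius_sq (?s B)) B"
      using spd[OF B] B by (intro real_analytic_at_compose[OF real_analytic_at_nearest[OF B]] real_analytic_at_radius_sq)
        (simp add: base_retract_ident)
    moreover have "(cost A B)\<^sup>2 = radius_sq (?s B)" if "B \<in> base A" for B
      using spd[OF that] by (simp add: cost_def base_retract_ident[OF that] radius_sq_eq)
    ultimately show "\<exists>g W. real_analytic_at g B \<and> open W \<and> B \<in> W \<and> (\<forall>y\<in>base A \<inter> W. (cost A y)\<^sup>2 = g y)"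
      by (intro exI[of _ "\<lambda>B. radius_sq (?s B)"] exI[of _ UNIV]) auto
  qed
qed

end

section \<open>Equivariance\<close>

lemma fiber_right_mult:
  fixes A :: "real^'m^'d"
  assumes "invertible D"
  shows "fiber (A ** D) (B ** D) = fiber A B"
proof -
  have "P ** (A ** D) = B ** D \<longleftrightarrow> P ** A = B" for P
  proof
    assume "P ** (A ** D) = B ** D"
    then have "P ** A ** (D ** matrix_inv D) = B ** (D ** matrix_inv D)" by (simp add: matrix_mul_assoc)
    then show "P ** A = B" using assms by (simp add: matrix_inv_right)
  qed (simp add: matrix_mul_assoc)
  then show ?thesis by (simp add: fiber_def act_def)
qed

lemma radius_orth_conj:
  fixes R P :: "real^'d^'d"
  assumes "orth R" "P \<in> spd"
  shows "radius (R ** P ** transpose R) = radius P"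
proof -
  have "R ** mat 1 ** transpose R = mat 1" using assms by (simp add: orth_def)
  then show ?thesis
    unfolding radius_def using d_AI_congruence[OF orth_invertible[OF assms(1)] mat_1_spd assms(2)] by (simp only:)
qed

lemma fiber_orth_conj:
  fixes A :: "real^'m^'d" and R :: "real^'d^'d"
  assumes R: "orth R" and P: "P \<in> fiber A B"
  shows "R ** P ** transpose R \<in> fiber (R ** A) (R ** B)"
proof -
  have P': "P \<in> spd" "det P = 1" "P ** A = B" using P by (auto simp: fiber_def spd1_def act_def)
  have "R ** P ** transpose R ** (R ** A) = R ** B"
    using R P'(3) by (simp add: matrix_mul_assoc[symmetric] orth_def matrix_cancel)
  then show ?thesis
    using det_orth_conj[OF R P'(1)] P' congruence_spd[OF orth_invertible[OF R] P'(1)]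
    by (simp add: fiber_def spd1_def act_def)
qed

lemma nearest_orth_conj:
  fixes A :: "real^'m^'d" and R :: "real^'d^'d"
  assumes R: "orth R" and ne: "fiber A B \<noteq> {}"
  shows "nearest (R ** A) (R ** B) = R ** nearest A B ** transpose R"
proof (rule nearest_eqI)
  let ?s = "nearest A B"
  have s: "?s \<in> fiber A B" by (rule nearest_minimizes(1)[OF ne])
  then show "R ** ?s ** transpose R \<in> fiber (R ** A) (R ** B)" by (rule fiber_orth_conj[OF R])
  fix P assume P: "P \<in> fiber (R ** A) (R ** B)"
  define P' where "P' = transpose R ** P ** transpose (transpose R)"
  have "P' \<in> fiber (transpose R ** (R ** A)) (transpose R ** (R ** B))"
    unfolding P'_def by (rule fiber_orth_conj[OF orth_transpose[OF R] P])
  then have "P' \<in> fiber A B" using R by (simp add: matrix_cancel orth_def)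
  then have "radius ?s \<le> radius P'" by (rule nearest_minimizes(2)[OF ne])
  moreover have "P \<in> spd" "?s \<in> spd" using P s by (auto simp: fiber_def spd1_spd)
  ultimately show "radius (R ** ?s ** transpose R) \<le> radius P"
    using radius_orth_conj[OF R] radius_orth_conj[OF orth_transpose[OF R]] by (simp add: P'_def)
qed

theorem theorem5:
  fixes A :: "real^'m^'d"
  assumes "CARD('m) < CARD('d)"
    and "CARD('n::finite) = CARD('d) - CARD('m)"
    and "rank A = CARD('m)"
  shows
    "(\<forall>U C (V :: real^'n^'d). thin_qr_completion A U C V \<longrightarrow>
        analytic_diffeo (base A \<times> spd1) spd1 (Phi A U C V) \<and>
        (\<forall>B\<in>base A. \<forall>\<Sigma>\<in>spd1. act A (Phi A U C V (B, \<Sigma>)) = B)) \<and>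
     analytically_diffeomorphic (spd1 :: (real^'d^'d) set) (base A \<times> (spd1 :: (real^'n^'n) set)) \<and>
     analytically_diffeomorphic (base A) ((spd :: (real^'m^'m) set) \<times> (UNIV :: (real^'m^'n) set)) \<and>
     (\<forall>B\<in>base A.
        fiber A B \<noteq> {} \<and>
        closedin (top_of_set spd1) (fiber A B) \<and>
        totally_geodesic spd1 (fiber A B) \<and>
        (\<exists>f. airm_isometry (spd1 :: (real^'n^'n) set) (fiber A B) f \<and>
           (\<forall>\<Sigma>\<in>spd1. \<forall>\<Sigma>'\<in>spd1. d_AI (f \<Sigma>) (f \<Sigma>') = d_AI \<Sigma> \<Sigma>'))) \<and>
     (\<forall>B\<in>base A. \<exists>!P. is_arg_min radius (\<lambda>P. P \<in> fiber A B) P) \<and>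
     real_analytic_on (nearest A) (base A) \<and>
     real_analytic_on (\<lambda>B. (cost A B)\<^sup>2) (base A) \<and>
     (\<forall>(D :: real^'m^'m) (R :: real^'d^'d). \<forall>B\<in>base A.
        invertible D \<and> orthogonal_matrix R \<longrightarrow>
        nearest (A ** D) (B ** D) = nearest A B \<and>
        nearest (R ** A) (R ** B) = R ** nearest A B ** transpose R)"
proof -
  have is_frame: "qr_frame A U C V" if "thin_qr_completion A U C V" for U C and V :: "real^'n^'d"
    using that by unfold_locales
  obtain U C and V :: "real^'n^'d" where "thin_qr_completion A U C V"
    using thin_qr_completion_exists[OF assms] by blast
  then interpret qr_frame A U C V by (rule is_frame)
  show ?thesis
  proof (intro conjI allI ballI impI)
    fix U C and V :: "real^'n^'d"
    assume "thin_qr_completion A U C V"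
    then interpret F: qr_frame A U C V by (rule is_frame)
    show "analytic_diffeo (base A \<times> spd1) spd1 (Phi A U C V)" by (rule F.Phi_diffeo)
    fix B and \<Sigma> :: "real^'n^'n"
    assume "B \<in> base A"
    then show "act A (Phi A U C V (B, \<Sigma>)) = B" by (rule F.act_Phi)
  next
    fix B assume B: "B \<in> base A"
    show "fiber A B \<noteq> {}" "closedin (top_of_set spd1) (fiber A B)" "totally_geodesic spd1 (fiber A B)"
      by (rule fiber_nonempty[OF B], rule closedin_fiber, rule totally_geodesic_fiber)
    show "\<exists>f. airm_isometry (spd1 :: (real^'n^'n) set) (fiber A B) f \<and>
        (\<forall>\<Sigma>\<in>spd1. \<forall>\<Sigma>'\<in>spd1. d_AI (f \<Sigma>) (f \<Sigma>') = d_AI \<Sigma> \<Sigma>')"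
      using fiber_isometry[OF B] by blast
    show "\<exists>!P. is_arg_min radius (\<lambda>P. P \<in> fiber A B) P"
      by (rule ex1_minimizer[OF fiber_nonempty[OF B]])
  next
    fix D :: "real^'m^'m" and R :: "real^'d^'d" and B
    assume B: "B \<in> base A" and DR: "invertible D \<and> orthogonal_matrix R"
    show "nearest (A ** D) (B ** D) = nearest A B"
      using DR by (simp add: nearest_def fiber_right_mult)
    show "nearest (R ** A) (R ** B) = R ** nearest A B ** transpose R"
      using DR by (intro nearest_orth_conj fiber_nonempty B) (simp add: orth_square)
  qed (fact spd1_diffeomorphic base_diffeomorphic nearest_analytic)+
qed

end
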